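(* Let $H$ satisfy (C3), (CNH), (CVX). Fix $T>0$ and a Lipschitz $W:\mathbb{R}\to\mathbb{R}$ with $I^{HJ}_T(W)\neq\emptyset$, and let $U_o^*(x)=\sup\{W(q(T))-\int_0^TL(q(s),\dot q(s))\,ds:\ q\in\mathcal{R}_T,\ q(0)=x\}$. Then for every Lipschitz $U_o:\mathbb{R}\to\mathbb{R}$: $U_o\in I^{HJ}_T(W)$ if and only if (i) $U_o\ge U_o^*$ on $\mathbb{R}$ and (ii) $U_o=U_o^*$ on $\overline{\pi_{W'}(\mathbb{R})}$.
   Context: (C3) $H\in C^3(\mathbb{R}^2;\mathbb{R})$; (CNH) there exists $X>0$ with $\partial_xH(x,p)=0$ whenever $|x|\ge X$; (CVX) for each $x$, $p\mapsto\partial_pH(x,p)$ is an increasing $C^1$-diffeomorphism of $\mathbb{R}$ onto itself. $L(x,v)=\sup_p(pv-H(x,p))$. (HS): $\dot q=\partial_pH(q,p)$, $\dot p=-\partial_xH(q,p)$ (solutions are global). $\mathcal{R}_T$: the $q\in C^1([0,T])$ such that some $p\in C^1([0,T])$ makes $(q,p)$ solve (HS). $S^{HJ}_TU_o$: viscosity solution at time $T$ of $\partial_tU+H(x,\partial_xU)=0$, $U(0)=U_o$; $I^{HJ}_T(W)=\{U_o\text{ Lipschitz}: S^{HJ}_TU_o=W\}$. When $I^{HJ}_T(W)\ne\emptyset$, $W'$ has left traces everywhere and $\pi_{W'}(x)=q(0)$ where $(q,p)$ solves (HS) with $q(T)=x$, $p(T)=W'(x-)$. *)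

theory Defs
  imports "HOL-Analysis.Analysis"
begin

definition d1 :: "(real \<Rightarrow> real \<Rightarrow> real) \<Rightarrow> real \<Rightarrow> real \<Rightarrow> real" where
  "d1 f a b = deriv (\<lambda>y. f y b) a"
definition d2 :: "(real \<Rightarrow> real \<Rightarrow> real) \<Rightarrow> real \<Rightarrow> real \<Rightarrow> real" where
  "d2 f a b = deriv (\<lambda>y. f a y) b"

fun Ck :: "nat \<Rightarrow> (real \<Rightarrow> real \<Rightarrow> real) \<Rightarrow> bool" where
  "Ck 0 f = continuous_on UNIV (\<lambda>z. f (fst z) (snd z))"
| "Ck (Suc k) f = (continuous_on UNIV (\<lambda>z. f (fst z) (snd z)) \<and>
     (\<forall>a b. ((\<lambda>y. f y b) has_real_derivative d1 f a b) (at a)) \<and>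
     (\<forall>a b. ((\<lambda>y. f a y) has_real_derivative d2 f a b) (at b)) \<and>
     Ck k (d1 f) \<and> Ck k (d2 f))"

definition hyp_C3 :: "(real \<Rightarrow> real \<Rightarrow> real) \<Rightarrow> bool" where
  "hyp_C3 H = Ck 3 H"

definition hyp_CNH :: "(real \<Rightarrow> real \<Rightarrow> real) \<Rightarrow> bool" where
  "hyp_CNH H = (\<exists>X>0. \<forall>x p. \<bar>x\<bar> \<ge> X \<longrightarrow> d1 H x p = 0)"

definition hyp_CVX :: "(real \<Rightarrow> real \<Rightarrow> real) \<Rightarrow> bool" where
  "hyp_CVX H = (\<forall>x. strict_mono (d2 H x) \<and> bij (d2 H x) \<and>
     (d2 H x) C1_differentiable_on UNIV \<and> (inv (d2 H x)) C1_differentiable_on UNIV)"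

definition Lag :: "(real \<Rightarrow> real \<Rightarrow> real) \<Rightarrow> real \<Rightarrow> real \<Rightarrow> real" where
  "Lag H x v = (SUP p. p * v - H x p)"

definition hs_sol :: "(real \<Rightarrow> real \<Rightarrow> real) \<Rightarrow> real \<Rightarrow> (real \<Rightarrow> real) \<Rightarrow> (real \<Rightarrow> real) \<Rightarrow> bool" where
  "hs_sol H T q p = (\<forall>t\<in>{0..T}.
     (q has_real_derivative d2 H (q t) (p t)) (at t within {0..T}) \<and>
     (p has_real_derivative - d1 H (q t) (p t)) (at t within {0..T}))"

definition RT :: "(real \<Rightarrow> real \<Rightarrow> real) \<Rightarrow> real \<Rightarrow> (real \<Rightarrow> real) set" where
  "RT H T = {q. \<exists>p. hs_sol H T q p}"

definition action :: "(real \<Rightarrow> real \<Rightarrow> real) \<Rightarrow> real \<Rightarrow> (real \<Rightarrow> real) \<Rightarrow> real" where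
  "action H T q = integral {0..T} (\<lambda>s. Lag H (q s) (vector_derivative q (at s within {0..T})))"

definition Ustar :: "(real \<Rightarrow> real \<Rightarrow> real) \<Rightarrow> real \<Rightarrow> (real \<Rightarrow> real) \<Rightarrow> real \<Rightarrow> real" where
  "Ustar H T W x = (SUP q \<in> {q \<in> RT H T. q 0 = x}. W (q T) - action H T q)"

text \<open>Viscosity sub-/supersolutions of U_t + H(x, U_x) = 0 on (0,T) x R, with
  C^1 test functions phi(t,x) (first argument time).\<close>
definition loc_max_on :: "(real \<Rightarrow> real \<Rightarrow> real) \<Rightarrow> real \<Rightarrow> real \<Rightarrow> real \<Rightarrow> bool" where
  "loc_max_on f T t x = (\<exists>e>0. \<forall>s y. s \<in> {0<..<T} \<and> dist (s, y) (t, x) < e \<longrightarrow> f s y \<le> f t x)"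

definition visc_sub :: "(real \<Rightarrow> real \<Rightarrow> real) \<Rightarrow> real \<Rightarrow> (real \<Rightarrow> real \<Rightarrow> real) \<Rightarrow> bool" where
  "visc_sub H T U = (\<forall>\<phi> t x. Ck 1 \<phi> \<and> t \<in> {0<..<T} \<and>
      loc_max_on (\<lambda>s y. U s y - \<phi> s y) T t x \<longrightarrow> d1 \<phi> t x + H x (d2 \<phi> t x) \<le> 0)"

definition visc_super :: "(real \<Rightarrow> real \<Rightarrow> real) \<Rightarrow> real \<Rightarrow> (real \<Rightarrow> real \<Rightarrow> real) \<Rightarrow> bool" where
  "visc_super H T U = (\<forall>\<phi> t x. Ck 1 \<phi> \<and> t \<in> {0<..<T} \<and>
      loc_max_on (\<lambda>s y. \<phi> s y - U s y) T t x \<longrightarrow> d1 \<phi> t x + H x (d2 \<phi> t x) \<ge> 0)"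

definition visc_sol :: "(real \<Rightarrow> real \<Rightarrow> real) \<Rightarrow> real \<Rightarrow> (real \<Rightarrow> real) \<Rightarrow> (real \<Rightarrow> real \<Rightarrow> real) \<Rightarrow> bool" where
  "visc_sol H T Uo U = ((\<exists>C. C-lipschitz_on ({0..T} \<times> UNIV) (\<lambda>z. U (fst z) (snd z))) \<and>
     (\<forall>x. U 0 x = Uo x) \<and> visc_sub H T U \<and> visc_super H T U)"

definition is_lipschitz :: "(real \<Rightarrow> real) \<Rightarrow> bool" where
  "is_lipschitz f = (\<exists>C. C-lipschitz_on UNIV f)"

definition IHJ :: "(real \<Rightarrow> real \<Rightarrow> real) \<Rightarrow> real \<Rightarrow> (real \<Rightarrow> real) \<Rightarrow> (real \<Rightarrow> real) set" where
  "IHJ H T W = {Uo. is_lipschitz Uo \<and> (\<exists>U. visc_sol H T Uo U \<and> U T = W)}"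

definition left_trace :: "(real \<Rightarrow> real) \<Rightarrow> real \<Rightarrow> real" where
  "left_trace W x = (THE l. ((\<lambda>y. deriv W y) \<longlongrightarrow> l)
      (at x within ({..<x} \<inter> {y. W differentiable (at y)})))"

definition piW :: "(real \<Rightarrow> real \<Rightarrow> real) \<Rightarrow> real \<Rightarrow> (real \<Rightarrow> real) \<Rightarrow> real \<Rightarrow> real" where
  "piW H T W x = (THE y. \<exists>q p. hs_sol H T q p \<and> q T = x \<and> p T = left_trace W x \<and> q 0 = y)"

end

theory Submission
  imports Defs
begin

text \<open>For Lipschitz \<open>Uo\<close> the value function \<open>V t x\<close>, the minimum of \<open>Uo (q 0)\<close> plus the action over
  curves ending in \<open>x\<close>, is attained by a Hamiltonian orbit: minimisers of the time-discretised action
  are orbits of a symplectic Euler scheme, whose momenta stay bounded by near-conservation of the energy,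
  and they converge to a solution of the Hamiltonian system.  Deforming minimisers shows that \<open>V\<close> is
  semiconcave, Lipschitz and a viscosity solution; by comparison it is the only one.

  If \<open>Uo\<close> evolves into \<open>W\<close>, then \<open>W (q T) - action \<le> Uo (q 0)\<close> along every orbit, with equality along the
  orbit that ends in \<open>x\<close> with momentum \<open>W'(x-)\<close>; compactness extends equality to the closure of the
  feet of these orbits.  Conversely the inequality gives \<open>V T \<ge> W\<close>, and equality on the feet gives
  \<open>V T \<le> W\<close> by using those orbits as competitors.\<close>

section \<open>Continuously differentiable functions of two variables\<close>

text \<open>Nothing is assumed about the growth of \<open>H\<close> beyond surjectivity of
  \<open>d2 H x\<close>, and the momenta of minimisers have no a priori bound. Estimates are
  therefore made on strips |p| \<le> B. Taking the Legendre supremum over a strip gives a Lagrangian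
  of linear growth with slope \<open>B\<close>; such functionals lack compactness on spaces of
  curves, which is why minimisers are sought with finitely many nodes, where compactness is
  elementary. The constants form one chain: the Lipschitz constant \<open>K\<close> of the datum
  bounds the initial momentum, hence the energy by \<open>E\<close>; the sublevel set of
  \<open>E + 1\<close> gives the momentum bound \<open>R\<close>; and \<open>B\<close> exceeds
  \<open>R\<close> by at least 1, so that the truncation never acts on a minimiser. All bounds are
  uniform in \<open>x\<close> because \<open>H\<close> depends on \<open>x\<close> only through its
  projection to a compact interval.

  Semiconcavity replaces differentiability throughout: stationarity of discrete minimisers, the
  Lipschitz bound and the subsolution property of the value function, and the left limits of slopes
  are all read off from quadratic upper bounds.\<close>

lemma Ck_mono: "Ck (Suc k) f \<Longrightarrow> Ck k f"
proof (induction k arbitrary: f)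
  case 0
  then show ?case by simp
next
  case (Suc k)
  from Suc.prems show ?case 
    using Suc.IH[of "d1 f"] Suc.IH[of "d2 f"] unfolding Ck.simps(2)[of "Suc k"] Ck.simps(2)[of k f] by blast
qed

lemma Ck_continuous: "Ck k f \<Longrightarrow> continuous_on UNIV (\<lambda>z. f (fst z) (snd z))"
  by (cases k) auto

lemma Ck_1I:
  assumes "\<And>a b. ((\<lambda>y. f y b) has_real_derivative f1 a b) (at a)"
    and "\<And>a b. ((\<lambda>y. f a y) has_real_derivative f2 a b) (at b)"
    and "continuous_on UNIV (\<lambda>z. f (fst z) (snd z))"
    and "continuous_on UNIV (\<lambda>z. f1 (fst z) (snd z))"
    and "continuous_on UNIV (\<lambda>z. f2 (fst z) (snd z))"
  shows "Ck 1 f" and "d1 f = f1" and "d2 f = f2"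
proof -
  show d: "d1 f = f1" "d2 f = f2"
    using assms(1,2) by (auto simp: d1_def d2_def fun_eq_iff intro!: DERIV_imp_deriv)
  show "Ck 1 f"
    using assms by (simp add: d)
qed

lemma Ck_1D:
  assumes "Ck 1 f"
  shows "continuous_on UNIV (\<lambda>z. d1 f (fst z) (snd z))"
    and "continuous_on UNIV (\<lambda>z. d2 f (fst z) (snd z))"
    and "((\<lambda>y. f y b) has_real_derivative d1 f a b) (at a)"
    and "((\<lambda>y. f a y) has_real_derivative d2 f a b) (at b)"
  using assms by auto

text \<open>\<open>Ck\<close> records partial derivatives only; continuity of the partial in the
  second variable combines them into a total derivative, which the chain rule along curves
  requires.\<close>

lemma Ck_1_has_derivative:
  assumes "Ck 1 f"
  shows "((\<lambda>z. f (fst z) (snd z)) has_derivative (\<lambda>h. d1 f a b * fst h + d2 f a b * snd h)) (at (a, b))"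
proof -
  have "((\<lambda>(x, y). f x y) has_derivative
      (\<lambda>(tx, ty). d1 f a b * tx + blinfun_mult_right (d2 f a b) ty)) (at (a, b) within UNIV \<times> UNIV)"
  proof (rule has_derivative_partialsI)
    show "((\<lambda>x. f x b) has_derivative (*) (d1 f a b)) (at a within UNIV)"
      using Ck_1D(3)[OF assms] by (simp add: has_field_derivative_def)
    show "((\<lambda>y. f x y) has_derivative blinfun_apply (blinfun_mult_right (d2 f x y))) (at y within UNIV)" for x y
      using Ck_1D(4)[OF assms] by (simp add: has_field_derivative_def)
    have "continuous_on UNIV (\<lambda>z. blinfun_mult_right (d2 f (fst z) (snd z)))"
      by (rule bounded_linear.continuous_on[OF bounded_linear_blinfun_mult_right Ck_1D(2)[OF assms]])
    then show "continuous (at (a, b) within UNIV \<times> UNIV) (\<lambda>(x, y). blinfun_mult_right (d2 f x y))"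
      by (simp add: continuous_on_eq_continuous_at case_prod_unfold)
  qed auto
  then show ?thesis by (simp add: case_prod_unfold)
qed

lemma Ck_1_chain:
  assumes "Ck 1 f"
    and "(\<alpha> has_real_derivative \<alpha>') (at s within S)" and "(\<beta> has_real_derivative \<beta>') (at s within S)"
  shows "((\<lambda>s. f (\<alpha> s) (\<beta> s)) has_real_derivative
      d1 f (\<alpha> s) (\<beta> s) * \<alpha>' + d2 f (\<alpha> s) (\<beta> s) * \<beta>') (at s within S)"
proof -
  have "((\<lambda>s. (\<alpha> s, \<beta> s)) has_derivative (\<lambda>h. (\<alpha>' * h, \<beta>' * h))) (at s within S)"
    using assms(2,3) by (intro has_derivative_Pair) (simp_all add: has_field_derivative_def)
  from has_derivative_compose[OF this Ck_1_has_derivative[OF assms(1)]]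
  have "((\<lambda>s. f (\<alpha> s) (\<beta> s)) has_derivative
      (\<lambda>h. d1 f (\<alpha> s) (\<beta> s) * (\<alpha>' * h) + d2 f (\<alpha> s) (\<beta> s) * (\<beta>' * h))) (at s within S)"
    by simp
  moreover have "(\<lambda>h. d1 f (\<alpha> s) (\<beta> s) * (\<alpha>' * h) + d2 f (\<alpha> s) (\<beta> s) * (\<beta>' * h))
      = (*) (d1 f (\<alpha> s) (\<beta> s) * \<alpha>' + d2 f (\<alpha> s) (\<beta> s) * \<beta>')"
    by (simp add: fun_eq_iff algebra_simps)
  ultimately show ?thesis by (simp add: has_field_derivative_def)
qed

lemma MVT_abs_le:
  fixes f f' :: "real \<Rightarrow> real"
  assumes "convex S" "a \<in> S" "b \<in> S"
    and "\<And>x. x \<in> S \<Longrightarrow> (f has_real_derivative f' x) (at x within S)"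
    and "\<And>x. x \<in> S \<Longrightarrow> \<bar>f' x\<bar> \<le> c"
  shows "\<bar>f b - f a\<bar> \<le> c * \<bar>b - a\<bar>"
  using field_differentiable_bound[of S f f' c b a] assms by auto

lemma box_lipschitz:
  fixes f f1 f2 :: "real \<Rightarrow> real \<Rightarrow> real"
  assumes d1: "\<And>x p. ((\<lambda>y. f y p) has_real_derivative f1 x p) (at x)"
    and d2: "\<And>x p. ((\<lambda>y. f x y) has_real_derivative f2 x p) (at p)"
    and b1: "\<And>x p. x \<in> S \<Longrightarrow> p \<in> P \<Longrightarrow> \<bar>f1 x p\<bar> \<le> c"
    and b2: "\<And>x p. x \<in> S \<Longrightarrow> p \<in> P \<Longrightarrow> \<bar>f2 x p\<bar> \<le> c"
    and S: "convex S" "convex P" and x: "x \<in> S" "x' \<in> S" "p \<in> P" "p' \<in> P"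
  shows "\<bar>f x p - f x' p'\<bar> \<le> c * (\<bar>x - x'\<bar> + \<bar>p - p'\<bar>)"
proof -
  have "\<bar>f x p - f x' p\<bar> \<le> c * \<bar>x - x'\<bar>"
    by (rule MVT_abs_le[where S=S and f'="\<lambda>y. f1 y p"])
       (use S x b1 has_field_derivative_at_within[OF d1] in auto)
  moreover have "\<bar>f x' p - f x' p'\<bar> \<le> c * \<bar>p - p'\<bar>"
    by (rule MVT_abs_le[where S=P and f'="\<lambda>y. f2 x' y"])
       (use S x b2 has_field_derivative_at_within[OF d2] in auto)
  ultimately show ?thesis by (simp add: distrib_left)
qed

lemma continuous_box_bounded:
  fixes f :: "real \<Rightarrow> real \<Rightarrow> real"
  assumes "continuous_on UNIV (\<lambda>z. f (fst z) (snd z))"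
  obtains c where "c > 0" "\<forall>x \<in> {a..b}. \<forall>p \<in> {a'..b'}. \<bar>f x p\<bar> \<le> c"
proof -
  have "compact ((\<lambda>z. f (fst z) (snd z)) ` ({a..b} \<times> {a'..b'}))"
    by (intro compact_continuous_image compact_Times compact_Icc continuous_on_subset[OF assms]) auto
  then have "bounded ((\<lambda>z. f (fst z) (snd z)) ` ({a..b} \<times> {a'..b'}))"
    by (rule compact_imp_bounded)
  then obtain c where "c > 0" "\<forall>y \<in> (\<lambda>z. f (fst z) (snd z)) ` ({a..b} \<times> {a'..b'}). norm y \<le> c"
    by (meson bounded_pos)
  then show ?thesis by (intro that[of c]) auto
qed

section \<open>Uniform bounds for the Hamiltonian\<close>

locale hamiltonian =
  fixes H :: "real \<Rightarrow> real \<Rightarrow> real"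
  assumes C3: "hyp_C3 H" and CNH: "hyp_CNH H" and CVX: "hyp_CVX H"
begin

lemma H_Ck: "Ck 2 (d1 H)" "Ck 2 (d2 H)" "Ck 1 (d1 H)" "Ck 1 (d2 H)"
  and H_C1: "Ck 1 H"
  and H_cont: "continuous_on UNIV (\<lambda>z. H (fst z) (snd z))"
  and H_d1: "((\<lambda>y. H y p) has_real_derivative d1 H x p) (at x)"
  and H_d2: "((\<lambda>y. H x y) has_real_derivative d2 H x p) (at p)"
  using C3 Ck_mono[of 1] by (auto simp: hyp_C3_def numeral_3_eq_3 numeral_2_eq_2)

lemma Hp_mono: "p < p' \<Longrightarrow> d2 H x p < d2 H x p'"
  using CVX by (auto simp: hyp_CVX_def strict_mono_def)

lemma Hp_surj: "\<exists>p. d2 H x p = v"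
proof -
  have "surj (d2 H x)" using CVX by (auto simp: hyp_CVX_def bij_def)
  then show ?thesis by (metis surjD)
qed

text \<open>The inverse of \<open>d2 H x\<close> is differentiable as well, so the two derivatives
  multiply to 1 and neither vanishes; a negative one would contradict monotonicity.\<close>

lemma Hpp_pos: "d2 (d2 H) x p > 0"
proof -
  let ?f = "d2 H x" and ?g = "inv (d2 H x)"
  have bij: "bij ?f" and g: "?g C1_differentiable_on UNIV"
    using CVX by (auto simp: hyp_CVX_def)
  have df: "(?f has_real_derivative d2 (d2 H) x p) (at p)"
    using Ck_1D(4)[OF H_Ck(4)] .
  obtain e where "(?g has_real_derivative e) (at (?f p))"
    using g unfolding C1_differentiable_on_eq real_differentiable_def by blast
  then have "((?g \<circ> ?f) has_real_derivative e * d2 (d2 H) x p) (at p)"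
    using df by (rule DERIV_chain)
  moreover have "?g \<circ> ?f = (\<lambda>x. x)"
    using bij by (auto simp: fun_eq_iff bij_is_inj)
  ultimately have "e * d2 (d2 H) x p = 1"
    using DERIV_unique DERIV_ident by metis
  then have "d2 (d2 H) x p \<noteq> 0" by auto
  moreover have "\<not> d2 (d2 H) x p < 0"
  proof
    assume "d2 (d2 H) x p < 0"
    from DERIV_neg_dec_right[OF df this] obtain d where "d > 0" "\<And>h. 0 < h \<Longrightarrow> h < d \<Longrightarrow> ?f (p + h) < ?f p"
      by auto
    from this(2)[of "d/2"] this(1) Hp_mono[of p "p + d/2" x] show False by auto
  qed
  ultimately show ?thesis by auto
qed

lemma H_convex: "H x p' \<ge> H x p + d2 H x p * (p' - p)"
proof -
  have "convex_on UNIV (H x)"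
    by (rule f''_ge0_imp_convex[where f'="d2 H x" and f''="d2 (d2 H) x"])
       (use H_d2 Ck_1D(4)[OF H_Ck(4)] less_imp_le[OF Hpp_pos] in auto)
  from convex_on_imp_above_tangent[OF this, of p p' "d2 H x p"] H_d2 show ?thesis
    by simp
qed

definition X0 where "X0 = (SOME X. X > 0 \<and> (\<forall>x p. \<bar>x\<bar> \<ge> X \<longrightarrow> d1 H x p = 0))"

lemma X0: "X0 > 0" "\<bar>x\<bar> \<ge> X0 \<Longrightarrow> d1 H x p = 0"
proof -
  have "X0 > 0 \<and> (\<forall>x p. \<bar>x\<bar> \<ge> X0 \<longrightarrow> d1 H x p = 0)"
    unfolding X0_def by (rule someI_ex) (use CNH in \<open>auto simp: hyp_CNH_def\<close>)
  then show "X0 > 0" "\<bar>x\<bar> \<ge> X0 \<Longrightarrow> d1 H x p = 0" by auto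
qed

text \<open>Projection of the position onto \<open>{-X0..X0}\<close>. Since \<open>H\<close> is
  constant in \<open>x\<close> on each side of this interval, \<open>H\<close> and its first
  derivatives factor through \<open>cx\<close>, and estimates over the whole line become estimates
  over a compact set.\<close>

definition cx where "cx x = max (- X0) (min X0 x)"

lemma cx_bounds: "cx x \<in> {-X0..X0}"
  using X0(1) by (auto simp: cx_def)

lemma cx_lip: "\<bar>cx x - cx y\<bar> \<le> \<bar>x - y\<bar>"
  using X0(1) by (auto simp: cx_def)

lemma H_cx: "H x p = H (cx x) p"
proof -
  have *: "H x p = H X p" if "convex S" "x \<in> S" "X \<in> S" "\<And>y. y \<in> S \<Longrightarrow> \<bar>y\<bar> \<ge> X0" for S x X
    using MVT_abs_le[OF that(1-3) has_field_derivative_at_within[OF H_d1], of p 0] X0(2) that(4)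
    by simp
  consider "x \<ge> X0" | "x \<le> -X0" | "\<bar>x\<bar> < X0" by linarith
  then show ?thesis
  proof cases
    case 1
    then show ?thesis using *[of "{X0..}" x X0] X0 by (auto simp: cx_def)
  next
    case 2
    then show ?thesis using *[of "{..-X0}" x "-X0"] X0 by (auto simp: cx_def)
  qed (auto simp: cx_def)
qed

lemma Hp_cx: "d2 H x p = d2 H (cx x) p"
proof -
  have "(\<lambda>y. H x y) = (\<lambda>y. H (cx x) y)" using H_cx by auto
  then show ?thesis unfolding d2_def by simp
qed

lemma Hx_cx: "d1 H x p = d1 H (cx x) p"
proof (cases "\<bar>x\<bar> < X0")
  case False
  then have "\<bar>cx x\<bar> \<ge> X0" by (auto simp: cx_def)
  then show ?thesis using False X0(2) by simp
qed (auto simp: cx_def)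

text \<open>Surjectivity at each position becomes uniform by compactness. A counterexample sequence
  has momenta of unbounded size; monotonicity transfers their small velocities to any fixed
  momentum, while the clamped positions converge along a subsequence.\<close>

lemma Hp_ge_1: "\<exists>P>0. \<forall>x p. p \<ge> P \<longrightarrow> d2 H x p \<ge> 1 \<and> d2 H x (- p) \<le> -1"
proof -
  have cont: "continuous_on UNIV (\<lambda>z. d2 H (fst z) (snd z))"
    using H_Ck Ck_continuous by blast
  \<comment> \<open>The sign \<sigma> treats both ends of the momentum axis in one argument.\<close>
  have key: "\<exists>P. \<forall>x p. p \<ge> P \<longrightarrow> \<sigma> * d2 H x (\<sigma> * p) \<ge> 1" if s: "\<sigma> = 1 \<or> \<sigma> = -1" for \<sigma> :: real
  proof (rule ccontr)
    assume "\<not> ?thesis"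
    then have "\<forall>n::nat. \<exists>x p. p \<ge> real n \<and> \<sigma> * d2 H x (\<sigma> * p) < 1" by (meson not_le)
    then obtain x p where xp: "\<And>n::nat. p n \<ge> real n" "\<And>n. \<sigma> * d2 H (x n) (\<sigma> * p n) < 1"
      by metis
    have "seq_compact {-X0..X0}" by (simp add: compact_imp_seq_compact)
    then obtain l r where l: "l \<in> {-X0..X0}" "strict_mono (r :: nat \<Rightarrow> nat)" "(\<lambda>n. cx (x (r n))) \<longlonglongrightarrow> l"
      by (rule seq_compactE[of _ "\<lambda>n. cx (x n)"]) (use cx_bounds in \<open>auto simp: comp_def\<close>)
    \<comment> \<open>Velocity 2 in direction \<sigma> leaves a margin over the bound 1 that
      survives the limit.\<close>
    obtain p0 where p0: "d2 H l p0 = 2 * \<sigma>" using Hp_surj by blast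
    have "isCont (\<lambda>z. d2 H (fst z) (snd z)) (l, p0)"
      using cont by (simp add: continuous_on_eq_continuous_at)
    then have "(\<lambda>n. d2 H (cx (x (r n))) p0) \<longlonglongrightarrow> d2 H l p0"
      using isCont_tendsto_compose[of "(l,p0)" "\<lambda>z. d2 H (fst z) (snd z)" "\<lambda>n. (cx (x (r n)), p0)"] l
      by (simp add: tendsto_Pair)
    then have lim: "(\<lambda>n. \<sigma> * d2 H (x (r n)) p0) \<longlonglongrightarrow> \<sigma> * (2 * \<sigma>)"
      unfolding p0 using Hp_cx by (intro tendsto_mult) auto
    have ev: "eventually (\<lambda>n. \<sigma> * d2 H (x (r n)) p0 \<le> 1) sequentially"
    proof (rule eventually_sequentiallyI[of "nat \<lceil>\<bar>p0\<bar>\<rceil>"])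
      fix n assume "nat \<lceil>\<bar>p0\<bar>\<rceil> \<le> n"
      then have "\<bar>p0\<bar> \<le> real n" by linarith
      also have "n \<le> r n" using l(2) seq_suble by blast
      then have "real n \<le> real (r n)" by simp
      also have "\<dots> \<le> p (r n)" using xp by auto
      finally have le: "\<bar>p0\<bar> \<le> p (r n)" .
      have "\<sigma> * d2 H (x (r n)) p0 \<le> \<sigma> * d2 H (x (r n)) (\<sigma> * p (r n))"
        using s
      proof
        assume "\<sigma> = 1"
        then show ?thesis using le Hp_mono[of p0 "p (r n)" "x (r n)"]
          by (cases "p0 = p (r n)") (auto simp: less_le)
      next
        assume "\<sigma> = -1"
        then show ?thesis using le Hp_mono[of "- p (r n)" p0 "x (r n)"]
          by (cases "p0 = - p (r n)") (auto simp: less_le)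
      qed
      then show "\<sigma> * d2 H (x (r n)) p0 \<le> 1" using xp(2)[of "r n"] by simp
    qed
    have "\<sigma> * (2 * \<sigma>) \<le> 1"
      using tendsto_upperbound[OF lim ev] by simp
    then show False using s by auto
  qed
  obtain P1 where P1: "\<And>x p. p \<ge> P1 \<Longrightarrow> d2 H x p \<ge> 1" using key[of 1] by auto
  obtain P2 where P2: "\<And>x p. p \<ge> P2 \<Longrightarrow> - d2 H x (- p) \<ge> 1" using key[of "-1"] by auto
  have "d2 H x p \<ge> 1 \<and> d2 H x (- p) \<le> -1" if "p \<ge> max 1 (max P1 P2)" for x p
    using P1[of p x] P2[of p x] that by simp
  then show ?thesis
    by (intro exI[of _ "max 1 (max P1 P2)"]) simp
qed

end

text \<open>What is used of \<open>H\<close> on the strip |p| \<le> B, with one constant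
  \<open>C\<close> for all upper bounds. The level \<open>B\<close> is a parameter because it is
  adapted later to the datum, to a solution or to a given orbit.\<close>

locale ham_box =
  fixes H :: "real \<Rightarrow> real \<Rightarrow> real" and B C m :: real
  assumes B_pos: "B > 0" and C_pos: "C > 0" and m_pos: "m > 0"
    and H_C1: "Ck 1 H"
    and H_d1: "\<And>x p. ((\<lambda>y. H y p) has_real_derivative d1 H x p) (at x)"
    and H_d2: "\<And>x p. ((\<lambda>y. H x y) has_real_derivative d2 H x p) (at p)"
    and H_bound: "\<And>x p. \<bar>p\<bar> \<le> B \<Longrightarrow> \<bar>H x p\<bar> \<le> C"
    and Hx_bound: "\<And>x p. \<bar>p\<bar> \<le> B \<Longrightarrow> \<bar>d1 H x p\<bar> \<le> C"
    and Hp_bound: "\<And>x p. \<bar>p\<bar> \<le> B \<Longrightarrow> \<bar>d2 H x p\<bar> \<le> C"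
    and Hx_lip: "\<And>x p x' p'. \<bar>p\<bar> \<le> B \<Longrightarrow> \<bar>p'\<bar> \<le> B \<Longrightarrow> \<bar>d1 H x p - d1 H x' p'\<bar> \<le> C * (\<bar>x - x'\<bar> + \<bar>p - p'\<bar>)"
    and Hp_lip: "\<And>x p x' p'. \<bar>p\<bar> \<le> B \<Longrightarrow> \<bar>p'\<bar> \<le> B \<Longrightarrow> \<bar>d2 H x p - d2 H x' p'\<bar> \<le> C * (\<bar>x - x'\<bar> + \<bar>p - p'\<bar>)"
    and Hp_strong_mono: "\<And>x p p'. \<bar>p\<bar> \<le> B \<Longrightarrow> \<bar>p'\<bar> \<le> B \<Longrightarrow> p \<le> p' \<Longrightarrow> m * (p' - p) \<le> d2 H x p' - d2 H x p"
    and H_convex: "\<And>x p p'. H x p' \<ge> H x p + d2 H x p * (p' - p)"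

section \<open>Uniform constants on momentum strips\<close>

context hamiltonian
begin

text \<open>Clamping reduces every bound to the compact box of clamped positions and admissible
  momenta. \<open>C\<close> is the sum of seven such bounds; \<open>m\<close> is the minimum of the
  second momentum derivative, positive by \<open>Hpp_pos\<close>.\<close>

lemma ham_box_exists:
  assumes "B > 0"
  shows "\<exists>C m. ham_box H B C m"
proof -
  note cont = Ck_1D(1,2)[OF H_Ck(3)] Ck_1D(1,2)[OF H_Ck(4)] H_cont
    Ck_continuous[OF H_Ck(3)] Ck_continuous[OF H_Ck(4)]
  let ?I = "{-X0..X0}" and ?J = "{-B..B}"
  obtain c1 where c1: "c1 > 0" "\<forall>x\<in>?I. \<forall>p\<in>?J. \<bar>d1 (d1 H) x p\<bar> \<le> c1"
    by (rule continuous_box_bounded[OF cont(1), of "-X0" X0 "-B" B])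
  obtain c2 where c2: "c2 > 0" "\<forall>x\<in>?I. \<forall>p\<in>?J. \<bar>d2 (d1 H) x p\<bar> \<le> c2"
    by (rule continuous_box_bounded[OF cont(2), of "-X0" X0 "-B" B])
  obtain c3 where c3: "c3 > 0" "\<forall>x\<in>?I. \<forall>p\<in>?J. \<bar>d1 (d2 H) x p\<bar> \<le> c3"
    by (rule continuous_box_bounded[OF cont(3), of "-X0" X0 "-B" B])
  obtain c4 where c4: "c4 > 0" "\<forall>x\<in>?I. \<forall>p\<in>?J. \<bar>d2 (d2 H) x p\<bar> \<le> c4"
    by (rule continuous_box_bounded[OF cont(4), of "-X0" X0 "-B" B])
  obtain c5 where c5: "c5 > 0" "\<forall>x\<in>?I. \<forall>p\<in>?J. \<bar>H x p\<bar> \<le> c5"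
    by (rule continuous_box_bounded[OF cont(5), of "-X0" X0 "-B" B])
  obtain c6 where c6: "c6 > 0" "\<forall>x\<in>?I. \<forall>p\<in>?J. \<bar>d1 H x p\<bar> \<le> c6"
    by (rule continuous_box_bounded[OF cont(6), of "-X0" X0 "-B" B])
  obtain c7 where c7: "c7 > 0" "\<forall>x\<in>?I. \<forall>p\<in>?J. \<bar>d2 H x p\<bar> \<le> c7"
    by (rule continuous_box_bounded[OF cont(7), of "-X0" X0 "-B" B])
  note c1 = c1(1) c1(2)[rule_format] and c2 = c2(1) c2(2)[rule_format] and c3 = c3(1) c3(2)[rule_format]
    and c4 = c4(1) c4(2)[rule_format] and c5 = c5(1) c5(2)[rule_format]
    and c6 = c6(1) c6(2)[rule_format] and c7 = c7(1) c7(2)[rule_format]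
  define C where "C = c1 + c2 + c3 + c4 + c5 + c6 + c7"
  have C: "C > 0" "c1 \<le> C" "c2 \<le> C" "c3 \<le> C" "c4 \<le> C" "c5 \<le> C" "c6 \<le> C" "c7 \<le> C"
    using c1 c2 c3 c4 c5 c6 c7 by (auto simp: C_def)
  have J: "p \<in> ?J" if "\<bar>p\<bar> \<le> B" for p using that by auto
  have lip: "C * (\<bar>cx x - cx x'\<bar> + d) \<le> C * (\<bar>x - x'\<bar> + d)" for x x' d
    using C cx_lip[of x x'] by (intro mult_left_mono) auto
  have Hx_lip: "\<bar>d1 H x p - d1 H x' p'\<bar> \<le> C * (\<bar>x - x'\<bar> + \<bar>p - p'\<bar>)" if "\<bar>p\<bar> \<le> B" "\<bar>p'\<bar> \<le> B" for x x' p p'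
    using order_trans[OF box_lipschitz[of "d1 H" "d1 (d1 H)" "d2 (d1 H)" ?I ?J C "cx x" "cx x'" p p'] lip[of x x']]
      Ck_1D(3,4)[OF H_Ck(3)] order_trans[OF c1(2) C(2)] order_trans[OF c2(2) C(3)] cx_bounds J that
    by (simp flip: Hx_cx)
  have Hp_lip: "\<bar>d2 H x p - d2 H x' p'\<bar> \<le> C * (\<bar>x - x'\<bar> + \<bar>p - p'\<bar>)" if "\<bar>p\<bar> \<le> B" "\<bar>p'\<bar> \<le> B" for x x' p p'
    using order_trans[OF box_lipschitz[of "d2 H" "d1 (d2 H)" "d2 (d2 H)" ?I ?J C "cx x" "cx x'" p p'] lip[of x x']]
      Ck_1D(3,4)[OF H_Ck(4)] order_trans[OF c3(2) C(4)] order_trans[OF c4(2) C(5)] cx_bounds J that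
    by (simp flip: Hp_cx)
  have "\<exists>z\<in>?I \<times> ?J. \<forall>y\<in>?I \<times> ?J. d2 (d2 H) (fst z) (snd z) \<le> d2 (d2 H) (fst y) (snd y)"
    using assms X0 by (intro continuous_attains_inf compact_Times continuous_on_subset[OF cont(4)]) auto
  then obtain z where z: "\<And>x p. x \<in> ?I \<Longrightarrow> p \<in> ?J \<Longrightarrow> d2 (d2 H) (fst z) (snd z) \<le> d2 (d2 H) x p"
    by fastforce
  define m where "m = d2 (d2 H) (fst z) (snd z)"
  have sm: "m * (p' - p) \<le> d2 H x p' - d2 H x p" if p: "\<bar>p\<bar> \<le> B" "\<bar>p'\<bar> \<le> B" "p \<le> p'" for x p p'
  proof (cases "p = p'")
    case False
    then have "\<exists>r. p < r \<and> r < p' \<and> d2 H (cx x) p' - d2 H (cx x) p = (p' - p) * d2 (d2 H) (cx x) r"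
      using p Ck_1D(4)[OF H_Ck(4)] by (intro MVT2) auto
    then obtain r where r: "p < r" "r < p'" "d2 H x p' - d2 H x p = (p' - p) * d2 (d2 H) (cx x) r"
      by (auto simp flip: Hp_cx)
    have "m \<le> d2 (d2 H) (cx x) r" unfolding m_def using r p cx_bounds by (intro z) auto
    then have "(p' - p) * m \<le> (p' - p) * d2 (d2 H) (cx x) r"
      using p by (intro mult_left_mono) auto
    then show ?thesis using r by (simp add: mult.commute)
  qed auto
  have "ham_box H B C m"
  proof
    show "B > 0" "C > 0" "m > 0" using assms C Hpp_pos by (auto simp: m_def)
    fix x p :: real assume p: "\<bar>p\<bar> \<le> B"
    show "\<bar>H x p\<bar> \<le> C"
      using c5(2)[OF cx_bounds[of x] J[OF p]] C by (simp flip: H_cx)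
    show "\<bar>d1 H x p\<bar> \<le> C"
      using c6(2)[OF cx_bounds[of x] J[OF p]] C by (simp flip: Hx_cx)
    show "\<bar>d2 H x p\<bar> \<le> C"
      using c7(2)[OF cx_bounds[of x] J[OF p]] C by (simp flip: Hp_cx)
  qed (fact H_C1 H_d1 H_d2 sm H_convex Hx_lip Hp_lip)+
  then show ?thesis by blast
qed

text \<open>By convexity the slopes at \<open>P\<close> and \<open>-P\<close>, at least 1 in modulus
  by \<open>Hp_ge_1\<close>, persist beyond these points, so \<open>H\<close> grows at least
  linearly there; \<open>C\<close> bounds it at the two base points uniformly in
  \<open>x\<close>.\<close>

lemma H_sublevel_bounded: "\<exists>R. \<forall>x p. H x p \<le> E \<longrightarrow> \<bar>p\<bar> \<le> R"
proof -
  obtain P where P: "P > 0" "\<forall>x p. p \<ge> P \<longrightarrow> d2 H x p \<ge> 1 \<and> d2 H x (- p) \<le> -1"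
    using Hp_ge_1 by (elim exE conjE)
  have P1: "1 \<le> d2 H x P" and P2: "d2 H x (- P) \<le> -1" for x
    using P by auto
  obtain C m where "ham_box H P C m" using ham_box_exists[OF P(1)] by blast
  then interpret ham_box H P C m .
  have "\<bar>p\<bar> \<le> P + C + \<bar>E\<bar>" if "H x p \<le> E" for x p
  proof (rule ccontr)
    assume "\<not> ?thesis"
    then have p: "\<bar>p\<bar> > P + C + \<bar>E\<bar>" by simp
    have b1: "\<bar>H x P\<bar> \<le> C" and b2: "\<bar>H x (-P)\<bar> \<le> C" using H_bound P(1) by auto
    show False
    proof (cases "p \<ge> 0")
      case True
      then have "P \<le> p" using p C_pos by linarith
      then have "1 * (p - P) \<le> d2 H x P * (p - P)" using P1[of x] by (intro mult_right_mono) auto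
      from order_trans[OF add_left_mono[OF this] H_convex] have "H x P + 1 * (p - P) \<le> H x p" .
      moreover have "- C \<le> H x P" using b1 by (simp add: abs_le_iff)
      ultimately have "- C + (p - P) \<le> E" using that by simp
      then show False using p True by linarith
    next
      case False
      then have "p \<le> - P" using p C_pos by linarith
      then have "-1 * (p - - P) \<le> d2 H x (-P) * (p - - P)" using P2[of x] by (intro mult_right_mono_neg) auto
      from order_trans[OF add_left_mono[OF this] H_convex] have "H x (-P) + -1 * (p - - P) \<le> H x p" .
      moreover have "- C \<le> H x (-P)" using b2 by (simp add: abs_le_iff)
      ultimately have "- C + (- p - P) \<le> E" using that by simp
      then show False using p False by linarith
    qed
  qed
  then show ?thesis by blast
qed

end

section \<open>Ordinary differential equations\<close>

text \<open>Gronwall's argument for the squared distance \<open>u\<close>, differentiable thanks to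
  the inner product. As |u'| \<le> 2 L u, one exponential weight makes \<open>u\<close> increasing
  and the other makes it decreasing; together they give the estimate in both directions of time, so
  that terminal data determine orbits too.\<close>

lemma ode_continuous_dependence:
  fixes z w :: "real \<Rightarrow> 'a::real_inner"
  assumes F: "\<And>x y. norm (F x - F y) \<le> L * norm (x - y)"
    and z: "\<And>s. s \<in> {a..b} \<Longrightarrow> (z has_vector_derivative F (z s)) (at s within {a..b})"
    and w: "\<And>s. s \<in> {a..b} \<Longrightarrow> (w has_vector_derivative F (w s)) (at s within {a..b})"
    and st: "s \<in> {a..b}" "t \<in> {a..b}"
  shows "norm (z t - w t) \<le> exp (L * \<bar>t - s\<bar>) * norm (z s - w s)"
proof -
  define u where "u = (\<lambda>s. (z s - w s) \<bullet> (z s - w s))"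
  define u' where "u' = (\<lambda>s. 2 * ((z s - w s) \<bullet> (F (z s) - F (w s))))"
  have du: "(u has_real_derivative u' s) (at s within {a..b})" if s: "s \<in> {a..b}" for s
  proof -
    have "((\<lambda>s. z s - w s) has_vector_derivative F (z s) - F (w s)) (at s within {a..b})"
      using z w s by (intro has_vector_derivative_diff) auto
    then have d: "((\<lambda>s. z s - w s) has_derivative (\<lambda>h. h *\<^sub>R (F (z s) - F (w s)))) (at s within {a..b})"
      by (simp add: has_vector_derivative_def)
    have "(u has_derivative (\<lambda>h. u' s * h)) (at s within {a..b})"
      unfolding u_def
      by (rule has_derivative_eq_rhs[OF has_derivative_inner[OF d d]])
         (auto simp: u'_def inner_commute algebra_simps)
    then show ?thesis by (simp add: has_field_derivative_def)
  qed
  have u'_bd: "\<bar>u' s\<bar> \<le> 2 * L * u s" if "s \<in> {a..b}" for s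
  proof -
    have "\<bar>u' s\<bar> \<le> 2 * (norm (z s - w s) * norm (F (z s) - F (w s)))"
      using Cauchy_Schwarz_ineq2[of "z s - w s" "F (z s) - F (w s)"] by (simp add: u'_def)
    also have "\<dots> \<le> 2 * (norm (z s - w s) * (L * norm (z s - w s)))"
      using F[of "z s" "w s"] by (intro mult_left_mono) auto
    also have "\<dots> = 2 * L * u s"
      by (simp add: u_def power2_norm_eq_inner[symmetric] power2_eq_square)
    finally show ?thesis .
  qed
  have u_norm: "u s = (norm (z s - w s))\<^sup>2" for s
    by (simp add: u_def power2_norm_eq_inner)
  have mono: "(\<lambda>s. u s * exp (2 * L * s)) x \<le> (\<lambda>s. u s * exp (2 * L * s)) y"
    "(\<lambda>s. u s * exp (- (2 * L * s))) y \<le> (\<lambda>s. u s * exp (- (2 * L * s))) x"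
    if xy: "x \<in> {a..b}" "y \<in> {a..b}" "x \<le> y" for x y
  proof -
    have d: "(u has_real_derivative u' t) (at t within {x..y})" if "t \<in> {x..y}" for t
      by (rule DERIV_subset[OF du]) (use that xy in auto)
    have "\<exists>t\<in>{x..y}. (\<lambda>s. u s * exp (2 * L * s)) y - (\<lambda>s. u s * exp (2 * L * s)) x
        = (y - x) * (u' t * exp (2 * L * t) + u t * (2 * L * exp (2 * L * t)))"
    proof (cases "x = y")
      case False
      then show ?thesis
        using mvt_very_simple[of x y "\<lambda>s. u s * exp (2 * L * s)"
            "\<lambda>t h. h * (u' t * exp (2 * L * t) + u t * (2 * L * exp (2 * L * t)))"] xy
        by (force intro!: derivative_eq_intros d[unfolded has_field_derivative_def] simp: algebra_simps)
    qed auto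
    then obtain t where t: "t \<in> {x..y}" "u y * exp (2 * L * y) - u x * exp (2 * L * x)
        = (y - x) * ((u' t + 2 * L * u t) * exp (2 * L * t))"
      by (auto simp: algebra_simps)
    have "(y - x) * ((u' t + 2 * L * u t) * exp (2 * L * t)) \<ge> 0"
      using u'_bd[of t] t xy by (intro mult_nonneg_nonneg) auto
    then show "(\<lambda>s. u s * exp (2 * L * s)) x \<le> (\<lambda>s. u s * exp (2 * L * s)) y" using t by simp
    have "\<exists>t\<in>{x..y}. (\<lambda>s. u s * exp (- (2 * L * s))) y - (\<lambda>s. u s * exp (- (2 * L * s))) x
        = (y - x) * (u' t * exp (- (2 * L * t)) - u t * (2 * L * exp (- (2 * L * t))))"
    proof (cases "x = y")
      case False
      then show ?thesis
        using mvt_very_simple[of x y "\<lambda>s. u s * exp (- (2 * L * s))"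
            "\<lambda>t h. h * (u' t * exp (- (2 * L * t)) - u t * (2 * L * exp (- (2 * L * t))))"] xy
        by (force intro!: derivative_eq_intros d[unfolded has_field_derivative_def] simp: algebra_simps)
    qed auto
    then obtain t where t: "t \<in> {x..y}" "u y * exp (- (2 * L * y)) - u x * exp (- (2 * L * x))
        = (y - x) * ((u' t - 2 * L * u t) * exp (- (2 * L * t)))"
      by (auto simp: algebra_simps)
    have "(y - x) * ((u' t - 2 * L * u t) * exp (- (2 * L * t))) \<le> 0"
      using u'_bd[of t] t xy by (intro mult_nonneg_nonpos mult_nonpos_nonneg) auto
    then show "(\<lambda>s. u s * exp (- (2 * L * s))) y \<le> (\<lambda>s. u s * exp (- (2 * L * s))) x" using t by simp
  qed
  have "u t \<le> exp (2 * (L * \<bar>t - s\<bar>)) * u s"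
  proof (cases "s \<le> t")
    case True
    then have "u t * exp (- (2 * L * t)) * exp (2 * L * t) \<le> u s * exp (- (2 * L * s)) * exp (2 * L * t)"
      using mono(2)[of s t] st by (intro mult_right_mono) auto
    then show ?thesis using True by (simp add: mult.assoc flip: exp_add) (simp add: algebra_simps)
  next
    case False
    then have "u t * exp (2 * L * t) * exp (- (2 * L * t)) \<le> u s * exp (2 * L * s) * exp (- (2 * L * t))"
      using mono(1)[of t s] st by (intro mult_right_mono) auto
    then show ?thesis using False by (simp add: mult.assoc flip: exp_add) (simp add: algebra_simps)
  qed
  then have "(norm (z t - w t))\<^sup>2 \<le> (exp (L * \<bar>t - s\<bar>) * norm (z s - w s))\<^sup>2"
    by (simp add: u_norm power_mult_distrib exp_double[symmetric])
  then show ?thesis by (rule power2_le_imp_le) auto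
qed

text \<open>Picard iteration; the weight \<open>exp (2 * L * s)\<close> turns the Picard operator into a
  contraction with factor \<open>1/2\<close> on the whole interval.\<close>
lemma ode_global_existence:
  fixes F :: "'a::euclidean_space \<Rightarrow> 'a"
  assumes F: "\<And>x y. norm (F x - F y) \<le> L * norm (x - y)" and L: "L > 0"
  obtains z where "z 0 = z0" "\<And>s. s \<in> {0..T} \<Longrightarrow> (z has_vector_derivative F (z s)) (at s within {0..T})"
proof (cases "T \<ge> 0")
  case False
  then show ?thesis by (intro that[of "\<lambda>_. z0"]) auto
next
  case T: True
  have contF: "continuous_on S F" for S
  proof -
    have "L-lipschitz_on S F" using F L by (auto intro!: lipschitz_onI simp: dist_norm)
    then show ?thesis by (rule lipschitz_on_continuous_on)
  qed
  define P where "P = (\<lambda>(z :: real \<Rightarrow> 'a) s. z0 + integral {0..s} (\<lambda>r. F (z r)))"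
  define Z where "Z = (\<lambda>n. (P ^^ n) (\<lambda>_. z0))"
  have Z0: "Z 0 = (\<lambda>_. z0)" and ZS: "Z (Suc n) = P (Z n)" for n by (auto simp: Z_def)
  have contFz: "continuous_on {0..T} (\<lambda>r. F (z r))" if "continuous_on {0..T} z" for z
    by (rule continuous_on_compose2[OF contF that subset_UNIV])
  have contP: "continuous_on {0..T} (P z)" if "continuous_on {0..T} z" for z
  proof -
    have "continuous_on {0..T} (\<lambda>s. integral {0..s} (\<lambda>r. F (z r)))"
      by (intro indefinite_integral_continuous_1 integrable_continuous_real contFz that)
    then show ?thesis unfolding P_def by (rule continuous_on_add[OF continuous_on_const])
  qed
  have contZ: "continuous_on {0..T} (Z n)" for n
    by (induction n) (auto simp: Z0 ZS intro: contP)
  have int: "(\<lambda>r. F (z r)) integrable_on {0..s}" if "continuous_on {0..T} z" "s \<in> {0..T}" for z s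
    using that by (intro integrable_continuous_real continuous_on_subset[OF contFz]) auto
  \<comment> \<open>Bounds the first Picard increment, from which the geometric decay
    starts.\<close>
  define D where "D = T * norm (F z0)"
  have D0: "D \<ge> 0" using T by (auto simp: D_def)
  have expint: "((\<lambda>r. c * L * exp (2 * L * r)) has_integral (c/2 * exp (2 * L * s) - c/2 * exp (2 * L * 0))) {0..s}"
    if "s \<ge> 0" for c s
    using that L by (intro fundamental_theorem_of_calculus)
      (auto intro!: derivative_eq_intros simp flip: has_real_derivative_iff_has_vector_derivative)
  have Pdiff: "norm (P z s - P w s) \<le> c/2 * exp (2 * L * s)"
    if cz: "continuous_on {0..T} z" "continuous_on {0..T} w" and s: "s \<in> {0..T}"
      and le: "\<And>r. r \<in> {0..T} \<Longrightarrow> norm (z r - w r) \<le> c * exp (2 * L * r)" and c: "c \<ge> 0" for z w s c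
  proof -
    have "P z s - P w s = integral {0..s} (\<lambda>r. F (z r) - F (w r))"
      using int cz s by (simp add: P_def integral_diff)
    also have "norm \<dots> \<le> integral {0..s} (\<lambda>r. c * L * exp (2 * L * r))"
    proof (rule integral_norm_bound_integral)
      show "(\<lambda>r. F (z r) - F (w r)) integrable_on {0..s}"
        using int cz s by (intro integrable_diff) auto
      show "(\<lambda>r. c * L * exp (2 * L * r)) integrable_on {0..s}"
        using expint s by (meson atLeastAtMost_iff has_integral_integrable)
      fix r assume r: "r \<in> {0..s}"
      have "norm (F (z r) - F (w r)) \<le> L * norm (z r - w r)" by (rule F)
      also have "\<dots> \<le> L * (c * exp (2 * L * r))" using le[of r] r s L by (intro mult_left_mono) auto
      finally show "norm (F (z r) - F (w r)) \<le> c * L * exp (2 * L * r)" by (simp add: mult_ac)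
    qed
    also have "\<dots> \<le> c/2 * exp (2 * L * s)"
      using integral_unique[OF expint[of s c]] s c by simp
    finally show ?thesis .
  qed
  have step: "norm (Z (Suc n) s - Z n s) \<le> D / 2 ^ n * exp (2 * L * s)" if "s \<in> {0..T}" for n s
    using that
  proof (induction n arbitrary: s)
    case 0
    then have "norm (Z (Suc 0) s - Z 0 s) = s * norm (F z0)"
      by (simp add: ZS Z0 P_def)
    also have "\<dots> \<le> D * 1" using 0 by (auto simp: D_def intro!: mult_right_mono)
    also have "\<dots> \<le> D * exp (2 * L * s)" using 0 L D0 by (intro mult_left_mono) auto
    finally show ?case by simp
  next
    case (Suc n)
    have "norm (P (Z (Suc n)) s - P (Z n) s) \<le> (D / 2 ^ n) / 2 * exp (2 * L * s)"
      using Suc D0 by (intro Pdiff contZ) auto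
    then show ?case by (simp add: ZS mult.commute)
  qed
  define E where "E = exp (2 * L * T)"
  have E: "exp (2 * L * s) \<le> E" if "s \<in> {0..T}" for s using that L by (auto simp: E_def)
  have "uniformly_convergent_on {0..T} (\<lambda>n s. \<Sum>i<n. Z (Suc i) s - Z i s)"
  proof (rule Weierstrass_m_test'[where M="\<lambda>n. D / 2 ^ n * E"])
    fix n s assume s: "s \<in> {0..T}"
    have "D / 2 ^ n * exp (2 * L * s) \<le> D / 2 ^ n * E"
      using E s D0 by (intro mult_left_mono) auto
    then show "norm (Z (Suc n) s - Z n s) \<le> D / 2 ^ n * E" using step[OF s, of n] by simp
  next
    show "summable (\<lambda>n. D / 2 ^ n * E)"
      using summable_mult[OF summable_geometric[of "1/2::real"], of "D * E"]
      by (simp add: power_divide mult_ac)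
  qed
  then obtain l where l: "uniform_limit {0..T} (\<lambda>n s. \<Sum>i<n. Z (Suc i) s - Z i s) l sequentially"
    by (auto simp: uniformly_convergent_on_def)
  define z where "z = (\<lambda>s. z0 + l s)"
  have sumZ: "(\<Sum>i<n. Z (Suc i) s - Z i s) = Z n s - z0" for n s
    using sum_lessThan_telescope[of "\<lambda>i. Z i s" n] by (simp add: Z0)
  have lim: "uniform_limit {0..T} Z z sequentially"
  proof -
    have "uniform_limit {0..T} (\<lambda>n s. z0 + (\<Sum>i<n. Z (Suc i) s - Z i s)) z sequentially"
      unfolding z_def by (intro uniform_limit_add uniform_limit_const l)
    then show ?thesis by (simp add: sumZ)
  qed
  have contz: "continuous_on {0..T} z"
    by (rule uniform_limit_theorem[OF _ lim]) (auto simp: contZ)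
  have fixp: "z s = P z s" if s: "s \<in> {0..T}" for s
  proof -
    have c1: "(\<lambda>n. Z (Suc n) s) \<longlonglongrightarrow> z s"
      using tendsto_uniform_limitI[OF lim s] by (rule LIMSEQ_Suc)
    have "(\<lambda>n. P (Z n) s - P z s) \<longlonglongrightarrow> 0"
    proof (rule LIMSEQ_I)
      fix e :: real assume e: "e > 0"
      have "e / E > 0" using e by (simp add: E_def)
      then obtain N where N: "\<And>n r. n \<ge> N \<Longrightarrow> r \<in> {0..T} \<Longrightarrow> norm (Z n r - z r) < e / E"
        using lim[unfolded uniform_limit_sequentially_iff dist_norm, rule_format, of "e / E"] by blast
      have "norm (P (Z n) s - P z s - 0) < e" if "n \<ge> N" for n
      proof -
        have "norm (P (Z n) s - P z s) \<le> (e / E) / 2 * exp (2 * L * s)"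
        proof (rule Pdiff[OF contZ contz s])
          fix r assume "r \<in> {0..T}"
          then have "norm (Z n r - z r) \<le> e / E * 1" using N[OF that, of r] by simp
          also have "\<dots> \<le> e / E * exp (2 * L * r)"
            using \<open>r \<in> {0..T}\<close> L \<open>e / E > 0\<close> by (intro mult_left_mono) auto
          finally show "norm (Z n r - z r) \<le> e / E * exp (2 * L * r)" .
        qed (use \<open>e / E > 0\<close> in auto)
        also have "\<dots> \<le> (e / E) / 2 * E" using E[OF s] \<open>e / E > 0\<close> by (intro mult_left_mono) auto
        also have "\<dots> < e" using e by (simp add: E_def)
        finally show ?thesis by simp
      qed
      then show "\<exists>no. \<forall>n\<ge>no. norm (P (Z n) s - P z s - 0) < e" by blast
    qed
    then have "(\<lambda>n. Z (Suc n) s) \<longlonglongrightarrow> P z s" by (simp add: ZS LIM_zero_iff)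
    then show ?thesis using c1 LIMSEQ_unique by blast
  qed
  show ?thesis
  proof
    show "z 0 = z0" using fixp[of 0] T by (simp add: P_def)
    fix s assume s: "s \<in> {0..T}"
    have "((\<lambda>s. integral {0..s} (\<lambda>r. F (z r))) has_vector_derivative F (z s)) (at s within {0..T})"
      by (rule integral_has_vector_derivative[OF _ s]) (rule contFz[OF contz])
    then have "(P z has_vector_derivative F (z s)) (at s within {0..T})"
      unfolding P_def by (auto intro!: derivative_eq_intros)
    from has_vector_derivative_transform[OF s fixp this]
    show "(z has_vector_derivative F (z s)) (at s within {0..T})" .
  qed
qed

section \<open>The truncated Lagrangian\<close>

text \<open>The Lagrangian at velocity \<open>d2 H x p\<close>, written through the momentum by
  Legendre duality (see \<open>Lag_velocity\<close>); along orbits the velocity never has to be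
  inverted.\<close>

definition hs_lagrangian :: "(real \<Rightarrow> real \<Rightarrow> real) \<Rightarrow> real \<Rightarrow> real \<Rightarrow> real" where
  "hs_lagrangian H x p = p * d2 H x p - H x p"

definition hs_action :: "(real \<Rightarrow> real \<Rightarrow> real) \<Rightarrow> real \<Rightarrow> (real \<Rightarrow> real) \<Rightarrow> (real \<Rightarrow> real) \<Rightarrow> real" where
  "hs_action H t q p = integral {0..t} (\<lambda>s. hs_lagrangian H (q s) (p s))"

context ham_box
begin

abbreviation "ell \<equiv> hs_lagrangian H"
abbreviation "act \<equiv> hs_action H"

text \<open>\<open>LB\<close> is the Lagrangian of the Hamiltonian that equals \<open>H\<close> for \<open>\<bar>p\<bar> \<le> B\<close> and is infinite
  elsewhere.  \<open>opt x v p\<close> is the variational inequality characterising the maximiser.\<close>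

definition "LB x v = (SUP p\<in>{-B..B}. p * v - H x p)"
definition "opt x v p \<longleftrightarrow> \<bar>p\<bar> \<le> B \<and> (\<forall>p'. \<bar>p'\<bar> \<le> B \<longrightarrow> (v - d2 H x p) * (p' - p) \<le> 0)"
text \<open>The semiconcavity constant of \<open>LB\<close>: the coefficient \<open>2 / m\<close> of
  the squared velocity increment plus the coefficient \<open>2 * C\<^sup>2 / m + C\<close> of the
  squared position increment, both arising in \<open>LB_semiconcave\<close>.\<close>

definition "Cs = 2 / m + 2 * C\<^sup>2 / m + C"

lemma Cs_pos: "Cs > 0"
  using C_pos m_pos by (auto simp: Cs_def intro!: add_nonneg_pos)

lemma H_lip: 
  assumes "\<bar>p\<bar> \<le> B" "\<bar>p'\<bar> \<le> B"
  shows "\<bar>H x p - H x' p'\<bar> \<le> C * (\<bar>x - x'\<bar> + \<bar>p - p'\<bar>)"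
  by (rule box_lipschitz[OF H_d1 H_d2, where S=UNIV and P="{-B..B}"])
     (use assms Hx_bound Hp_bound in auto)

lemma H_taylor_x:
  assumes p: "\<bar>p\<bar> \<le> B"
  shows "\<bar>H x' p - H x p - d1 H x p * (x' - x)\<bar> \<le> C * (x' - x)\<^sup>2"
proof -
  define S where "S = {min x x'..max x x'}"
  have "\<bar>(H x' p - d1 H x p * x') - (H x p - d1 H x p * x)\<bar> \<le> (C * \<bar>x' - x\<bar>) * \<bar>x' - x\<bar>"
  proof (rule MVT_abs_le[where S=S and f'="\<lambda>y. d1 H y p - d1 H x p"])
    fix y assume y: "y \<in> S"
    show "((\<lambda>y. H y p - d1 H x p * y) has_real_derivative d1 H y p - d1 H x p) (at y within S)"
      by (auto intro!: derivative_eq_intros has_field_derivative_at_within[OF H_d1])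
    have "\<bar>d1 H y p - d1 H x p\<bar> \<le> C * \<bar>y - x\<bar>"
      using Hx_lip[OF p p, of y x] by simp
    also have "\<dots> \<le> C * \<bar>x' - x\<bar>"
      using y C_pos by (intro mult_left_mono) (auto simp: S_def)
    finally show "\<bar>d1 H y p - d1 H x p\<bar> \<le> C * \<bar>x' - x\<bar>" .
  qed (auto simp: S_def)
  also have "(C * \<bar>x' - x\<bar>) * \<bar>x' - x\<bar> = C * (x' - x)\<^sup>2"
    by (simp add: power2_eq_square flip: abs_mult)
  finally show ?thesis by (simp add: algebra_simps)
qed

text \<open>Two tangent inequalities, at \<open>p\<close> and at the midpoint \<open>r\<close>, are
  added; strong monotonicity between \<open>p\<close> and \<open>r\<close> turns the difference of
  the two slopes into the quadratic gain. Using a single midpoint gives the factor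
  \<open>m / 4\<close>.\<close>

lemma H_strongly_convex:
  assumes p: "\<bar>p\<bar> \<le> B" "\<bar>p'\<bar> \<le> B"
  shows "H x p' \<ge> H x p + d2 H x p * (p' - p) + m / 4 * (p' - p)\<^sup>2"
proof -
  define r where "r = (p + p') / 2"
  have r: "\<bar>r\<bar> \<le> B" "p' - r = (p' - p) / 2" "r - p = (p' - p) / 2"
    using p by (auto simp: r_def field_simps abs_le_iff)
  have "(d2 H x r - d2 H x p) * (p' - p) \<ge> m / 2 * (p' - p)\<^sup>2"
  proof (cases "p \<le> p'")
    case True
    then have "m * (r - p) \<le> d2 H x r - d2 H x p"
      using p r by (intro Hp_strong_mono) (auto simp: r_def)
    then have "m * (r - p) * (p' - p) \<le> (d2 H x r - d2 H x p) * (p' - p)"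
      using True by (intro mult_right_mono) auto
    then show ?thesis by (simp add: r power2_eq_square)
  next
    case False
    then have "m * (p - r) \<le> d2 H x p - d2 H x r"
      using p r by (intro Hp_strong_mono) (auto simp: r_def)
    then have "m * (p - r) * (p - p') \<le> (d2 H x p - d2 H x r) * (p - p')"
      using False by (intro mult_right_mono) auto
    moreover have "p - r = (p - p') / 2" by (simp add: r_def field_simps)
    then have "m * (p - r) * (p - p') = m / 2 * (p' - p)\<^sup>2"
      by (simp only:) (simp add: power2_eq_square field_simps)
    moreover have "(d2 H x p - d2 H x r) * (p - p') = (d2 H x r - d2 H x p) * (p' - p)"
      by (simp add: algebra_simps)
    ultimately show ?thesis by simp
  qed
  moreover have "H x p' \<ge> H x r + d2 H x r * ((p' - p) / 2)"
    using H_convex[of x r p'] r by simp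
  moreover have "H x r \<ge> H x p + d2 H x p * ((p' - p) / 2)"
    using H_convex[of x p r] r by simp
  ultimately show ?thesis by (simp add: field_simps)
qed

lemma opt_exists: "\<exists>p. opt x v p"
proof -
  consider "v \<ge> d2 H x B" | "v \<le> d2 H x (-B)" | "d2 H x (-B) \<le> v \<and> v \<le> d2 H x B" by linarith
  then show ?thesis
  proof cases
    case 1
    then have "opt x v B" using B_pos by (auto simp: opt_def intro!: mult_nonneg_nonpos)
    then show ?thesis by blast
  next
    case 2
    then have "opt x v (-B)" using B_pos by (auto simp: opt_def intro!: mult_nonpos_nonneg)
    then show ?thesis by blast
  next
    case 3
    have "C-lipschitz_on {-B..B} (d2 H x)"
      using C_pos Hp_lip[of _ _ x x] by (intro lipschitz_onI) (auto simp: dist_real_def)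
    then have "continuous_on {-B..B} (d2 H x)" by (rule lipschitz_on_continuous_on)
    then obtain p where "-B \<le> p" "p \<le> B" "d2 H x p = v"
      using IVT'[of "d2 H x" "-B" v B] 3 B_pos by auto
    then have "opt x v p" by (auto simp: opt_def)
    then show ?thesis by blast
  qed
qed

lemma opt_bound: "opt x v p \<Longrightarrow> \<bar>p\<bar> \<le> B"
  by (simp add: opt_def)

text \<open>An interior maximiser can be varied in both directions, so the variational inequality
  becomes an equality; only at the boundary of the strip may the truncation be felt.\<close>

lemma opt_interior:
  assumes "opt x v p" "\<bar>p\<bar> < B"
  shows "v = d2 H x p"
proof -
  define d where "d = B - \<bar>p\<bar>"
  have "d > 0" "\<bar>p + d\<bar> \<le> B" "\<bar>p - d\<bar> \<le> B" using assms by (auto simp: d_def)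
  then have "(v - d2 H x p) * d \<le> 0" "(v - d2 H x p) * (- d) \<le> 0"
    using assms(1) unfolding opt_def by (metis add_diff_cancel_left', metis add_diff_cancel_left' diff_conv_add_uminus)
  then have "(v - d2 H x p) * d = 0" by simp
  then show ?thesis using \<open>d > 0\<close> by simp
qed

lemma opt_velocity: "\<bar>p\<bar> \<le> B \<Longrightarrow> opt x (d2 H x p) p"
  by (simp add: opt_def)

lemma LB_ge: 
  assumes "\<bar>p\<bar> \<le> B"
  shows "p * v - H x p \<le> LB x v"
  unfolding LB_def
proof (rule cSUP_upper)
  show "p \<in> {-B..B}" using assms by auto
  show "bdd_above ((\<lambda>p. p * v - H x p) ` {-B..B})"
  proof (rule bdd_aboveI2)
    fix p assume "p \<in> {-B..B}"
    then have "\<bar>p\<bar> \<le> B" by auto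
    then have "\<bar>p * v\<bar> \<le> B * \<bar>v\<bar>" "\<bar>H x p\<bar> \<le> C"
      by (auto simp: abs_mult intro: mult_right_mono H_bound)
    then show "p * v - H x p \<le> B * \<bar>v\<bar> + C" by linarith
  qed
qed

lemma LB_le:
  assumes "\<And>p. \<bar>p\<bar> \<le> B \<Longrightarrow> p * v - H x p \<le> c"
  shows "LB x v \<le> c"
  unfolding LB_def using B_pos assms by (intro cSUP_least) auto

lemma LB_opt:
  assumes "opt x v p"
  shows "LB x v = p * v - H x p"
proof (rule antisym)
  show "LB x v \<le> p * v - H x p"
  proof (rule LB_le)
    fix p' assume p': "\<bar>p'\<bar> \<le> B"
    have "(v - d2 H x p) * (p' - p) \<le> 0" using assms p' by (simp add: opt_def)
    then show "p' * v - H x p' \<le> p * v - H x p"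
      using H_convex[of x p p'] by (simp add: algebra_simps)
  qed
qed (use assms opt_bound LB_ge in auto)

lemma LB_velocity: "\<bar>p\<bar> \<le> B \<Longrightarrow> LB x (d2 H x p) = ell x p"
  by (simp add: LB_opt[OF opt_velocity] hs_lagrangian_def)

lemma LB_lip: "\<bar>LB x v - LB x' v'\<bar> \<le> C * \<bar>x - x'\<bar> + B * \<bar>v - v'\<bar>"
proof -
  have "LB x v \<le> LB x' v' + (C * \<bar>x - x'\<bar> + B * \<bar>v - v'\<bar>)" for x v x' v'
  proof (rule LB_le)
    fix p assume p: "\<bar>p\<bar> \<le> B"
    have "\<bar>p * (v - v')\<bar> \<le> B * \<bar>v - v'\<bar>"
      unfolding abs_mult using p by (intro mult_right_mono) auto
    moreover have "p * (v - v') \<le> \<bar>p * (v - v')\<bar>" by simp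
    ultimately have "p * v \<le> p * v' + B * \<bar>v - v'\<bar>" unfolding right_diff_distrib by linarith
    then show "p * v - H x p \<le> LB x' v' + (C * \<bar>x - x'\<bar> + B * \<bar>v - v'\<bar>)"
      using H_lip[OF p p, of x x'] LB_ge[OF p, of v' x'] by simp
  qed
  from this[of x v x' v'] this[of x' v' x v] show ?thesis
    by (simp add: abs_minus_commute abs_le_iff)
qed

text \<open>Testing with the momenta \<open>B\<close> and \<open>-B\<close> gives growth of slope
  \<open>B\<close> in the velocity. This beats the slope \<open>K\<close> of the datum and makes the
  discrete problem coercive.\<close>

lemma LB_lower: "LB x v \<ge> B * \<bar>v\<bar> - C"
  using LB_ge[of B v x] LB_ge[of "-B" v x] H_bound[of B x] H_bound[of "-B" x] B_pos
  by (cases "v \<ge> 0") auto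

lemma LB_0_upper: "LB x 0 \<le> C"
proof (rule LB_le)
  fix p assume "\<bar>p\<bar> \<le> B"
  then show "p * 0 - H x p \<le> C" using H_bound[of p x] by auto
qed

text \<open>A supremum is not semiconcave by itself; here strong convexity of \<open>H\<close> in
  \<open>p\<close> helps. Passing from the maximiser \<open>p\<close> to another momentum at
  distance \<open>a\<close> costs \<open>m / 4 * a\<^sup>2\<close>, which by completing the square
  absorbs the gain \<open>a * (V + C * X)\<close> that the increments could offer.\<close>

lemma LB_semiconcave:
  assumes "opt x v p"
  shows "LB x' v' \<le> LB x v - d1 H x p * (x' - x) + p * (v' - v) + Cs * ((x' - x)\<^sup>2 + (v' - v)\<^sup>2)"
proof (rule LB_le)
  fix p' assume p': "\<bar>p'\<bar> \<le> B"
  have p: "\<bar>p\<bar> \<le> B" using assms opt_bound by auto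
  define a where "a = \<bar>p' - p\<bar>"
  define X where "X = \<bar>x' - x\<bar>"
  define V where "V = \<bar>v' - v\<bar>"
  have sq: "(x' - x)\<^sup>2 = X\<^sup>2" "(v' - v)\<^sup>2 = V\<^sup>2" "(p' - p)\<^sup>2 = a\<^sup>2"
    by (auto simp: a_def X_def V_def)
  have "H x' p' \<ge> H x p' + d1 H x p' * (x' - x) - C * X\<^sup>2"
    using H_taylor_x[OF p', of x' x] by (simp add: sq abs_le_iff)
  moreover have "\<bar>(d1 H x p' - d1 H x p) * (x' - x)\<bar> \<le> C * a * X"
    unfolding abs_mult a_def X_def using Hx_lip[OF p' p, of x x] by (intro mult_right_mono) auto
  then have "d1 H x p' * (x' - x) \<ge> d1 H x p * (x' - x) - C * a * X"
    unfolding left_diff_distrib by linarith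
  moreover have "H x p' \<ge> H x p + d2 H x p * (p' - p) + m / 4 * a\<^sup>2"
    using H_strongly_convex[OF p p', of x] by (simp add: sq)
  moreover have "v * (p' - p) \<le> d2 H x p * (p' - p)"
    using assms p' by (simp add: opt_def left_diff_distrib)
  moreover have "\<bar>(p' - p) * (v' - v)\<bar> \<le> a * V" by (simp add: a_def V_def abs_mult)
  then have "p' * v' \<le> p * v + p * (v' - v) + v * (p' - p) + a * V"
    by (simp add: abs_le_iff algebra_simps)
  ultimately have 1: "p' * v' - H x' p' \<le> (p * v - H x p) - d1 H x p * (x' - x) + p * (v' - v)
      + (a * (V + C * X) - m / 4 * a\<^sup>2 + C * X\<^sup>2)"
    by (simp add: algebra_simps)
  have "a * (V + C * X) - m / 4 * a\<^sup>2 \<le> (V + C * X)\<^sup>2 / m"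
  proof -
    have "0 \<le> (m * a / 2 - (V + C * X))\<^sup>2" by simp
    also have "\<dots> = m * (m / 4 * a\<^sup>2 - a * (V + C * X) + (V + C * X)\<^sup>2 / m)"
      using m_pos by (simp add: power2_eq_square field_simps)
    finally show ?thesis using m_pos by (simp add: zero_le_mult_iff)
  qed
  also have "(V + C * X)\<^sup>2 \<le> 2 * V\<^sup>2 + 2 * C\<^sup>2 * X\<^sup>2"
  proof -
    have "0 \<le> (V - C * X)\<^sup>2" by simp
    then show ?thesis by (simp add: power2_eq_square algebra_simps)
  qed
  then have "(V + C * X)\<^sup>2 / m \<le> (2 * V\<^sup>2 + 2 * C\<^sup>2 * X\<^sup>2) / m"
    using m_pos by (intro divide_right_mono) auto
  finally have 2: "a * (V + C * X) - m / 4 * a\<^sup>2 + C * X\<^sup>2 \<le> (2 * V\<^sup>2 + 2 * C\<^sup>2 * X\<^sup>2) / m + C * X\<^sup>2"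
    by simp
  have "Cs * (X\<^sup>2 + V\<^sup>2) = (2 * V\<^sup>2 + 2 * C\<^sup>2 * X\<^sup>2) / m + C * X\<^sup>2 + (2 / m * X\<^sup>2 + (2 * C\<^sup>2 / m + C) * V\<^sup>2)"
    by (simp add: Cs_def add_divide_distrib algebra_simps)
  moreover have "2 / m * X\<^sup>2 + (2 * C\<^sup>2 / m + C) * V\<^sup>2 \<ge> 0"
    using m_pos C_pos by (intro add_nonneg_nonneg mult_nonneg_nonneg) auto
  ultimately have "(2 * V\<^sup>2 + 2 * C\<^sup>2 * X\<^sup>2) / m + C * X\<^sup>2 \<le> Cs * (X\<^sup>2 + V\<^sup>2)" by linarith
  then show "p' * v' - H x' p' \<le> LB x v - d1 H x p * (x' - x) + p * (v' - v)
      + Cs * ((x' - x)\<^sup>2 + (v' - v)\<^sup>2)"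
    using 1 2 unfolding LB_opt[OF assms] sq by linarith
qed

lemma ell_lip:
  assumes "\<bar>p\<bar> \<le> B" "\<bar>p'\<bar> \<le> B"
  shows "\<bar>ell x p - ell x' p'\<bar> \<le> (2 + B) * C * (\<bar>x - x'\<bar> + \<bar>p - p'\<bar>)"
proof -
  let ?d = "\<bar>x - x'\<bar> + \<bar>p - p'\<bar>"
  have "\<bar>p * (d2 H x p - d2 H x' p')\<bar> \<le> B * (C * ?d)"
    unfolding abs_mult using assms B_pos by (intro mult_mono Hp_lip) auto
  moreover have "\<bar>(p - p') * d2 H x' p'\<bar> \<le> ?d * C"
    unfolding abs_mult using assms by (intro mult_mono Hp_bound) auto
  moreover have "\<bar>H x p - H x' p'\<bar> \<le> C * ?d" by (rule H_lip[OF assms])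
  moreover have "ell x p - ell x' p' = p * (d2 H x p - d2 H x' p') + (p - p') * d2 H x' p' - (H x p - H x' p')"
    by (simp add: hs_lagrangian_def algebra_simps)
  ultimately have "\<bar>ell x p - ell x' p'\<bar> \<le> B * (C * ?d) + ?d * C + C * ?d" by linarith
  then show ?thesis by (simp add: algebra_simps)
qed

lemma ell_bound: "\<bar>p\<bar> \<le> B \<Longrightarrow> \<bar>ell x p\<bar> \<le> (1 + B) * C"
proof -
  assume p: "\<bar>p\<bar> \<le> B"
  have "\<bar>p * d2 H x p\<bar> \<le> B * C" unfolding abs_mult using p Hp_bound[OF p] B_pos by (intro mult_mono) auto
  then show ?thesis using H_bound[OF p, of x] unfolding hs_lagrangian_def by (simp add: algebra_simps)
qed

end

section \<open>The time-discretised problem\<close>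

text \<open>Fermat's rule for a functional that is known only through a quadratic upper bound and
  may have a kink of slope \<open>K\<close>. With \<open>K = 0\<close> it yields stationarity, with
  the Lipschitz constant of the datum the transversality bound.\<close>

lemma first_order_condition:
  fixes a c K :: real
  assumes "\<And>e. 0 \<le> K * \<bar>e\<bar> + a * e + c * e\<^sup>2" and "c \<ge> 0"
  shows "\<bar>a\<bar> \<le> K"
proof (rule ccontr)
  assume "\<not> ?thesis"
  then have d: "\<bar>a\<bar> - K > 0" by simp
  \<comment> \<open>The step length balances the linear against the quadratic term: with sign
    opposite to \<open>a\<close>, the right-hand side drops to \<open>- e\<^sup>2\<close>.\<close>
  define e where "e = (\<bar>a\<bar> - K) / (c + 1)"
  define s where "s = - sgn a"
  have e: "e > 0" "(c + 1) * e = \<bar>a\<bar> - K" using d assms(2) by (auto simp: e_def)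
  have "0 \<le> K * \<bar>s * e\<bar> + a * (s * e) + c * (s * e)\<^sup>2" by (rule assms(1))
  also have "\<dots> \<le> K * e + (- \<bar>a\<bar>) * e + c * e\<^sup>2"
  proof (cases "a = 0")
    case True
    then show ?thesis using assms(1)[of 1] assms(1)[of e] e d assms(2) by (auto simp: s_def)
  next
    case False
    then show ?thesis using e by (auto simp: s_def sgn_if abs_mult power2_eq_square)
  qed
  also have "\<dots> = e * (c * e - (\<bar>a\<bar> - K))" by (simp add: power2_eq_square algebra_simps)
  also have "\<dots> = - e\<^sup>2" using e(2) by (simp add: algebra_simps power2_eq_square flip: e(2))
  finally show False using e by simp
qed

lemma sum_change_two:
  fixes f g :: "nat \<Rightarrow> real"
  assumes "Suc j < N" "\<And>i. i < N \<Longrightarrow> i \<noteq> j \<Longrightarrow> i \<noteq> Suc j \<Longrightarrow> g i = f i"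
  shows "(\<Sum>i<N. g i) = (\<Sum>i<N. f i) + (g j - f j) + (g (Suc j) - f (Suc j))"
proof -
  have "(\<Sum>i<N. g i) - (\<Sum>i<N. f i) = (\<Sum>i<N. g i - f i)" by (simp add: sum_subtractf)
  also have "\<dots> = (\<Sum>i\<in>{j, Suc j}. g i - f i)"
    using assms by (intro sum.mono_neutral_right) auto
  finally show ?thesis by simp
qed

lemma sum_change_first:
  fixes f g :: "nat \<Rightarrow> real"
  assumes "0 < N" "\<And>i. i < N \<Longrightarrow> i \<noteq> 0 \<Longrightarrow> g i = f i"
  shows "(\<Sum>i<N. g i) = (\<Sum>i<N. f i) + (g 0 - f 0)"
proof -
  have "(\<Sum>i<N. g i) - (\<Sum>i<N. f i) = (\<Sum>i<N. g i - f i)" by (simp add: sum_subtractf)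
  also have "\<dots> = (\<Sum>i\<in>{0}. g i - f i)"
    using assms by (intro sum.mono_neutral_right) auto
  finally show ?thesis by simp
qed

lemma abs_diff_le_variation:
  fixes \<xi> :: "nat \<Rightarrow> real"
  assumes "i \<le> N"
  shows "\<bar>\<xi> N - \<xi> i\<bar> \<le> (\<Sum>j<N. \<bar>\<xi> (Suc j) - \<xi> j\<bar>)"
  using assms
proof (induction N)
  case (Suc N)
  then show ?case
    by (cases "i = Suc N") (auto simp: sum_nonneg le_Suc_eq)
qed simp

text \<open>Discrete curves are encoded as functions on all natural numbers, so their compactness is
  Tychonoff's theorem; irrelevant coordinates can be confined to one point.\<close>

lemma compact_Pi_UNIV:
  fixes S :: "'i \<Rightarrow> 'b::topological_space set"
  assumes "\<And>i. compact (S i)"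
  shows "compact {f. \<forall>i. f i \<in> S i}"
proof -
  have "compactin (product_topology (\<lambda>i. euclidean) UNIV) (PiE UNIV S)"
    using assms by (simp add: compactin_PiE)
  moreover have "PiE UNIV S = {f. \<forall>i. f i \<in> S i}" by auto
  ultimately show ?thesis by (simp add: euclidean_product_topology)
qed

text \<open>The two unit margins absorb discretisation errors: \<open>E + 1\<close> allows for the
  drift of the energy over all steps, \<open>R + 1 \<le> B\<close> for the change of momentum in one
  step.\<close>

locale ham_disc = ham_box +
  fixes Uo :: "real \<Rightarrow> real" and K E R :: real
  assumes Uo_lip: "\<And>x y. \<bar>Uo x - Uo y\<bar> \<le> K * \<bar>x - y\<bar>"
    and K_nonneg: "K \<ge> 0" and RB: "R + 1 \<le> B"
    and H_le_E: "\<And>x p. \<bar>p\<bar> \<le> K \<Longrightarrow> H x p \<le> E"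
    and sublevel_R: "\<And>x p. H x p \<le> E + 1 \<Longrightarrow> \<bar>p\<bar> \<le> R"
begin

lemma K_le_R: "K \<le> R"
  using H_le_E[of K 0] sublevel_R[of 0 K] K_nonneg by simp

lemma R_nonneg: "R \<ge> 0" and R_less_B: "R < B"
  using K_le_R K_nonneg RB by auto

text \<open>The Lagrangian is sampled at the left node with the forward difference as velocity. This
  choice makes the stationarity equations a symplectic Euler scheme, explicit in the position and
  implicit in the momentum.\<close>

definition "J N h \<xi> = Uo (\<xi> 0) + (\<Sum>i<N. h * LB (\<xi> i) ((\<xi> (Suc i) - \<xi> i) / h))"

text \<open>The datum can gain at most \<open>K\<close> per unit of variation, whereas the truncated
  action charges \<open>B\<close> per unit, so the cost controls the total variation.\<close>

lemma J_lower:
  assumes "h > 0" "\<xi> N = x"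
  shows "J N h \<xi> \<ge> Uo x + (B - K) * (\<Sum>i<N. \<bar>\<xi> (Suc i) - \<xi> i\<bar>) - real N * h * C"
proof -
  let ?V = "\<Sum>i<N. \<bar>\<xi> (Suc i) - \<xi> i\<bar>"
  have "(\<Sum>i<N. h * LB (\<xi> i) ((\<xi> (Suc i) - \<xi> i) / h)) \<ge> (\<Sum>i<N. B * \<bar>\<xi> (Suc i) - \<xi> i\<bar> - h * C)"
  proof (rule sum_mono)
    fix i
    have "h * (B * \<bar>(\<xi> (Suc i) - \<xi> i) / h\<bar> - C) \<le> h * LB (\<xi> i) ((\<xi> (Suc i) - \<xi> i) / h)"
      by (rule mult_left_mono[OF LB_lower]) (use assms in simp)
    moreover have "h * (B * \<bar>(\<xi> (Suc i) - \<xi> i) / h\<bar> - C) = B * \<bar>\<xi> (Suc i) - \<xi> i\<bar> - h * C"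
      using assms by (simp add: field_simps)
    ultimately show "B * \<bar>\<xi> (Suc i) - \<xi> i\<bar> - h * C \<le> h * LB (\<xi> i) ((\<xi> (Suc i) - \<xi> i) / h)" by simp
  qed
  moreover have "(\<Sum>i<N. B * \<bar>\<xi> (Suc i) - \<xi> i\<bar> - h * C) = B * ?V - real N * h * C"
    by (simp add: sum_subtractf sum_distrib_left)
  moreover have "K * \<bar>x - \<xi> 0\<bar> \<le> K * ?V"
    using abs_diff_le_variation[of 0 N \<xi>] assms K_nonneg by (intro mult_left_mono) auto
  then have "Uo (\<xi> 0) \<ge> Uo x - K * ?V" using Uo_lip[of x "\<xi> 0"] by (simp add: abs_le_iff)
  ultimately show ?thesis unfolding J_def by (simp add: algebra_simps)
qed

lemma J_cong: "(\<And>i. i \<le> N \<Longrightarrow> \<xi> i = \<zeta> i) \<Longrightarrow> J N h \<xi> = J N h \<zeta>"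
  unfolding J_def by (auto intro!: sum.cong)

lemma J_minimizer:
  assumes h: "h > 0"
  shows "\<exists>\<xi>. \<xi> N = x \<and> (\<forall>\<zeta>. \<zeta> N = x \<longrightarrow> J N h \<xi> \<le> J N h \<zeta>)"
proof -
  \<comment> \<open>The variation allowed by \<open>J_lower\<close> to a curve that costs no more
    than the constant curve at \<open>x\<close>.\<close>
  define A where "A = 2 * real N * h * C / (B - K)"
  have BK: "B - K > 0" using K_le_R RB by simp
  have A: "A \<ge> 0" using BK h C_pos by (simp add: A_def)
  define S where "S = {f :: nat \<Rightarrow> real. \<forall>i. f i \<in> (if i < N then {x - A..x + A} else {x})}"
  have "compact S" unfolding S_def by (intro compact_Pi_UNIV) auto
  moreover have "(\<lambda>_. x) \<in> S" using A by (auto simp: S_def)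
  moreover have cLB: "continuous_on UNIV (\<lambda>f :: nat \<Rightarrow> real. LB (f i) ((f (Suc i) - f i) / h))" for i
  proof -
    have "(C + B)-lipschitz_on UNIV (\<lambda>z. LB (fst z) (snd z))"
    proof (rule lipschitz_onI)
      fix z w :: "real \<times> real"
      have "\<bar>LB (fst z) (snd z) - LB (fst w) (snd w)\<bar> \<le> C * \<bar>fst z - fst w\<bar> + B * \<bar>snd z - snd w\<bar>"
        by (rule LB_lip)
      also have "\<dots> \<le> C * dist z w + B * dist z w"
        using dist_fst_le[of z w] dist_snd_le[of z w] C_pos B_pos
        by (intro add_mono mult_left_mono) (auto simp: dist_real_def)
      finally show "dist (LB (fst z) (snd z)) (LB (fst w) (snd w)) \<le> (C + B) * dist z w"
        by (simp add: dist_real_def algebra_simps)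
    qed (use B_pos C_pos in auto)
    then have "continuous_on UNIV (\<lambda>z. LB (fst z) (snd z))" by (rule lipschitz_on_continuous_on)
    moreover have "continuous_on UNIV (\<lambda>f :: nat \<Rightarrow> real. (f i, (f (Suc i) - f i) / h))"
      using h by (intro continuous_intros) auto
    ultimately show ?thesis
      using continuous_on_compose2[of UNIV "\<lambda>z. LB (fst z) (snd z)" UNIV "\<lambda>f. (f i, (f (Suc i) - f i) / h)"]
      by simp
  qed
  have cUo: "continuous_on UNIV Uo"
  proof (rule lipschitz_on_continuous_on)
    show "K-lipschitz_on UNIV Uo"
      using K_nonneg Uo_lip by (intro lipschitz_onI) (auto simp: dist_real_def)
  qed
  have "continuous_on S (J N h)"
    unfolding J_def
    by (intro continuous_on_add continuous_on_sum continuous_on_mult continuous_on_const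
        continuous_on_subset[OF cLB] continuous_on_compose2[OF cUo] 
        continuous_on_subset[OF continuous_on_product_coordinates]) auto
  ultimately obtain \<xi> where \<xi>: "\<xi> \<in> S" "\<And>\<zeta>. \<zeta> \<in> S \<Longrightarrow> J N h \<xi> \<le> J N h \<zeta>"
    using continuous_attains_inf[of S "J N h"] by blast
  have "J N h \<xi> \<le> J N h \<zeta>" if \<zeta>: "\<zeta> N = x" for \<zeta>
  proof (cases "J N h \<zeta> \<le> J N h (\<lambda>_. x)")
    case True
    have "(\<Sum>i<N. h * LB x 0) \<le> (\<Sum>i<N. h * C)"
      using h LB_0_upper by (intro sum_mono mult_left_mono) auto
    then have "J N h (\<lambda>_. x) \<le> Uo x + real N * h * C" by (simp add: J_def)
    with J_lower[where \<xi>=\<zeta> and N=N and x=x, OF h \<zeta>] True have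
      "(B - K) * (\<Sum>i<N. \<bar>\<zeta> (Suc i) - \<zeta> i\<bar>) \<le> 2 * real N * h * C" by linarith
    then have V: "(\<Sum>i<N. \<bar>\<zeta> (Suc i) - \<zeta> i\<bar>) \<le> A"
      using BK by (simp add: A_def pos_le_divide_eq mult.commute)
    \<comment> \<open>Only the nodes up to \<open>N\<close> enter the cost; resetting the later ones
      moves the curve into the compact set.\<close>
    define \<eta> where "\<eta> = (\<lambda>i. if i < N then \<zeta> i else x)"
    have "\<eta> i \<in> (if i < N then {x - A..x + A} else {x})" for i
    proof (cases "i < N")
      case True
      then have "\<bar>\<zeta> N - \<zeta> i\<bar> \<le> A" using abs_diff_le_variation[of i N \<zeta>] V by linarith
      then show ?thesis using True \<zeta> by (auto simp: \<eta>_def)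
    qed (auto simp: \<eta>_def)
    then have "\<eta> \<in> S" by (simp add: S_def)
    then have "J N h \<xi> \<le> J N h \<eta>" by (rule \<xi>)
    also have "\<dots> = J N h \<zeta>" using \<zeta> by (intro J_cong) (auto simp: \<eta>_def)
    finally show ?thesis .
  next
    case False
    then show ?thesis using \<xi>(2)[OF \<open>(\<lambda>_. x) \<in> S\<close>] by simp
  qed
  moreover have "\<xi> N = x" using \<xi>(1) by (auto simp: S_def dest: spec[of _ N])
  ultimately show ?thesis by blast
qed

text \<open>Moving an interior node changes two summands. \<open>LB_semiconcave\<close> bounds both
  changes from above by a linear plus a quadratic term in the displacement, and minimality then
  forces the linear coefficient to vanish.\<close>

lemma discrete_euler_lagrange:
  assumes h: "h > 0" and min: "\<And>\<zeta>. \<zeta> N = \<xi> N \<Longrightarrow> J N h \<xi> \<le> J N h \<zeta>"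
    and j: "Suc j < N"
    and p: "\<And>i. opt (\<xi> i) ((\<xi> (Suc i) - \<xi> i) / h) (p (Suc i))"
  shows "p (Suc j) = p (Suc (Suc j)) + h * d1 H (\<xi> (Suc j)) (p (Suc (Suc j)))"
proof -
  let ?a = "p (Suc j) - p (Suc (Suc j)) - h * d1 H (\<xi> (Suc j)) (p (Suc (Suc j)))"
  have "\<bar>?a\<bar> \<le> 0"
  proof (rule first_order_condition)
    show "h * Cs * (1 + 2 / h\<^sup>2) \<ge> 0" using h Cs_pos by (intro mult_nonneg_nonneg add_nonneg_nonneg) auto
    fix e :: real
    let ?x0 = "\<xi> j" and ?x1 = "\<xi> (Suc j)" and ?x2 = "\<xi> (Suc (Suc j))"
    let ?\<zeta> = "\<xi>(Suc j := ?x1 + e)"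
    let ?f = "\<lambda>\<xi> i. h * LB (\<xi> i) ((\<xi> (Suc i) - \<xi> i) / h)"
    have "(\<Sum>i<N. ?f ?\<zeta> i) = (\<Sum>i<N. ?f \<xi> i) + (?f ?\<zeta> j - ?f \<xi> j) + (?f ?\<zeta> (Suc j) - ?f \<xi> (Suc j))"
      using j by (intro sum_change_two) auto
    moreover have "J N h \<xi> \<le> J N h ?\<zeta>" using j by (intro min) auto
    ultimately have "0 \<le> (?f ?\<zeta> j - ?f \<xi> j) + (?f ?\<zeta> (Suc j) - ?f \<xi> (Suc j))"
      by (simp add: J_def)
    moreover have "LB ?x0 ((?x1 + e - ?x0) / h) \<le> LB ?x0 ((?x1 - ?x0) / h) + p (Suc j) * (e / h) + Cs * (e / h)\<^sup>2"
      using LB_semiconcave[OF p[of j], of ?x0 "(?x1 + e - ?x0) / h"]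
      by (simp add: diff_divide_distrib add_divide_distrib)
    then have "h * LB ?x0 ((?x1 + e - ?x0) / h) \<le> h * (LB ?x0 ((?x1 - ?x0) / h) + p (Suc j) * (e / h) + Cs * (e / h)\<^sup>2)"
      using h by (intro mult_left_mono) auto
    then have "?f ?\<zeta> j - ?f \<xi> j \<le> p (Suc j) * e + h * (Cs * (e / h)\<^sup>2)"
      using h by (simp add: algebra_simps)
    moreover have "LB (?x1 + e) ((?x2 - (?x1 + e)) / h) \<le> LB ?x1 ((?x2 - ?x1) / h)
        - d1 H ?x1 (p (Suc (Suc j))) * e - p (Suc (Suc j)) * (e / h) + Cs * (e\<^sup>2 + (e / h)\<^sup>2)"
      using LB_semiconcave[OF p[of "Suc j"], of "?x1 + e" "(?x2 - (?x1 + e)) / h"]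
      by (simp add: diff_divide_distrib add_divide_distrib)
    then have "h * LB (?x1 + e) ((?x2 - (?x1 + e)) / h) \<le> h * (LB ?x1 ((?x2 - ?x1) / h)
        - d1 H ?x1 (p (Suc (Suc j))) * e - p (Suc (Suc j)) * (e / h) + Cs * (e\<^sup>2 + (e / h)\<^sup>2))"
      using h by (intro mult_left_mono) auto
    then have "?f ?\<zeta> (Suc j) - ?f \<xi> (Suc j) \<le> - h * d1 H ?x1 (p (Suc (Suc j))) * e - p (Suc (Suc j)) * e
        + h * (Cs * (e\<^sup>2 + (e / h)\<^sup>2))"
      using h by (simp add: algebra_simps)
    ultimately have "0 \<le> ?a * e + (h * (Cs * (e / h)\<^sup>2) + h * (Cs * (e\<^sup>2 + (e / h)\<^sup>2)))"
      by (simp add: algebra_simps)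
    also have "h * (Cs * (e / h)\<^sup>2) + h * (Cs * (e\<^sup>2 + (e / h)\<^sup>2)) = h * Cs * (1 + 2 / h\<^sup>2) * e\<^sup>2"
      using h by (simp add: power_divide algebra_simps)
    finally show "0 \<le> 0 * \<bar>e\<bar> + ?a * e + h * Cs * (1 + 2 / h\<^sup>2) * e\<^sup>2" by simp
  qed
  then show ?thesis by simp
qed

text \<open>Moving the initial node changes one summand and the datum, and the latter contributes a
  kink of slope \<open>K\<close>; the momentum extrapolated to time 0 is therefore a possible slope
  of the datum.\<close>

lemma discrete_transversality:
  assumes h: "h > 0" and min: "\<And>\<zeta>. \<zeta> N = \<xi> N \<Longrightarrow> J N h \<xi> \<le> J N h \<zeta>"
    and N: "0 < N"
    and p: "\<And>i. opt (\<xi> i) ((\<xi> (Suc i) - \<xi> i) / h) (p (Suc i))"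
  shows "\<bar>p (Suc 0) + h * d1 H (\<xi> 0) (p (Suc 0))\<bar> \<le> K"
proof -
  let ?a = "- p (Suc 0) - h * d1 H (\<xi> 0) (p (Suc 0))"
  have "\<bar>?a\<bar> \<le> K"
  proof (rule first_order_condition)
    show "h * Cs * (1 + 1 / h\<^sup>2) \<ge> 0" using h Cs_pos by (intro mult_nonneg_nonneg add_nonneg_nonneg) auto
    fix e :: real
    let ?x1 = "\<xi> 0" and ?x2 = "\<xi> (Suc 0)"
    let ?\<zeta> = "\<xi>(0 := ?x1 + e)"
    let ?f = "\<lambda>\<xi> i. h * LB (\<xi> i) ((\<xi> (Suc i) - \<xi> i) / h)"
    have "(\<Sum>i<N. ?f ?\<zeta> i) = (\<Sum>i<N. ?f \<xi> i) + (?f ?\<zeta> 0 - ?f \<xi> 0)"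
      using N by (intro sum_change_first) auto
    moreover have "J N h \<xi> \<le> J N h ?\<zeta>" using N by (intro min) auto
    ultimately have "0 \<le> (Uo (?x1 + e) - Uo ?x1) + (?f ?\<zeta> 0 - ?f \<xi> 0)"
      by (simp add: J_def)
    moreover have "Uo (?x1 + e) - Uo ?x1 \<le> K * \<bar>e\<bar>"
      using Uo_lip[of "?x1 + e" ?x1] by (simp add: abs_le_iff)
    moreover have "LB (?x1 + e) ((?x2 - (?x1 + e)) / h) \<le> LB ?x1 ((?x2 - ?x1) / h)
        - d1 H ?x1 (p (Suc 0)) * e - p (Suc 0) * (e / h) + Cs * (e\<^sup>2 + (e / h)\<^sup>2)"
      using LB_semiconcave[OF p[of 0], of "?x1 + e" "(?x2 - (?x1 + e)) / h"]
      by (simp add: diff_divide_distrib add_divide_distrib)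
    then have "h * LB (?x1 + e) ((?x2 - (?x1 + e)) / h) \<le> h * (LB ?x1 ((?x2 - ?x1) / h)
        - d1 H ?x1 (p (Suc 0)) * e - p (Suc 0) * (e / h) + Cs * (e\<^sup>2 + (e / h)\<^sup>2))"
      using h by (intro mult_left_mono) auto
    then have "?f ?\<zeta> 0 - ?f \<xi> 0 \<le> - h * d1 H ?x1 (p (Suc 0)) * e - p (Suc 0) * e
        + h * (Cs * (e\<^sup>2 + (e / h)\<^sup>2))"
      using h by (simp add: algebra_simps)
    ultimately have "0 \<le> K * \<bar>e\<bar> + ?a * e + h * (Cs * (e\<^sup>2 + (e / h)\<^sup>2))"
      by (simp add: algebra_simps)
    also have "h * (Cs * (e\<^sup>2 + (e / h)\<^sup>2)) = h * Cs * (1 + 1 / h\<^sup>2) * e\<^sup>2"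
      using h by (simp add: power_divide algebra_simps)
    finally show "0 \<le> K * \<bar>e\<bar> + ?a * e + h * Cs * (1 + 1 / h\<^sup>2) * e\<^sup>2" .
  qed
  then show ?thesis by (simp add: abs_le_iff)
qed

definition "discrete_minimiser N h x \<xi> p \<longleftrightarrow> \<xi> N = x \<and> (\<forall>\<zeta>. \<zeta> N = x \<longrightarrow> J N h \<xi> \<le> J N h \<zeta>) \<and>
  (\<forall>i\<le>N. \<bar>p i\<bar> \<le> R) \<and>
  (\<forall>i<N. \<xi> (Suc i) = \<xi> i + h * d2 H (\<xi> i) (p (Suc i)) \<and> p (Suc i) = p i - h * d1 H (\<xi> i) (p (Suc i))) \<and>
  J N h \<xi> = Uo (\<xi> 0) + (\<Sum>i<N. h * ell (\<xi> i) (p (Suc i)))"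

text \<open>A discrete minimiser is a symplectic Euler orbit; the energy of such an orbit grows by at most
  \<open>O(h\<^sup>2)\<close> per step, which keeps the momenta away from the truncation level \<open>B\<close>.\<close>
lemma discrete_extremal:
  assumes h: "h > 0" and N: "N > 0" and small: "real N * h * C ^ 3 * h \<le> 1" "h * C < 1"
  shows "\<exists>\<xi> p. discrete_minimiser N h x \<xi> p"
proof -
  obtain \<xi> where \<xi>: "\<xi> N = x" and min: "\<And>\<zeta>. \<zeta> N = x \<Longrightarrow> J N h \<xi> \<le> J N h \<zeta>"
    using J_minimizer[OF h] by blast
  have "\<forall>i. \<exists>p. opt (\<xi> i) ((\<xi> (Suc i) - \<xi> i) / h) p" using opt_exists by blast
  then obtain p' where p': "\<And>i. opt (\<xi> i) ((\<xi> (Suc i) - \<xi> i) / h) (p' i)" by metis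
  \<comment> \<open>The maximiser on the cell starting at node \<open>i\<close> is stored at index
    \<open>Suc i\<close>; index 0 is filled by running the momentum step backwards once, so that the
    scheme holds from the start and transversality reads
    \<open>\<bar>p 0\<bar> \<le> K\<close>.\<close>
  define p where "p = (\<lambda>i. case i of 0 \<Rightarrow> p' 0 + h * d1 H (\<xi> 0) (p' 0) | Suc j \<Rightarrow> p' j)"
  have p: "opt (\<xi> i) ((\<xi> (Suc i) - \<xi> i) / h) (p (Suc i))" for i
    using p' by (simp add: p_def)
  have step: "p i = p (Suc i) + h * d1 H (\<xi> i) (p (Suc i))" if "i < N" for i
  proof (cases i)
    case 0
    then show ?thesis by (simp add: p_def)
  next
    case (Suc j)
    then show ?thesis using discrete_euler_lagrange[of h N \<xi> j p] h min \<xi> p that by simp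
  qed
  have p0: "\<bar>p 0\<bar> \<le> K"
    using discrete_transversality[of h N \<xi> p] h min \<xi> p N step[of 0] by simp
  \<comment> \<open>One momentum step is shorter than 1, so a momentum bounded by \<open>R\<close>
    stays strictly inside the strip and \<open>opt_interior\<close> gives the true velocity.\<close>
  have vel: "\<xi> (Suc i) = \<xi> i + h * d2 H (\<xi> i) (p (Suc i))" if "i < N" "\<bar>p i\<bar> \<le> R" for i
  proof -
    have "\<bar>h * d1 H (\<xi> i) (p (Suc i))\<bar> \<le> h * C"
      using Hx_bound[OF opt_bound[OF p[of i]], of "\<xi> i"] h by (simp add: abs_mult)
    then have "\<bar>p (Suc i)\<bar> < B" using step[OF that(1)] that(2) small(2) RB by linarith
    from opt_interior[OF p this] show ?thesis using h by (simp add: field_simps)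
  qed
  have energy: "H (\<xi> i) (p i) \<le> E + real i * (C ^ 3 * h\<^sup>2) \<and> \<bar>p i\<bar> \<le> R" if "i \<le> N" for i
    using that
  proof (induction i)
    case 0
    then show ?case using H_le_E[OF p0, of "\<xi> 0"] sublevel_R[of "\<xi> 0" "p 0"] by auto
  next
    case (Suc i)
    then have IH: "H (\<xi> i) (p i) \<le> E + real i * (C ^ 3 * h\<^sup>2)" "\<bar>p i\<bar> \<le> R" and i: "i < N" by auto
    let ?q = "p (Suc i)" and ?x = "\<xi> i"
    have q: "\<bar>?q\<bar> \<le> B" using p opt_bound by blast
    define a where "a = h * d2 H ?x ?q"
    have "a\<^sup>2 \<le> (h * C)\<^sup>2"
      unfolding a_def using Hp_bound[OF q, of ?x] h by (intro power2_mono) (simp add: abs_mult)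
    then have Ca: "C * a\<^sup>2 \<le> C ^ 3 * h\<^sup>2"
      using C_pos by (simp add: power_mult_distrib power3_eq_cube power2_eq_square algebra_simps)
    have "H (\<xi> (Suc i)) ?q \<le> H ?x ?q + d1 H ?x ?q * a + C * a\<^sup>2"
      using H_taylor_x[OF q, of "\<xi> (Suc i)" ?x] vel[OF i IH(2)] by (simp add: a_def abs_le_iff)
    \<comment> \<open>The product of \<open>h\<close>, \<open>d1 H\<close> and \<open>d2 H\<close>
      lost in the momentum step is exactly the one gained in the position step; only the
      second-order remainder \<open>C * a\<^sup>2\<close> survives.\<close>
    moreover have "H ?x (p i) \<ge> H ?x ?q + d2 H ?x ?q * (h * d1 H ?x ?q)"
      using H_convex[of ?x ?q "p i"] step[OF i] by simp
    ultimately have "H (\<xi> (Suc i)) ?q \<le> H ?x (p i) + C ^ 3 * h\<^sup>2"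
      using Ca by (simp add: a_def algebra_simps)
    then have 1: "H (\<xi> (Suc i)) ?q \<le> E + real (Suc i) * (C ^ 3 * h\<^sup>2)"
      using IH by (simp add: algebra_simps)
    have "real (Suc i) * (C ^ 3 * h\<^sup>2) \<le> real N * (C ^ 3 * h\<^sup>2)"
      using Suc.prems C_pos by (intro mult_right_mono) auto
    also have "\<dots> = real N * h * C ^ 3 * h" by (simp add: power2_eq_square)
    finally have "H (\<xi> (Suc i)) ?q \<le> E + 1" using 1 small by linarith
    then show ?case using 1 sublevel_R by blast
  qed
  have v: "\<xi> (Suc i) = \<xi> i + h * d2 H (\<xi> i) (p (Suc i))" if "i < N" for i
    using vel energy[of i] that by simp
  have "LB (\<xi> i) ((\<xi> (Suc i) - \<xi> i) / h) = ell (\<xi> i) (p (Suc i))" if "i < N" for i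
    using v[OF that] h LB_velocity[OF opt_bound[OF p[of i]], of "\<xi> i"] by simp
  then have "J N h \<xi> = Uo (\<xi> 0) + (\<Sum>i<N. h * ell (\<xi> i) (p (Suc i)))"
    unfolding J_def by (auto intro!: sum.cong)
  moreover have "p (Suc i) = p i - h * d1 H (\<xi> i) (p (Suc i))" if "i < N" for i
    using step[OF that] by simp
  ultimately have "discrete_minimiser N h x \<xi> p"
    unfolding discrete_minimiser_def using \<xi> min energy v by blast
  then show ?thesis by blast
qed

end

section \<open>Passage to continuous time\<close>

lemma MVT_norm_le:
  fixes z :: "real \<Rightarrow> 'a::real_normed_vector"
  assumes "\<And>s. s \<in> {a..b} \<Longrightarrow> (z has_vector_derivative z' s) (at s within {a..b})"
    and "\<And>s. s \<in> {a..b} \<Longrightarrow> norm (z' s) \<le> c" and "s \<in> {a..b}" "r \<in> {a..b}"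
  shows "norm (z s - z r) \<le> c * \<bar>s - r\<bar>"
proof -
  have "norm (z s - z r) \<le> c * norm (s - r)"
  proof (rule differentiable_bound[where S="{a..b}" and f'="\<lambda>s h. h *\<^sub>R z' s"])
    show "(z has_derivative (\<lambda>h. h *\<^sub>R z' s)) (at s within {a..b})" if "s \<in> {a..b}" for s
      using assms(1)[OF that] by (simp add: has_vector_derivative_def)
    show "onorm (\<lambda>h. h *\<^sub>R z' s) \<le> c" if "s \<in> {a..b}" for s
      using mult_right_mono[OF assms(2)[OF that], of "\<bar>x\<bar>" for x]
      by (intro onorm_le) (simp add: mult.commute)
  qed (use assms in auto)
  then show ?thesis by simp
qed

lemma riemann_sum_estimate:
  fixes f :: "real \<Rightarrow> real"
  assumes h: "h \<ge> 0" and "f integrable_on {0..real N * h}"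
    and "\<And>i r. i < N \<Longrightarrow> real i * h \<le> r \<Longrightarrow> r \<le> real (Suc i) * h \<Longrightarrow> \<bar>f r - c i\<bar> \<le> d"
  shows "\<bar>integral {0..real N * h} f - (\<Sum>i<N. h * c i)\<bar> \<le> real N * h * d"
  using assms(2,3)
proof (induction N)
  case (Suc N)
  let ?a = "real N * h" and ?b = "real (Suc N) * h"
  have ab: "0 \<le> ?a" "?a \<le> ?b" using h by (auto simp: algebra_simps)
  have i1: "f integrable_on {0..?a}" and i2: "f integrable_on {?a..?b}"
    using ab by (auto intro: integrable_on_subinterval[OF Suc.prems(1)])
  have "\<bar>integral {?a..?b} f - h * c N\<bar> \<le> h * d"
  proof -
    have "integral {?a..?b} f - h * c N = integral {?a..?b} (\<lambda>r. f r - c N)"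
      using integral_diff[OF i2 integrable_const_ivl[of "c N"]] ab by (simp add: algebra_simps)
    also have "norm \<dots> \<le> integral {?a..?b} (\<lambda>r. d)"
      using i2 Suc.prems(2)[of N] by (intro integral_norm_bound_integral integrable_diff) auto
    also have "\<dots> = h * d" using ab by (simp add: algebra_simps)
    finally show ?thesis by simp
  qed
  moreover have "\<bar>integral {0..?a} f - (\<Sum>i<N. h * c i)\<bar> \<le> ?a * d"
    using i1 Suc.prems(2) by (intro Suc.IH) auto
  moreover have "integral {0..?b} f = integral {0..?a} f + integral {?a..?b} f"
    using Henstock_Kurzweil_Integration.integral_combine[OF ab Suc.prems(1)] by simp
  ultimately show ?case by (simp add: algebra_simps)
qed simp

lemma grid_point:
  assumes "h > 0" "0 \<le> s" "s \<le> real N * h"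
  obtains i where "i \<le> N" "real i * h \<le> s" "s \<le> real i * h + h"
proof
  let ?i = "nat \<lfloor>s / h\<rfloor>"
  have fl: "real ?i \<le> s / h" "s / h \<le> real ?i + 1"
    using assms by (auto simp: of_nat_nat)
  show 1: "real ?i * h \<le> s" "s \<le> real ?i * h + h"
    using fl assms(1) by (auto simp: field_simps)
  have "real ?i * h \<le> real N * h" using 1 assms by linarith
  then show "?i \<le> N" using assms(1) by simp
qed

lemma tendsto_0_le_imp:
  fixes a :: real
  assumes "D \<longlonglongrightarrow> 0" "\<And>n. a \<le> b + D n"
  shows "a \<le> b"
  using LIMSEQ_le_const[of "\<lambda>n. b + D n" "b + 0" a] tendsto_add[OF tendsto_const assms(1)] assms(2)
  by auto

lemma euler_split:
  fixes b :: "'a::real_normed_vector"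
  shows "norm (b - w') \<le> norm (a - w) + norm (b - a - h *\<^sub>R f) + norm (w' - w - h *\<^sub>R g)
    + norm (h *\<^sub>R (f - g))"
proof -
  let ?c = "b - a - h *\<^sub>R f" and ?d = "w' - w - h *\<^sub>R g"
  have eq: "b - w' = (a - w) + ?c - ?d + h *\<^sub>R (f - g)" by (simp add: scaleR_diff_right)
  show ?thesis
    unfolding eq
    using norm_triangle_ineq[of "(a - w) + ?c - ?d" "h *\<^sub>R (f - g)"]
      norm_triangle_ineq4[of "(a - w) + ?c" ?d] norm_triangle_ineq[of "a - w" ?c]
    by linarith
qed

section \<open>The flow with clamped momentum\<close>

context ham_box
begin

definition "cl p = max (- B) (min B p)"
text \<open>The Hamiltonian vector field with the momentum clamped to the strip. It is bounded and
  globally Lipschitz, so its orbits are global, and they solve the original system as long as the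
  momentum stays in the strip.\<close>

definition "F z = (d2 H (fst z) (cl (snd z)), - d1 H (fst z) (cl (snd z)))"

lemma cl_bound: "\<bar>cl p\<bar> \<le> B" and cl_id: "\<bar>p\<bar> \<le> B \<Longrightarrow> cl p = p"
  and cl_lip: "\<bar>cl p - cl p'\<bar> \<le> \<bar>p - p'\<bar>"
  using B_pos by (auto simp: cl_def)

lemma norm_prod_le: "norm (z :: real \<times> real) \<le> \<bar>fst z\<bar> + \<bar>snd z\<bar>"
  using norm_triangle_ineq[of "(fst z, 0)" "(0, snd z)"] by (simp add: norm_Pair)

lemma abs_fst_le: "\<bar>fst z\<bar> \<le> norm (z :: real \<times> real)" 
  and abs_snd_le: "\<bar>snd z\<bar> \<le> norm (z :: real \<times> real)"
  by (metis norm_fst_le prod.collapse real_norm_def, metis norm_snd_le prod.collapse real_norm_def)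

lemma F_lip: "norm (F z - F w) \<le> 4 * C * norm (z - w)"
proof -
  let ?d = "\<bar>fst z - fst w\<bar> + \<bar>cl (snd z) - cl (snd w)\<bar>"
  have "norm (F z - F w) \<le> \<bar>fst (F z - F w)\<bar> + \<bar>snd (F z - F w)\<bar>" by (rule norm_prod_le)
  also have "\<dots> \<le> C * ?d + C * ?d"
    using Hx_lip[OF cl_bound cl_bound, of "fst z" "snd z" "fst w" "snd w"]
      Hp_lip[OF cl_bound cl_bound, of "fst z" "snd z" "fst w" "snd w"]
    by (intro add_mono) (auto simp: F_def)
  also have "\<dots> = 2 * C * ?d" by simp
  also have "?d \<le> 2 * norm (z - w)"
    using cl_lip[of "snd z" "snd w"] abs_fst_le[of "z - w"] abs_snd_le[of "z - w"] by simp
  then have "2 * C * ?d \<le> 2 * C * (2 * norm (z - w))" using C_pos by (intro mult_left_mono) auto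
  finally show ?thesis by simp
qed

lemma F_bound: "norm (F z) \<le> 2 * C"
  using norm_prod_le[of "F z"] Hx_bound[OF cl_bound, of "fst z" "snd z"] Hp_bound[OF cl_bound, of "fst z" "snd z"]
  by (simp add: F_def)

lemma hs_sol_imp_F:
  assumes "hs_sol H t q p" "\<And>s. s \<in> {0..t} \<Longrightarrow> \<bar>p s\<bar> \<le> B" "s \<in> {0..t}"
  shows "((\<lambda>s. (q s, p s)) has_vector_derivative F (q s, p s)) (at s within {0..t})"
  using assms by (auto simp: hs_sol_def F_def cl_id has_real_derivative_iff_has_vector_derivative
      intro!: has_vector_derivative_Pair)

lemma F_imp_hs_sol:
  assumes z: "\<And>s. s \<in> {0..t} \<Longrightarrow> (z has_vector_derivative F (z s)) (at s within {0..t})"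
    and b: "\<And>s. s \<in> {0..t} \<Longrightarrow> \<bar>snd (z s)\<bar> \<le> B"
  shows "hs_sol H t (\<lambda>s. fst (z s)) (\<lambda>s. snd (z s))"
  unfolding hs_sol_def
proof (intro ballI conjI)
  fix s assume s: "s \<in> {0..t}"
  show "((\<lambda>s. fst (z s)) has_real_derivative d2 H (fst (z s)) (snd (z s))) (at s within {0..t})"
    using bounded_linear.has_vector_derivative[OF bounded_linear_fst z[OF s]] b[OF s]
    by (simp add: F_def cl_id has_real_derivative_iff_has_vector_derivative)
  show "((\<lambda>s. snd (z s)) has_real_derivative - d1 H (fst (z s)) (snd (z s))) (at s within {0..t})"
    using bounded_linear.has_vector_derivative[OF bounded_linear_snd z[OF s]] b[OF s]
    by (simp add: F_def cl_id has_real_derivative_iff_has_vector_derivative)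
qed

lemma box_continuous:
  fixes f :: "real \<Rightarrow> real \<Rightarrow> real"
  assumes f: "\<And>x p x' p'. \<bar>p\<bar> \<le> B \<Longrightarrow> \<bar>p'\<bar> \<le> B \<Longrightarrow> \<bar>f x p - f x' p'\<bar> \<le> c * (\<bar>x - x'\<bar> + \<bar>p - p'\<bar>)"
    and q: "continuous_on S q" and p: "continuous_on S p" and b: "\<And>s. s \<in> S \<Longrightarrow> \<bar>p s\<bar> \<le> B"
  shows "continuous_on S (\<lambda>s. f (q s) (p s))"
  unfolding continuous_on_def
proof
  fix s assume s: "s \<in> S"
  have "((\<lambda>r. c * (\<bar>q r - q s\<bar> + \<bar>p r - p s\<bar>)) \<longlongrightarrow> c * (\<bar>q s - q s\<bar> + \<bar>p s - p s\<bar>)) (at s within S)"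
    using q p s unfolding continuous_on_def by (intro tendsto_intros) auto
  then have lim: "((\<lambda>r. c * (\<bar>q r - q s\<bar> + \<bar>p r - p s\<bar>)) \<longlongrightarrow> 0) (at s within S)" by simp
  have "((\<lambda>r. f (q r) (p r) - f (q s) (p s)) \<longlongrightarrow> 0) (at s within S)"
    by (rule Lim_null_comparison[OF _ lim])
       (use f b s in \<open>auto simp: eventually_at_filter\<close>)
  then show "((\<lambda>r. f (q r) (p r)) \<longlongrightarrow> f (q s) (p s)) (at s within S)"
    by (rule LIM_zero_cancel)
qed

lemma hs_sol_continuous:
  assumes "hs_sol H t q p"
  shows "continuous_on {0..t} q" "continuous_on {0..t} p"
  by (rule DERIV_continuous_on, use assms in \<open>auto simp: hs_sol_def\<close>)+

lemma ell_continuous: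
  assumes "hs_sol H t q p" "\<And>s. s \<in> {0..t} \<Longrightarrow> \<bar>p s\<bar> \<le> B"
  shows "continuous_on {0..t} (\<lambda>s. ell (q s) (p s))"
  by (rule box_continuous[OF ell_lip]) (use assms hs_sol_continuous in auto)

lemma ell_integrable:
  assumes "hs_sol H t q p" "\<And>s. s \<in> {0..t} \<Longrightarrow> \<bar>p s\<bar> \<le> B"
  shows "(\<lambda>s. ell (q s) (p s)) integrable_on {0..t}"
  using ell_continuous[OF assms] by (rule integrable_continuous_real)

lemma LB_continuous:
  assumes "continuous_on S \<gamma>" "continuous_on S g"
  shows "continuous_on S (\<lambda>s. LB (\<gamma> s) (g s))"
  unfolding continuous_on_def
proof
  fix s assume s: "s \<in> S"
  have "((\<lambda>r. C * \<bar>\<gamma> r - \<gamma> s\<bar> + B * \<bar>g r - g s\<bar>) \<longlongrightarrow> C * \<bar>\<gamma> s - \<gamma> s\<bar> + B * \<bar>g s - g s\<bar>) (at s within S)"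
    using assms s unfolding continuous_on_def by (intro tendsto_intros) auto
  then have lim: "((\<lambda>r. C * \<bar>\<gamma> r - \<gamma> s\<bar> + B * \<bar>g r - g s\<bar>) \<longlongrightarrow> 0) (at s within S)" by simp
  have "((\<lambda>r. LB (\<gamma> r) (g r) - LB (\<gamma> s) (g s)) \<longlongrightarrow> 0) (at s within S)"
    by (rule Lim_null_comparison[OF _ lim]) (use LB_lip in \<open>auto simp: eventually_at_filter\<close>)
  then show "((\<lambda>r. LB (\<gamma> r) (g r)) \<longlongrightarrow> LB (\<gamma> s) (g s)) (at s within S)"
    by (rule LIM_zero_cancel)
qed

text \<open>It suffices to extract a convergent subsequence of initial points: continuous dependence
  makes the orbits converge uniformly to the clamped orbit of the limit point. The momentum bound
  passes to the limit, so that orbit is Hamiltonian, and \<open>ell_lip\<close> carries the action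
  along.\<close>

lemma hs_sol_limit:
  assumes hs: "\<And>n. hs_sol H t (q n) (p n)" and b: "\<And>n s. s \<in> {0..t} \<Longrightarrow> \<bar>p n s\<bar> \<le> R"
    and RB: "R \<le> B" and t: "t \<ge> 0" and q0: "bounded (range (\<lambda>n. q n 0))"
  obtains r q' p' where "strict_mono (r :: nat \<Rightarrow> nat)" "hs_sol H t q' p'"
    "\<forall>s\<in>{0..t}. \<bar>p' s\<bar> \<le> R"
    "\<forall>s\<in>{0..t}. (\<lambda>n. q (r n) s) \<longlonglongrightarrow> q' s"
    "\<forall>s\<in>{0..t}. (\<lambda>n. p (r n) s) \<longlonglongrightarrow> p' s"
    "(\<lambda>n. integral {0..t} (\<lambda>s. ell (q (r n) s) (p (r n) s))) \<longlonglongrightarrow> integral {0..t} (\<lambda>s. ell (q' s) (p' s))"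
proof -
  have bB: "\<bar>p n s\<bar> \<le> B" if "s \<in> {0..t}" for n s using b[OF that, of n] RB by simp
  define z where "z = (\<lambda>n s. (q n s, p n s))"
  have z: "(z n has_vector_derivative F (z n s)) (at s within {0..t})" if "s \<in> {0..t}" for n s
    unfolding z_def using hs_sol_imp_F[OF hs bB that] .
  have "bounded (range (\<lambda>n. q n 0) \<times> {-R..R})" using q0 by (intro bounded_Times) auto
  then have "bounded (range (\<lambda>n. z n 0))"
    by (rule bounded_subset) (use b[of 0] t in \<open>auto simp: z_def abs_le_iff minus_le_iff\<close>)
  then obtain z0 r where r: "strict_mono (r :: nat \<Rightarrow> nat)" "(\<lambda>n. z (r n) 0) \<longlonglongrightarrow> z0"
    using bounded_imp_convergent_subsequence[of "\<lambda>n. z n 0"] by (auto simp: comp_def)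
  obtain Z where Z: "Z 0 = z0" "\<And>s. s \<in> {0..t} \<Longrightarrow> (Z has_vector_derivative F (Z s)) (at s within {0..t})"
    using ode_global_existence[OF F_lip, of z0 t] C_pos by auto
  define D where "D = (\<lambda>n. exp (4 * C * t) * norm (z (r n) 0 - z0))"
  have D: "D \<longlonglongrightarrow> 0"
    using tendsto_mult_left[OF tendsto_norm[OF LIM_zero[OF r(2)]], of "exp (4 * C * t)"] by (simp add: D_def)
  have dist: "norm (z (r n) s - Z s) \<le> D n" if s: "s \<in> {0..t}" for n s
  proof -
    have "norm (z (r n) s - Z s) \<le> exp (4 * C * \<bar>s - 0\<bar>) * norm (z (r n) 0 - Z 0)"
      by (rule ode_continuous_dependence[where a=0 and b=t, OF F_lip z Z(2)]) (use s in auto)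
    also have "\<dots> \<le> D n" unfolding D_def Z(1) using s C_pos by (intro mult_right_mono) auto
    finally show ?thesis .
  qed
  have dq: "\<bar>q (r n) s - fst (Z s)\<bar> \<le> D n" and dp: "\<bar>p (r n) s - snd (Z s)\<bar> \<le> D n" if "s \<in> {0..t}" for n s
    using dist[OF that, of n] abs_fst_le[of "z (r n) s - Z s"] abs_snd_le[of "z (r n) s - Z s"]
    by (auto simp: z_def)
  have conv: "(\<lambda>n. q (r n) s) \<longlonglongrightarrow> fst (Z s)" "(\<lambda>n. p (r n) s) \<longlonglongrightarrow> snd (Z s)" if "s \<in> {0..t}" for s
    by (rule LIM_zero_cancel, rule Lim_null_comparison[OF _ D], use dq dp that in auto)+
  have bZ: "\<bar>snd (Z s)\<bar> \<le> R" if "s \<in> {0..t}" for s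
    using LIMSEQ_le_const2[OF tendsto_rabs[OF conv(2)[OF that]]] b[OF that] by blast
  have hsZ: "hs_sol H t (\<lambda>s. fst (Z s)) (\<lambda>s. snd (Z s))"
    using bZ RB by (intro F_imp_hs_sol Z(2)) force+
  have bZB: "\<bar>snd (Z s)\<bar> \<le> B" if "s \<in> {0..t}" for s using bZ[OF that] RB by simp
  show ?thesis
  proof (rule that[OF r(1) hsZ])
    show "\<forall>s\<in>{0..t}. \<bar>snd (Z s)\<bar> \<le> R" "\<forall>s\<in>{0..t}. (\<lambda>n. q (r n) s) \<longlonglongrightarrow> fst (Z s)"
      "\<forall>s\<in>{0..t}. (\<lambda>n. p (r n) s) \<longlonglongrightarrow> snd (Z s)"
      using bZ conv by blast+
    have "\<bar>integral {0..t} (\<lambda>s. ell (q (r n) s) (p (r n) s)) - integral {0..t} (\<lambda>s. ell (fst (Z s)) (snd (Z s)))\<bar>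
        \<le> t * ((2 + B) * C * (2 * D n))" for n
    proof -
      have const: "integral {0..t} (\<lambda>s. k) = t * k" for k :: real using t by simp
      have "integral {0..t} (\<lambda>s. ell (q (r n) s) (p (r n) s)) - integral {0..t} (\<lambda>s. ell (fst (Z s)) (snd (Z s)))
        = integral {0..t} (\<lambda>s. ell (q (r n) s) (p (r n) s) - ell (fst (Z s)) (snd (Z s)))"
        by (rule integral_diff[symmetric]) (intro ell_integrable hs hsZ bB bZB; assumption)+
      also have "norm \<dots> \<le> integral {0..t} (\<lambda>s. (2 + B) * C * (2 * D n))"
      proof (rule integral_norm_bound_integral)
        show "(\<lambda>s. ell (q (r n) s) (p (r n) s) - ell (fst (Z s)) (snd (Z s))) integrable_on {0..t}"
          by (rule integrable_diff) (intro ell_integrable hs hsZ bB bZB; assumption)+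
        fix s assume s: "s \<in> {0..t}"
        have "\<bar>ell (q (r n) s) (p (r n) s) - ell (fst (Z s)) (snd (Z s))\<bar>
          \<le> (2 + B) * C * (\<bar>q (r n) s - fst (Z s)\<bar> + \<bar>p (r n) s - snd (Z s)\<bar>)"
          by (rule ell_lip[OF bB[OF s] bZB[OF s]])
        also have "\<dots> \<le> (2 + B) * C * (2 * D n)"
          using dq[OF s, of n] dp[OF s, of n] B_pos C_pos by (intro mult_left_mono) auto
        finally show "norm (ell (q (r n) s) (p (r n) s) - ell (fst (Z s)) (snd (Z s))) \<le> (2 + B) * C * (2 * D n)"
          by simp
      qed auto
      also have "\<dots> = t * ((2 + B) * C * (2 * D n))" using const .
      finally show ?thesis by (simp only: real_norm_def)
    qed
    then have le: "\<forall>n. norm (integral {0..t} (\<lambda>s. ell (q (r n) s) (p (r n) s))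
        - integral {0..t} (\<lambda>s. ell (fst (Z s)) (snd (Z s)))) \<le> t * ((2 + B) * C * (2 * D n))"
      by (simp only: real_norm_def) blast
    have "(\<lambda>n. t * ((2 + B) * C * 2) * D n) \<longlonglongrightarrow> t * ((2 + B) * C * 2) * 0"
      by (intro tendsto_mult_left D)
    then have "(\<lambda>n. t * ((2 + B) * C * (2 * D n))) \<longlonglongrightarrow> 0"
      by (simp add: mult.assoc)
    from Lim_null_comparison[OF always_eventually[OF le] this]
    have "(\<lambda>n. integral {0..t} (\<lambda>s. ell (q (r n) s) (p (r n) s))
        - integral {0..t} (\<lambda>s. ell (fst (Z s)) (snd (Z s)))) \<longlonglongrightarrow> 0" .
    then show "(\<lambda>n. integral {0..t} (\<lambda>s. ell (q (r n) s) (p (r n) s)))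
        \<longlonglongrightarrow> integral {0..t} (\<lambda>s. ell (fst (Z s)) (snd (Z s)))"
      by (rule LIM_zero_cancel)
  qed
qed

text \<open>The local error per step is \<open>10 * C\<^sup>2 * h\<^sup>2\<close>: a part 8 because
  the exact orbit leaves its tangent (Lipschitz constant \<open>4 * C\<close> times speed
  \<open>2 * C\<close>), and a part 2 because the scheme evaluates the field at the new momentum.
  The exponential is discrete Gronwall.\<close>

lemma euler_error:
  assumes z: "\<And>s. s \<in> {0..t} \<Longrightarrow> (z has_vector_derivative F (z s)) (at s within {0..t})"
    and h: "h > 0" "real N * h = t" and z0: "z 0 = (\<xi> 0, p 0)"
    and b: "\<And>i. i \<le> N \<Longrightarrow> \<bar>p i\<bar> \<le> B"
    and x: "\<And>i. i < N \<Longrightarrow> \<xi> (Suc i) = \<xi> i + h * d2 H (\<xi> i) (p (Suc i))"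
    and p: "\<And>i. i < N \<Longrightarrow> p (Suc i) = p i - h * d1 H (\<xi> i) (p (Suc i))"
    and i: "i \<le> N"
  shows "norm (z (real i * h) - (\<xi> i, p i)) \<le> t * (10 * C\<^sup>2) * exp (4 * C * t) * h"
proof -
  define e where "e = (\<lambda>i. norm (z (real i * h) - (\<xi> i, p i)))"
  have "e i \<le> real i * h * (10 * C\<^sup>2) * exp (4 * C * (real i * h)) * h" if "i \<le> N" for i
    using that
  proof (induction i)
    case 0
    then show ?case by (simp add: e_def z0)
  next
    case (Suc i)
    let ?a = "real i * h" and ?b = "real (Suc i) * h"
    have i: "i < N" using Suc by simp
    have "?b \<le> t" unfolding h(2)[symmetric] using i h(1) by (intro mult_right_mono) auto
    then have ab: "0 \<le> ?a" "?b = ?a + h" "{?a..?b} \<subseteq> {0..t}" using h by (auto simp: algebra_simps)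
    have zd: "(z has_vector_derivative F (z s)) (at s within {?a..?b})" if "s \<in> {?a..?b}" for s
      using has_vector_derivative_within_subset[OF z ab(3)] that ab(3) by blast
    have incr: "norm ((\<lambda>s. z s - s *\<^sub>R F (z ?a)) ?b - (\<lambda>s. z s - s *\<^sub>R F (z ?a)) ?a) \<le> (4 * C * (2 * C * h)) * \<bar>?b - ?a\<bar>"
    proof (rule MVT_norm_le[where z'="\<lambda>s. F (z s) - F (z ?a)"])
      fix s assume s: "s \<in> {?a..?b}"
      show "((\<lambda>s. z s - s *\<^sub>R F (z ?a)) has_vector_derivative F (z s) - F (z ?a)) (at s within {?a..?b})"
        using zd[OF s] by (auto intro!: derivative_eq_intros)
      have "norm (z s - z ?a) \<le> 2 * C * \<bar>s - ?a\<bar>"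
        by (rule MVT_norm_le[OF zd F_bound s]) (use ab h in auto)
      also have "\<dots> \<le> 2 * C * h" using s ab C_pos by (intro mult_left_mono) auto
      finally have "norm (z s - z ?a) \<le> 2 * C * h" .
      then have "4 * C * norm (z s - z ?a) \<le> 4 * C * (2 * C * h)"
        using C_pos by (intro mult_left_mono) auto
      then show "norm (F (z s) - F (z ?a)) \<le> 4 * C * (2 * C * h)" using F_lip[of "z s" "z ?a"] by simp
    qed (use ab h in auto)
    have 1: "norm (z ?b - z ?a - h *\<^sub>R F (z ?a)) \<le> 8 * C\<^sup>2 * h\<^sup>2"
    proof -
      have bah: "?b - ?a = h" by (simp add: algebra_simps)
      have "z ?b - z ?a - h *\<^sub>R F (z ?a) = (\<lambda>s. z s - s *\<^sub>R F (z ?a)) ?b - (\<lambda>s. z s - s *\<^sub>R F (z ?a)) ?a"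
        by (subst bah[symmetric]) (simp add: scaleR_left_diff_distrib)
      moreover have "4 * C * (2 * C * h) * \<bar>?b - ?a\<bar> = 8 * C\<^sup>2 * h\<^sup>2"
        unfolding bah using h(1) by (simp add: power2_eq_square)
      ultimately show ?thesis using incr by (simp only:)
    qed
    let ?w = "(\<xi> i, p i)" and ?w' = "(\<xi> (Suc i), p (Suc i))"
    have pb: "\<bar>p i\<bar> \<le> B" "\<bar>p (Suc i)\<bar> \<le> B" using b i by auto
    have dp: "\<bar>p (Suc i) - p i\<bar> \<le> h * C"
    proof -
      have "p (Suc i) - p i = - (h * d1 H (\<xi> i) (p (Suc i)))" using p[OF i] by simp
      then show ?thesis using Hx_bound[OF pb(2), of "\<xi> i"] h by (simp only: abs_minus abs_mult) simp
    qed
    have 2: "norm (?w' - ?w - h *\<^sub>R F ?w) \<le> 2 * C\<^sup>2 * h\<^sup>2"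
    proof -
      let ?v = "?w' - ?w - h *\<^sub>R F ?w"
      have f: "fst ?v = h * (d2 H (\<xi> i) (p (Suc i)) - d2 H (\<xi> i) (p i))"
        "snd ?v = - h * (d1 H (\<xi> i) (p (Suc i)) - d1 H (\<xi> i) (p i))"
        using x[OF i] p[OF i] pb by (auto simp: F_def cl_id algebra_simps)
      have "C * \<bar>p (Suc i) - p i\<bar> \<le> C * (h * C)" using dp C_pos by (intro mult_left_mono) auto
      then have "\<bar>d2 H (\<xi> i) (p (Suc i)) - d2 H (\<xi> i) (p i)\<bar> \<le> C * (h * C)"
        "\<bar>d1 H (\<xi> i) (p (Suc i)) - d1 H (\<xi> i) (p i)\<bar> \<le> C * (h * C)"
        using Hp_lip[OF pb(2,1), of "\<xi> i" "\<xi> i"] Hx_lip[OF pb(2,1), of "\<xi> i" "\<xi> i"] by auto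
      then have "\<bar>fst ?v\<bar> \<le> h * (C * (h * C))" "\<bar>snd ?v\<bar> \<le> h * (C * (h * C))"
        unfolding f abs_mult using h by (auto intro!: mult_left_mono)
      then have "norm ?v \<le> h * (C * (h * C)) + h * (C * (h * C))"
        using norm_prod_le[of ?v] by linarith
      also have "h * (C * (h * C)) + h * (C * (h * C)) = 2 * C\<^sup>2 * h\<^sup>2"
        by (simp add: power2_eq_square)
      finally show ?thesis .
    qed
    have 4: "norm (z ?b - ?w') \<le> norm (z ?a - ?w) + norm (z ?b - z ?a - h *\<^sub>R F (z ?a))
        + norm (?w' - ?w - h *\<^sub>R F ?w) + norm (h *\<^sub>R (F (z ?a) - F ?w))"
      by (rule euler_split)
    have e_eq: "norm (z ?a - ?w) = e i" "norm (z ?b - ?w') = e (Suc i)" unfolding e_def by (rule refl)+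
    have "h * norm (F (z ?a) - F ?w) \<le> h * (4 * C * e i)"
      using F_lip[of "z ?a" ?w] h(1) unfolding e_eq by (intro mult_left_mono) auto
    then have "norm (h *\<^sub>R (F (z ?a) - F ?w)) \<le> h * (4 * C * e i)"
      using h(1) unfolding norm_scaleR by simp
    moreover have "(1 + 4 * C * h) * e i = e i + h * (4 * C * e i)" by (simp add: algebra_simps)
    ultimately have "e (Suc i) \<le> (1 + 4 * C * h) * e i + 10 * C\<^sup>2 * h\<^sup>2"
      using 1 2 4 unfolding e_eq by linarith
    also have "\<dots> \<le> exp (4 * C * h) * (real i * h * (10 * C\<^sup>2) * exp (4 * C * (real i * h)) * h)
        + exp (4 * C * (real (Suc i) * h)) * (10 * C\<^sup>2 * h\<^sup>2)"
    proof (rule add_mono)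
      show "(1 + 4 * C * h) * e i \<le> exp (4 * C * h) * (real i * h * (10 * C\<^sup>2) * exp (4 * C * (real i * h)) * h)"
        using Suc C_pos h by (intro mult_mono exp_ge_add_one_self) (auto simp: e_def)
      have "1 * (10 * C\<^sup>2 * h\<^sup>2) \<le> exp (4 * C * (real (Suc i) * h)) * (10 * C\<^sup>2 * h\<^sup>2)"
        using C_pos h by (intro mult_right_mono) auto
      then show "10 * C\<^sup>2 * h\<^sup>2 \<le> exp (4 * C * (real (Suc i) * h)) * (10 * C\<^sup>2 * h\<^sup>2)" by simp
    qed
    also have "\<dots> = real (Suc i) * h * (10 * C\<^sup>2) * exp (4 * C * (real (Suc i) * h)) * h"
    proof -
      have "exp (4 * C * (real (Suc i) * h)) = exp (4 * C * h) * exp (4 * C * (real i * h))"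
        by (simp add: algebra_simps flip: exp_add)
      then show ?thesis by (simp add: power2_eq_square algebra_simps)
    qed
    finally show ?case .
  qed
  from this[OF i] have le: "e i \<le> real i * h * (10 * C\<^sup>2) * exp (4 * C * (real i * h)) * h" .
  have "real i * h \<le> t" unfolding h(2)[symmetric] using i h(1) by (intro mult_right_mono) auto
  moreover have "t \<ge> 0" using h by auto
  ultimately have "real i * h * (10 * C\<^sup>2) * exp (4 * C * (real i * h)) * h \<le> t * (10 * C\<^sup>2) * exp (4 * C * t) * h"
    using h(1) C_pos by (intro mult_mono mult_right_mono) auto
  then show ?thesis using order_trans[OF le] unfolding e_def by blast
qed

end

section \<open>Limits of discrete minimisers\<close>

context ham_disc
begin

lemma Uo_continuous: "continuous_on S Uo"
proof (rule lipschitz_on_continuous_on)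
  show "K-lipschitz_on S Uo"
    using K_nonneg Uo_lip by (intro lipschitz_onI) (auto simp: dist_real_def)
qed

text \<open>A Lipschitz velocity, with a constant depending on the curve, is what makes the discrete
  cost converge; orbits and their deformations satisfy it, and no other curves have to be
  compared.\<close>

definition "competitor t x \<gamma> g \<longleftrightarrow> (\<forall>s\<in>{0..t}. (\<gamma> has_real_derivative g s) (at s within {0..t})) \<and>
   (\<exists>M. \<forall>s\<in>{0..t}. \<forall>r\<in>{0..t}. \<bar>g s - g r\<bar> \<le> M * \<bar>s - r\<bar>) \<and> \<gamma> t = x"

text \<open>On each cell the difference quotient equals the velocity at some intermediate time, so
  \<open>LB_lip\<close> bounds the sampling error by the oscillation of curve and velocity over one
  step.\<close>

lemma competitor_discrete:
  assumes t: "t > 0" and comp: "competitor t x \<gamma> g"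
  obtains M where "M \<ge> 0" 
    "\<And>N h. h > 0 \<Longrightarrow> real N * h = t \<Longrightarrow> J N h (\<lambda>i. \<gamma> (real i * h)) \<le> Uo (\<gamma> 0) + integral {0..t} (\<lambda>s. LB (\<gamma> s) (g s)) + M * h"
proof -
  have d\<gamma>: "(\<gamma> has_real_derivative g s) (at s within {0..t})" if "s \<in> {0..t}" for s
    using comp that by (auto simp: competitor_def)
  obtain M where M: "\<And>s r. s \<in> {0..t} \<Longrightarrow> r \<in> {0..t} \<Longrightarrow> \<bar>g s - g r\<bar> \<le> M * \<bar>s - r\<bar>"
    using comp unfolding competitor_def by blast
  have M0: "M \<ge> 0" using order_trans[OF abs_ge_zero M[of 0 t]] t by (auto simp: zero_le_mult_iff)
  define G where "G = \<bar>g 0\<bar> + M * t"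
  have G: "\<bar>g s\<bar> \<le> G" if "s \<in> {0..t}" for s
  proof -
    have "M * \<bar>s - 0\<bar> \<le> M * t" using that M0 by (intro mult_left_mono) auto
    then show ?thesis using M[of s 0] that t by (auto simp: G_def)
  qed
  have cg: "continuous_on {0..t} g"
  proof (rule lipschitz_on_continuous_on)
    show "M-lipschitz_on {0..t} g" using M M0 by (intro lipschitz_onI) (auto simp: dist_real_def)
  qed
  have c\<gamma>: "continuous_on {0..t} \<gamma>" using d\<gamma> by (rule DERIV_continuous_on)
  have int: "(\<lambda>s. LB (\<gamma> s) (g s)) integrable_on {0..t}"
    by (intro integrable_continuous_real LB_continuous c\<gamma> cg)
  have est: "J N h (\<lambda>i. \<gamma> (real i * h)) \<le> Uo (\<gamma> 0) + integral {0..t} (\<lambda>s. LB (\<gamma> s) (g s)) + t * (C * G + B * M) * h"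
    if h: "h > 0" "real N * h = t" for N h
  proof -
    let ?c = "\<lambda>i. LB (\<gamma> (real i * h)) ((\<gamma> (real (Suc i) * h) - \<gamma> (real i * h)) / h)"
    have "\<bar>integral {0..real N * h} (\<lambda>s. LB (\<gamma> s) (g s)) - (\<Sum>i<N. h * ?c i)\<bar> \<le> real N * h * ((C * G + B * M) * h)"
    proof (rule riemann_sum_estimate)
      fix i r assume i: "i < N" and r: "real i * h \<le> r" "r \<le> real (Suc i) * h"
      let ?a = "real i * h" and ?b = "real (Suc i) * h"
      have "?b \<le> t" unfolding h(2)[symmetric] using i h(1) by (intro mult_right_mono) auto
      then have sub: "0 \<le> ?a" "?a < ?b" "{?a..?b} \<subseteq> {0..t}" and bah: "?b - ?a = h"
        using h(1) by (auto simp: algebra_simps)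
      have d: "(\<gamma> has_real_derivative g s) (at s within {?a..?b})" if "s \<in> {?a..?b}" for s
        using d\<gamma> sub that by (meson DERIV_subset subsetD)
      have "\<exists>s\<in>{?a<..<?b}. \<gamma> ?b - \<gamma> ?a = (\<lambda>h. g s * h) (?b - ?a)"
        using d sub(2) by (intro mvt_simple[where f'="\<lambda>s h. g s * h"]) (auto simp: has_field_derivative_def)
      then obtain s where "s \<in> {?a<..<?b}" and s2: "\<gamma> ?b - \<gamma> ?a = g s * h" unfolding bah by blast
      then have s: "s \<in> {?a..?b}" "\<gamma> ?b - \<gamma> ?a = g s * h" unfolding greaterThanLessThan_iff atLeastAtMost_iff by auto
      have 1: "(\<gamma> ?b - \<gamma> ?a) / h = g s" using s h(1) by simp
      have "\<bar>g r - g s\<bar> \<le> M * \<bar>r - s\<bar>" using s(1) r sub by (intro M) auto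
      also have "\<dots> \<le> M * h" using s(1) r bah M0 by (intro mult_left_mono) auto
      finally have 2: "B * \<bar>g r - g s\<bar> \<le> B * (M * h)" using B_pos by (intro mult_left_mono) auto
      have "\<bar>\<gamma> r - \<gamma> ?a\<bar> \<le> G * \<bar>r - ?a\<bar>"
        using r sub d G by (intro MVT_abs_le[of "{?a..?b}" ?a r \<gamma> g]) auto
      also have "\<dots> \<le> G * h" using r bah G[of 0] t by (intro mult_left_mono) auto
      finally have 3: "C * \<bar>\<gamma> r - \<gamma> ?a\<bar> \<le> C * (G * h)" using C_pos by (intro mult_left_mono) auto
      show "\<bar>LB (\<gamma> r) (g r) - ?c i\<bar> \<le> (C * G + B * M) * h"
        using LB_lip[of "\<gamma> r" "g r" "\<gamma> ?a" "g s"] 2 3 unfolding 1 by (simp add: algebra_simps)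
    qed (use h int in auto)
    then show ?thesis using h(2) unfolding J_def by (simp add: abs_le_iff mult.assoc)
  qed
  show ?thesis
    by (rule that[OF _ est]) (use t C_pos B_pos M0 G[of 0] in auto)
qed

text \<open>The minimiser of the time-discretised problem converges, as the step tends to 0, to a
  solution of the Hamiltonian system that is optimal for the continuous problem.\<close>
theorem minimiser_exists:
  assumes t: "t > 0"
  obtains q p where "hs_sol H t q p" "q t = x" "\<And>s. s \<in> {0..t} \<Longrightarrow> \<bar>p s\<bar> \<le> R"
    "\<And>\<gamma> g. competitor t x \<gamma> g \<Longrightarrow>
       Uo (q 0) + integral {0..t} (\<lambda>s. ell (q s) (p s)) \<le> Uo (\<gamma> 0) + integral {0..t} (\<lambda>s. LB (\<gamma> s) (g s))"
proof -
  \<comment> \<open>Guarantees that every step size satisfies both smallness conditions of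
    \<open>discrete_extremal\<close>.\<close>
  define n0 where "n0 = nat \<lceil>t * C ^ 3 * t + t * C\<rceil> + 1"
  define NN where "NN = (\<lambda>n. n + n0)"
  define hh where "hh = (\<lambda>n. t / real (NN n))"
  have NN: "NN n > 0" "real (NN n) \<ge> t * C ^ 3 * t + t * C + 1" for n
    by (auto simp: NN_def n0_def) linarith
  have cc: "0 \<le> t * C ^ 3 * t" "0 \<le> t * C" using t C_pos by auto
  have hh: "hh n > 0" "real (NN n) * hh n = t" for n using t NN[of n] by (auto simp: hh_def)
  have h1: "real (NN n) * hh n * C ^ 3 * hh n \<le> 1" "hh n * C < 1" for n
  proof -
    have "t * C ^ 3 * t \<le> real (NN n)" "t * C < real (NN n)" using NN(2)[of n] cc by linarith+
    then show "real (NN n) * hh n * C ^ 3 * hh n \<le> 1" "hh n * C < 1"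
      unfolding hh(2) using NN(1)[of n] by (auto simp: hh_def field_simps)
  qed
  have hh_lim: "hh \<longlonglongrightarrow> 0"
  proof -
    have "(\<lambda>n. t / real n) \<longlonglongrightarrow> 0" by (rule lim_const_over_n)
    from LIMSEQ_ignore_initial_segment[OF this, of n0] show ?thesis by (simp add: hh_def NN_def)
  qed
  have "\<forall>n. \<exists>\<xi> p. discrete_minimiser (NN n) (hh n) x \<xi> p"
    by (intro allI discrete_extremal hh NN h1)
  then obtain \<xi> p where \<xi>p: "\<And>n. discrete_minimiser (NN n) (hh n) x (\<xi> n) (p n)" by metis
  have x_end: "\<xi> n (NN n) = x" and min: "\<zeta> (NN n) = x \<Longrightarrow> J (NN n) (hh n) (\<xi> n) \<le> J (NN n) (hh n) \<zeta>"
    and pR: "i \<le> NN n \<Longrightarrow> \<bar>p n i\<bar> \<le> R"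
    and xs: "i < NN n \<Longrightarrow> \<xi> n (Suc i) = \<xi> n i + hh n * d2 H (\<xi> n i) (p n (Suc i))"
    and ps: "i < NN n \<Longrightarrow> p n (Suc i) = p n i - hh n * d1 H (\<xi> n i) (p n (Suc i))"
    and JJ: "J (NN n) (hh n) (\<xi> n) = Uo (\<xi> n 0) + (\<Sum>i<NN n. hh n * ell (\<xi> n i) (p n (Suc i)))" for n i \<zeta>
    using \<xi>p[of n] unfolding discrete_minimiser_def by blast+
  have pB: "\<bar>p n i\<bar> \<le> B" if "i \<le> NN n" for n i using pR[OF that] R_less_B by simp
  have \<xi>0: "\<bar>x - \<xi> n 0\<bar> \<le> t * C" for n
  proof -
    have "\<bar>\<xi> n (NN n) - \<xi> n 0\<bar> \<le> (\<Sum>i<NN n. \<bar>\<xi> n (Suc i) - \<xi> n i\<bar>)"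
      by (rule abs_diff_le_variation) simp
    also have "\<dots> \<le> (\<Sum>i<NN n. hh n * C)"
    proof (rule sum_mono)
      fix i assume "i \<in> {..<NN n}"
      then have i: "i < NN n" by simp
      have "\<bar>\<xi> n (Suc i) - \<xi> n i\<bar> = hh n * \<bar>d2 H (\<xi> n i) (p n (Suc i))\<bar>"
        using xs[OF i] hh(1)[of n] by (simp add: abs_mult)
      also have "\<dots> \<le> hh n * C" using hh(1)[of n] i by (intro mult_left_mono Hp_bound pB) auto
      finally show "\<bar>\<xi> n (Suc i) - \<xi> n i\<bar> \<le> hh n * C" .
    qed
    also have "\<dots> = t * C" using hh(2)[of n] by (simp flip: mult.assoc)
    finally show ?thesis by (simp add: x_end)
  qed
  have "(\<xi> n 0, p n 0) \<in> {x - t * C..x + t * C} \<times> {-R..R}" for n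
  proof -
    have "\<bar>p n 0\<bar> \<le> R" by (rule pR) simp
    then have "- R \<le> p n 0" "p n 0 \<le> R" by linarith+
    moreover have "x - t * C \<le> \<xi> n 0" "\<xi> n 0 \<le> x + t * C" using \<xi>0[of n] by linarith+
    ultimately show ?thesis by simp
  qed
  then have "range (\<lambda>n. (\<xi> n 0, p n 0)) \<subseteq> {x - t * C..x + t * C} \<times> {-R..R}" by blast
  then have "bounded (range (\<lambda>n. (\<xi> n 0, p n 0)))"
    by (rule bounded_subset[rotated]) (intro bounded_Times, auto)
  then obtain z0 r where r: "strict_mono (r :: nat \<Rightarrow> nat)" "(\<lambda>n. (\<xi> (r n) 0, p (r n) 0)) \<longlonglongrightarrow> z0"
    using bounded_imp_convergent_subsequence[of "\<lambda>n. (\<xi> n 0, p n 0)"] by (auto simp: comp_def)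
  obtain Z where Z0: "Z 0 = z0" and Z: "\<And>s. s \<in> {0..t} \<Longrightarrow> (Z has_vector_derivative F (Z s)) (at s within {0..t})"
    using ode_global_existence[OF F_lip, of z0 t] C_pos by auto
  define c where "c = t * (10 * C\<^sup>2) * exp (4 * C * t)"
  define D where "D = (\<lambda>n. exp (4 * C * t) * norm ((\<xi> (r n) 0, p (r n) 0) - z0) + c * hh (r n))"
  have hr: "(\<lambda>n. hh (r n)) \<longlonglongrightarrow> 0" using LIMSEQ_subseq_LIMSEQ[OF hh_lim r(1)] by (simp add: comp_def)
  have D: "D \<longlonglongrightarrow> 0"
  proof -
    have "D \<longlonglongrightarrow> exp (4 * C * t) * norm (0 :: real \<times> real) + c * 0"
      unfolding D_def by (intro tendsto_add tendsto_mult_left tendsto_norm LIM_zero r(2) hr)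
    then show ?thesis by simp
  qed
  have dist: "norm (Z (real i * hh (r n)) - (\<xi> (r n) i, p (r n) i)) \<le> D n" if i: "i \<le> NN (r n)" for n i
  proof -
    let ?m = "r n"
    \<comment> \<open>The exact orbit \<open>z\<close> issued from the discrete initial point splits
      the error: the scheme differs from \<open>z\<close> by the Euler error, and \<open>z\<close>
      differs from \<open>Z\<close> by continuous dependence.\<close>
    obtain z where z0': "z 0 = (\<xi> ?m 0, p ?m 0)"
      and z: "\<And>s. s \<in> {0..t} \<Longrightarrow> (z has_vector_derivative F (z s)) (at s within {0..t})"
      using ode_global_existence[OF F_lip, of "(\<xi> ?m 0, p ?m 0)" t] C_pos by auto
    let ?s = "real i * hh ?m"
    have s: "?s \<in> {0..t}"
      using hh[of ?m] i mult_right_mono[of "real i" "real (NN ?m)" "hh ?m"] by auto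
    have "norm (z ?s - (\<xi> ?m i, p ?m i)) \<le> c * hh ?m"
      unfolding c_def by (rule euler_error[OF z hh(1) hh(2) z0' pB xs ps i])
    moreover have "norm (Z ?s - z ?s) \<le> exp (4 * C * \<bar>?s - 0\<bar>) * norm (Z 0 - z 0)"
      by (rule ode_continuous_dependence[where a=0 and b=t, OF F_lip Z z]) (use s t in auto)
    moreover have "\<dots> \<le> exp (4 * C * t) * norm ((\<xi> ?m 0, p ?m 0) - z0)"
      unfolding Z0 z0' norm_minus_commute[of z0] using s C_pos by (intro mult_right_mono) auto
    moreover have "norm (Z ?s - (\<xi> ?m i, p ?m i)) \<le> norm (Z ?s - z ?s) + norm (z ?s - (\<xi> ?m i, p ?m i))"
      using dist_triangle[of "Z ?s" "(\<xi> ?m i, p ?m i)" "z ?s"] by (simp only: dist_norm)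
    ultimately show ?thesis unfolding D_def by linarith
  qed
  define q' where "q' = (\<lambda>s. fst (Z s))"
  define p' where "p' = (\<lambda>s. snd (Z s))"
  have dq: "\<bar>q' (real i * hh (r n)) - \<xi> (r n) i\<bar> \<le> D n" 
    and dp: "\<bar>p' (real i * hh (r n)) - p (r n) i\<bar> \<le> D n" if "i \<le> NN (r n)" for n i
    using dist[OF that] abs_fst_le[of "Z (real i * hh (r n)) - (\<xi> (r n) i, p (r n) i)"]
      abs_snd_le[of "Z (real i * hh (r n)) - (\<xi> (r n) i, p (r n) i)"] by (auto simp: q'_def p'_def)
  have lipZ: "norm (Z s - Z u) \<le> 2 * C * \<bar>s - u\<bar>" if "s \<in> {0..t}" "u \<in> {0..t}" for s u
    by (rule MVT_norm_le[OF Z F_bound that])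
  have lipq: "\<bar>q' s - q' u\<bar> \<le> 2 * C * \<bar>s - u\<bar>" and lipp: "\<bar>p' s - p' u\<bar> \<le> 2 * C * \<bar>s - u\<bar>"
    if "s \<in> {0..t}" "u \<in> {0..t}" for s u
    using lipZ[OF that] abs_fst_le[of "Z s - Z u"] abs_snd_le[of "Z s - Z u"] by (auto simp: q'_def p'_def)
  have grid: "real i * hh n \<in> {0..t}" if "i \<le> NN n" for i n
    using hh[of n] that mult_right_mono[of "real i" "real (NN n)" "hh n"] by auto
  have q't: "q' t = x"
  proof -
    have "\<bar>q' t - x\<bar> \<le> 0 + D n" for n
      using dq[of "NN (r n)" n] by (simp add: hh(2) x_end)
    then have "\<bar>q' t - x\<bar> \<le> 0" by (rule tendsto_0_le_imp[OF D])
    then show ?thesis by simp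
  qed
  have p'R: "\<bar>p' s\<bar> \<le> R" if s: "s \<in> {0..t}" for s
  proof -
    have lim: "(\<lambda>n. D n + 2 * C * hh (r n)) \<longlonglongrightarrow> 0"
      using tendsto_add[OF D tendsto_mult_left[OF hr, of "2 * C"]] by simp
    have "\<bar>p' s\<bar> \<le> R + (D n + 2 * C * hh (r n))" for n
    proof -
      obtain i where i: "i \<le> NN (r n)" "real i * hh (r n) \<le> s" "s \<le> real i * hh (r n) + hh (r n)"
        using grid_point[of "hh (r n)" s "NN (r n)"] hh s by auto
      have "2 * C * \<bar>s - real i * hh (r n)\<bar> \<le> 2 * C * hh (r n)"
        using i C_pos by (intro mult_left_mono) auto
      then show ?thesis using lipp[OF s grid[OF i(1)]] dp[OF i(1)] pR[OF i(1)] by linarith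
    qed
    then show ?thesis by (rule tendsto_0_le_imp[OF lim])
  qed
  have p'B: "\<bar>p' s\<bar> \<le> B" if s: "s \<in> {0..t}" for s using p'R[OF s] R_less_B by simp
  have hs: "hs_sol H t q' p'"
    unfolding q'_def p'_def using p'B by (intro F_imp_hs_sol Z) (auto simp: p'_def)
  \<comment> \<open>Over one cell the limiting position and momentum move by at most
    \<open>2 * C * h\<close> each, and the sampled momentum lags by \<open>C * h\<close>, which
    makes 5; \<open>D n\<close> counts once for each component.\<close>
  define \<delta> where "\<delta> = (\<lambda>n. (2 + B) * C * (2 * D n + 5 * C * hh (r n)))"
  have cost: "\<bar>integral {0..t} (\<lambda>s. ell (q' s) (p' s)) - (\<Sum>i<NN (r n). hh (r n) * ell (\<xi> (r n) i) (p (r n) (Suc i)))\<bar>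
      \<le> t * \<delta> n" for n
  proof -
    let ?h = "hh (r n)" and ?N = "NN (r n)"
    have "\<bar>integral {0..real ?N * ?h} (\<lambda>s. ell (q' s) (p' s)) - (\<Sum>i<?N. ?h * ell (\<xi> (r n) i) (p (r n) (Suc i)))\<bar>
      \<le> real ?N * ?h * \<delta> n"
    proof (rule riemann_sum_estimate)
      show "(\<lambda>s. ell (q' s) (p' s)) integrable_on {0..real ?N * ?h}"
        unfolding hh(2) by (rule ell_integrable[OF hs p'B])
      fix i s assume i: "i < ?N" and s: "real i * ?h \<le> s" "s \<le> real (Suc i) * ?h"
      have s': "s \<in> {0..t}" using s grid[of i "r n"] grid[of "Suc i" "r n"] i by auto
      have "s - real i * ?h \<le> ?h" using s by (simp add: algebra_simps)
      then have le: "2 * C * \<bar>s - real i * ?h\<bar> \<le> 2 * C * ?h" 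
        using s C_pos by (intro mult_left_mono) auto
      have g: "real i * ?h \<in> {0..t}" using grid i by auto
      have "p (r n) (Suc i) - p (r n) i = - (?h * d1 H (\<xi> (r n) i) (p (r n) (Suc i)))"
        using ps[OF i] by linarith
      then have "\<bar>p (r n) (Suc i) - p (r n) i\<bar> = ?h * \<bar>d1 H (\<xi> (r n) i) (p (r n) (Suc i))\<bar>"
        using hh(1)[of "r n"] by (simp only: abs_minus abs_mult abs_of_pos)
      also have "\<dots> \<le> ?h * C" using hh(1)[of "r n"] i by (intro mult_left_mono Hx_bound pB) auto
      finally have pp: "\<bar>p (r n) (Suc i) - p (r n) i\<bar> \<le> ?h * C" .
      have "\<bar>q' s - \<xi> (r n) i\<bar> + \<bar>p' s - p (r n) (Suc i)\<bar> \<le> 2 * D n + 5 * C * ?h"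
      proof -
        have "2 * D n + 5 * C * ?h = D n + 2 * C * ?h + (D n + 2 * C * ?h) + ?h * C"
          by (simp add: algebra_simps)
        moreover have "\<bar>q' s - \<xi> (r n) i\<bar> \<le> D n + 2 * C * ?h"
          using lipq[OF s' g] le dq[OF less_imp_le[OF i]] by linarith
        moreover have "\<bar>p' s - p (r n) (Suc i)\<bar> \<le> D n + 2 * C * ?h + ?h * C"
          using lipp[OF s' g] le dp[OF less_imp_le[OF i]] pp by linarith
        ultimately show ?thesis by linarith
      qed
      then have "(2 + B) * C * (\<bar>q' s - \<xi> (r n) i\<bar> + \<bar>p' s - p (r n) (Suc i)\<bar>) \<le> \<delta> n"
        unfolding \<delta>_def using B_pos C_pos by (intro mult_left_mono) auto
      moreover have "\<bar>p (r n) (Suc i)\<bar> \<le> B" using i by (intro pB) auto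
      ultimately show "\<bar>ell (q' s) (p' s) - ell (\<xi> (r n) i) (p (r n) (Suc i))\<bar> \<le> \<delta> n"
        using ell_lip[OF p'B[OF s'], of "p (r n) (Suc i)" "q' s" "\<xi> (r n) i"] by linarith
    qed (use hh(1)[of "r n"] in simp)
    then show ?thesis unfolding hh(2) .
  qed
  have opt: "Uo (q' 0) + integral {0..t} (\<lambda>s. ell (q' s) (p' s)) \<le> Uo (\<gamma> 0) + integral {0..t} (\<lambda>s. LB (\<gamma> s) (g s))"
    if comp: "competitor t x \<gamma> g" for \<gamma> g
  proof -
    obtain M where M: "M \<ge> 0" "\<And>N h. h > 0 \<Longrightarrow> real N * h = t \<Longrightarrow>
        J N h (\<lambda>i. \<gamma> (real i * h)) \<le> Uo (\<gamma> 0) + integral {0..t} (\<lambda>s. LB (\<gamma> s) (g s)) + M * h"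
      by (rule competitor_discrete[OF t comp]) blast
    have "Uo (q' 0) + integral {0..t} (\<lambda>s. ell (q' s) (p' s))
        \<le> (Uo (\<gamma> 0) + integral {0..t} (\<lambda>s. LB (\<gamma> s) (g s))) + (K * D n + t * \<delta> n + M * hh (r n))" for n
    proof -
      let ?h = "hh (r n)" and ?N = "NN (r n)"
      have "J ?N ?h (\<xi> (r n)) \<le> J ?N ?h (\<lambda>i. \<gamma> (real i * ?h))"
        using comp by (intro min) (simp add: hh(2) competitor_def)
      also have "\<dots> \<le> Uo (\<gamma> 0) + integral {0..t} (\<lambda>s. LB (\<gamma> s) (g s)) + M * ?h"
        by (rule M(2)[OF hh])
      finally have 1: "J ?N ?h (\<xi> (r n)) \<le> Uo (\<gamma> 0) + integral {0..t} (\<lambda>s. LB (\<gamma> s) (g s)) + M * ?h" .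
      have "K * \<bar>q' 0 - \<xi> (r n) 0\<bar> \<le> K * D n" using dq[of 0 n] K_nonneg by (intro mult_left_mono) auto
      then have "Uo (q' 0) \<le> Uo (\<xi> (r n) 0) + K * D n" using Uo_lip[of "q' 0" "\<xi> (r n) 0"] by linarith
      then show ?thesis using 1 cost[of n] JJ[of "r n"] by linarith
    qed
    moreover have "(\<lambda>n. K * D n + t * \<delta> n + M * hh (r n)) \<longlonglongrightarrow> K * 0 + t * ((2 + B) * C * (2 * 0 + 5 * C * 0)) + M * 0"
      unfolding \<delta>_def by (intro tendsto_intros D hr)
    then have "(\<lambda>n. K * D n + t * \<delta> n + M * hh (r n)) \<longlonglongrightarrow> 0" by simp
    ultimately show ?thesis by (rule tendsto_0_le_imp[rotated])
  qed
  show ?thesis by (rule that[OF hs q't p'R opt])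
qed

end

section \<open>The value function\<close>

lemma has_real_derivative_mono_integral:
  fixes f \<Psi> :: "real \<Rightarrow> real"
  assumes "a \<le> b" "f integrable_on {a..b}"
    and "\<And>s. s \<in> {a..b} \<Longrightarrow> (\<Psi> has_real_derivative \<Psi>' s) (at s within {a..b})"
    and "\<And>s. s \<in> {a..b} \<Longrightarrow> f s \<le> \<Psi>' s"
  shows "integral {a..b} f \<le> \<Psi> b - \<Psi> a"
proof -
  have "(\<Psi>' has_integral (\<Psi> b - \<Psi> a)) {a..b}"
    using assms(1,3) by (intro fundamental_theorem_of_calculus)
      (auto simp flip: has_real_derivative_iff_has_vector_derivative)
  from has_integral_le[OF integrable_integral[OF assms(2)] this assms(4)] show ?thesis by simp
qed

lemma hs_sol_restrict: "hs_sol H t q p \<Longrightarrow> s \<le> t \<Longrightarrow> hs_sol H s q p"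
  unfolding hs_sol_def by (force intro: DERIV_subset[where s="{0..t}" and t="{0..s}"])

context ham_box
begin

lemma energy_conserved:
  assumes hs: "hs_sol H t q p" and s: "s \<in> {0..t}" "r \<in> {0..t}"
  shows "H (q s) (p s) = H (q r) (p r)"
proof -
  have "((\<lambda>s. H (q s) (p s)) has_real_derivative 0) (at s within {0..t})" if "s \<in> {0..t}" for s
    using Ck_1_chain[OF H_C1, of q "d2 H (q s) (p s)" s "{0..t}" p "- d1 H (q s) (p s)"] hs that
    by (simp add: hs_sol_def)
  from MVT_abs_le[of "{0..t}" r s, OF _ s(2,1) this, of 0] show ?thesis by simp
qed

lemma hs_sol_lipschitz:
  assumes hs: "hs_sol H t q p" and b: "\<And>s. s \<in> {0..t} \<Longrightarrow> \<bar>p s\<bar> \<le> B"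
    and s: "s \<in> {0..t}" "r \<in> {0..t}"
  shows "\<bar>q s - q r\<bar> \<le> C * \<bar>s - r\<bar>" "\<bar>p s - p r\<bar> \<le> C * \<bar>s - r\<bar>"
proof -
  show "\<bar>q s - q r\<bar> \<le> C * \<bar>s - r\<bar>"
    by (rule MVT_abs_le[of "{0..t}" _ _ q "\<lambda>s. d2 H (q s) (p s)"])
       (use hs s b Hp_bound in \<open>auto simp: hs_sol_def\<close>)
  show "\<bar>p s - p r\<bar> \<le> C * \<bar>s - r\<bar>"
    by (rule MVT_abs_le[of "{0..t}" _ _ p "\<lambda>s. - d1 H (q s) (p s)"])
       (use hs s b Hx_bound in \<open>auto simp: hs_sol_def\<close>)
qed

lemma velocity_lipschitz:
  assumes hs: "hs_sol H t q p" and b: "\<And>s. s \<in> {0..t} \<Longrightarrow> \<bar>p s\<bar> \<le> B"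
    and s: "s \<in> {0..t}" "r \<in> {0..t}"
  shows "\<bar>d2 H (q s) (p s) - d2 H (q r) (p r)\<bar> \<le> 2 * C * C * \<bar>s - r\<bar>"
proof -
  have "\<bar>d2 H (q s) (p s) - d2 H (q r) (p r)\<bar> \<le> C * (\<bar>q s - q r\<bar> + \<bar>p s - p r\<bar>)"
    by (rule Hp_lip[OF b[OF s(1)] b[OF s(2)]])
  also have "\<dots> \<le> C * (C * \<bar>s - r\<bar> + C * \<bar>s - r\<bar>)"
    using hs_sol_lipschitz[OF hs b s] C_pos by (intro mult_left_mono add_mono) auto
  finally show ?thesis by (simp add: algebra_simps)
qed

lemma act_abs_le:
  assumes hs: "hs_sol H t q p" and b: "\<And>s. s \<in> {0..t} \<Longrightarrow> \<bar>p s\<bar> \<le> B" and t: "t \<ge> 0"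
  shows "\<bar>act t q p\<bar> \<le> (1 + B) * C * t"
proof -
  have "norm (integral {0..t} (\<lambda>s. ell (q s) (p s))) \<le> integral {0..t} (\<lambda>s. (1 + B) * C)"
    using ell_bound b by (intro integral_norm_bound_integral ell_integrable[OF hs b]) auto
  then show ?thesis using t by (simp add: hs_action_def mult_ac)
qed

lemma act_has_derivative:
  assumes hs: "hs_sol H t q p" and b: "\<And>s. s \<in> {0..t} \<Longrightarrow> \<bar>p s\<bar> \<le> B" and s: "s \<in> {0..t}"
  shows "((\<lambda>s. act s q p) has_real_derivative ell (q s) (p s)) (at s within {0..t})"
  unfolding hs_action_def by (rule integral_has_real_derivative[OF ell_continuous[OF hs b] s])

text \<open>The competitor is the given orbit run at speed \<open>s / t\<close> and sheared linearly in time so that it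
  ends in \<open>x\<close>; the first-order terms integrate to the momentum and energy at time \<open>s\<close>.\<close>
lemma deformed_orbit_action:
  assumes hs: "hs_sol H s q p" and b: "\<And>r. r \<in> {0..s} \<Longrightarrow> \<bar>p r\<bar> \<le> B"
    and s0: "0 < s0" "s0 \<le> s" "s0 \<le> t"
  obtains \<gamma> g where
    "\<forall>r\<in>{0..t}. (\<gamma> has_real_derivative g r) (at r within {0..t})"
    "\<forall>r\<in>{0..t}. \<forall>r'\<in>{0..t}. \<bar>g r - g r'\<bar> \<le> s / t * (2 * C * C * (s / t)) * \<bar>r - r'\<bar>"
    "\<gamma> t = x" "\<gamma> 0 = q 0"
    "integral {0..t} (\<lambda>r. LB (\<gamma> r) (g r)) \<le> act s q p + p s * (x - q s) - H (q s) (p s) * (t - s)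
      + t * ((C + Cs + 2 * Cs * C\<^sup>2 + 2 * Cs / s0\<^sup>2) * (1 + 1 / s0\<^sup>2) * ((x - q s)\<^sup>2 + (t - s)\<^sup>2))"
proof -
  define d where "d = x - q s"
  define k where "k = s / t"
  define E where "E = H (q s) (p s)"
  have pos: "s > 0" "t > 0" "k > 0" using s0 by (auto simp: k_def)
  have kt: "k * t = s" using pos by (simp add: k_def)
  have img: "(\<lambda>r. k * r) ` {0..t} \<subseteq> {0..s}"
  proof (rule image_subsetI)
    fix r assume r: "r \<in> {0..t}"
    then have "k * r \<le> k * t" using pos by (intro mult_left_mono) auto
    then show "k * r \<in> {0..s}" using r pos by (simp add: kt)
  qed
  have mem: "k * r \<in> {0..s}" if "r \<in> {0..t}" for r using img that by blast
  have dk: "((\<lambda>r. k * r) has_real_derivative k) (at r within {0..t})" for r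
    by (auto intro!: derivative_eq_intros)
  have chain: "((\<lambda>r. f (k * r)) has_real_derivative f' * k) (at r within {0..t})"
    if "(f has_real_derivative f') (at (k * r) within {0..s})" for f f' r
    using DERIV_image_chain[OF DERIV_subset[OF that img] dk] by (simp add: comp_def)
  have dq: "(q has_real_derivative d2 H (q r) (p r)) (at r within {0..s})"
    and dp: "(p has_real_derivative - d1 H (q r) (p r)) (at r within {0..s})" if "r \<in> {0..s}" for r
    using hs that by (auto simp: hs_sol_def)
  define \<gamma> where "\<gamma> = (\<lambda>r. q (k * r) + r / t * d)"
  define g where "g = (\<lambda>r. d2 H (q (k * r)) (p (k * r)) * k + d / t)"
  \<comment> \<open>An antiderivative of the first-order expansion of the deformed cost: rescaling
    time contributes the conserved energy, and the shear contributes the total derivative of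
    \<open>u * p u\<close>, because \<open>p' = - d1 H\<close> along the orbit.\<close>
  define \<Psi> where "\<Psi> = (\<lambda>r. act (k * r) q p + E * (k - 1) * r + d / s * (k * r * p (k * r)))"
  define \<Psi>' where "\<Psi>' = (\<lambda>r. ell (q (k * r)) (p (k * r)) * k + E * (k - 1)
     + d / s * (k * p (k * r) + (- d1 H (q (k * r)) (p (k * r)) * k) * (k * r)))"
  define Q where "Q = C + Cs + 2 * Cs * C\<^sup>2 + 2 * Cs / s0\<^sup>2"
  define Err where "Err = Q * (1 + 1 / s0\<^sup>2) * (d\<^sup>2 + (t - s)\<^sup>2)"
  have Q: "Q \<ge> 0" using C_pos Cs_pos by (auto simp: Q_def intro!: add_nonneg_nonneg)
  have d\<gamma>: "(\<gamma> has_real_derivative g r) (at r within {0..t})" if "r \<in> {0..t}" for r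
    unfolding \<gamma>_def g_def
    by (rule DERIV_add[OF chain[OF dq[OF mem[OF that]]]]) (use pos in \<open>auto intro!: derivative_eq_intros\<close>)
  have glip: "\<bar>g r - g r'\<bar> \<le> s / t * (2 * C * C * (s / t)) * \<bar>r - r'\<bar>" if "r \<in> {0..t}" "r' \<in> {0..t}" for r r'
  proof -
    have "g r - g r' = k * (d2 H (q (k * r)) (p (k * r)) - d2 H (q (k * r')) (p (k * r')))"
      by (simp add: g_def algebra_simps)
    then have "\<bar>g r - g r'\<bar> = k * \<bar>d2 H (q (k * r)) (p (k * r)) - d2 H (q (k * r')) (p (k * r'))\<bar>"
      using pos by (simp add: abs_mult)
    also have "\<dots> \<le> k * (2 * C * C * \<bar>k * r - k * r'\<bar>)"
      using velocity_lipschitz[OF hs b mem[OF that(1)] mem[OF that(2)]] pos by (intro mult_left_mono) auto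
    also have "\<bar>k * r - k * r'\<bar> = k * \<bar>r - r'\<bar>"
      using pos by (simp add: abs_mult flip: right_diff_distrib)
    finally show ?thesis by (simp add: k_def mult.assoc)
  qed
  have d\<Psi>: "(\<Psi> has_real_derivative \<Psi>' r) (at r within {0..t})" if "r \<in> {0..t}" for r
  proof -
    have 1: "((\<lambda>r. act (k * r) q p) has_real_derivative ell (q (k * r)) (p (k * r)) * k) (at r within {0..t})"
      by (rule chain[OF act_has_derivative[OF hs b mem[OF that]]])
    have 2: "((\<lambda>r. E * (k - 1) * r) has_real_derivative E * (k - 1)) (at r within {0..t})"
      by (auto intro!: derivative_eq_intros)
    have 3: "((\<lambda>r. d / s * (k * r * p (k * r))) has_real_derivative
        d / s * (k * p (k * r) + (- d1 H (q (k * r)) (p (k * r)) * k) * (k * r))) (at r within {0..t})"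
      by (rule DERIV_cmult[OF DERIV_mult[OF dk chain[OF dp[OF mem[OF that]]]]])
    show ?thesis unfolding \<Psi>_def \<Psi>'_def by (intro DERIV_add 1 2 3)
  qed
  have le: "LB (\<gamma> r) (g r) \<le> \<Psi>' r + Err" if r: "r \<in> {0..t}" for r
  proof -
    define u where "u = k * r"
    define y where "y = q u"
    define P where "P = p u"
    define v where "v = d2 H y P"
    define a where "a = d1 H y P"
    have u: "u \<in> {0..s}" using mem[OF r] by (simp add: u_def)
    have P: "\<bar>P\<bar> \<le> B" using b[OF u] by (simp add: P_def)
    have Eu: "E = H y P" unfolding E_def y_def P_def by (rule energy_conserved[OF hs]) (use u pos in auto)
    have av: "\<bar>a\<bar> \<le> C" "\<bar>v\<bar> \<le> C" using Hx_bound[OF P] Hp_bound[OF P] by (auto simp: a_def v_def)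
    have rt: "r / t = u / s" using pos by (simp add: u_def k_def)
    have us: "0 \<le> u / s" "u / s \<le> 1" using u pos by auto
    have \<gamma>r: "\<gamma> r - y = u / s * d" unfolding \<gamma>_def y_def u_def[symmetric] rt by simp
    have gr: "g r - v = (k - 1) * v + d / t" by (simp add: g_def v_def y_def P_def u_def algebra_simps)
    define \<tau> where "\<tau> = \<bar>t - s\<bar> / s0"
    have k1: "\<bar>k - 1\<bar> \<le> \<tau>"
    proof -
      have "\<bar>k - 1\<bar> = \<bar>t - s\<bar> / t" using pos by (simp add: k_def field_simps abs_minus_commute)
      also have "\<dots> \<le> \<bar>t - s\<bar> / s0" using s0 by (intro divide_left_mono) auto
      finally show ?thesis by (simp add: \<tau>_def)
    qed
    have "LB (\<gamma> r) (g r) \<le> LB y v - d1 H y P * (\<gamma> r - y) + P * (g r - v) + Cs * ((\<gamma> r - y)\<^sup>2 + (g r - v)\<^sup>2)"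
      unfolding v_def by (rule LB_semiconcave[OF opt_velocity[OF P]])
    also have "LB y v = P * v - E" unfolding v_def Eu by (simp add: LB_velocity[OF P] hs_lagrangian_def)
    finally have 1: "LB (\<gamma> r) (g r) \<le> P * v - E - a * (u / s * d) + P * ((k - 1) * v + d / t)
        + Cs * ((u / s * d)\<^sup>2 + ((k - 1) * v + d / t)\<^sup>2)"
      unfolding \<gamma>r gr a_def .
    define X where "X = a * (u / s * d)"
    have "\<Psi>' r = (P * v - E) * k + E * (k - 1) + d / s * (k * P + (- a * k) * u)"
      unfolding \<Psi>'_def u_def[symmetric] y_def[symmetric] P_def[symmetric] a_def Eu by (simp add: hs_lagrangian_def v_def)
    also have "\<dots> = P * v - E + P * ((k - 1) * v) + d / t * P - k * X"
      using pos by (simp add: k_def X_def field_simps)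
    \<comment> \<open>The mismatch \<open>(k - 1) * X\<close> is of second order:
      \<open>k - 1\<close> is controlled by the time shift and \<open>X\<close> by the displacement
      \<open>d\<close>.\<close>
    finally have "P * v - E - X + P * ((k - 1) * v + d / t) = \<Psi>' r + (k - 1) * X"
      by (simp add: algebra_simps)
    then have 2: "P * v - E - a * (u / s * d) + P * ((k - 1) * v + d / t) = \<Psi>' r + (k - 1) * (a * (u / s * d))"
      unfolding X_def .
    have ud: "\<bar>u / s * d\<bar> \<le> \<bar>d\<bar>" using us mult_right_mono[of "u / s" 1 "\<bar>d\<bar>"] by (simp only: abs_mult abs_of_nonneg mult_1)
    have "\<bar>(k - 1) * (a * (u / s * d))\<bar> \<le> \<tau> * (C * \<bar>d\<bar>)"
      unfolding abs_mult[of "k - 1"] abs_mult[of a] using k1 av ud C_pos by (intro mult_mono) auto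
    also have "\<dots> \<le> C * (\<tau>\<^sup>2 + d\<^sup>2)"
    proof -
      have "0 \<le> (\<tau> - \<bar>d\<bar>)\<^sup>2 + \<tau>\<^sup>2 + d\<^sup>2" by simp
      then have "\<tau> * \<bar>d\<bar> \<le> \<tau>\<^sup>2 + d\<^sup>2" by (simp add: power2_diff)
      then show ?thesis using C_pos mult_left_mono[of "\<tau> * \<bar>d\<bar>" "\<tau>\<^sup>2 + d\<^sup>2" C] by (simp add: mult_ac)
    qed
    finally have 3: "(k - 1) * (a * (u / s * d)) \<le> C * (\<tau>\<^sup>2 + d\<^sup>2)" by linarith
    have sq1: "(u / s * d)\<^sup>2 \<le> d\<^sup>2" using ud by (simp only: abs_le_square_iff)
    have "\<bar>(k - 1) * v\<bar> \<le> \<tau> * C" unfolding abs_mult using k1 av by (intro mult_mono) auto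
    then have "((k - 1) * v)\<^sup>2 \<le> (\<tau> * C)\<^sup>2" by (intro power2_mono) (simp add: abs_le_iff)
    moreover have "(d / t)\<^sup>2 \<le> d\<^sup>2 / s0\<^sup>2"
      unfolding power_divide using s0 by (intro divide_left_mono power_mono) auto
    moreover have "((k - 1) * v + d / t)\<^sup>2 \<le> 2 * ((k - 1) * v)\<^sup>2 + 2 * (d / t)\<^sup>2"
    proof -
      have "0 \<le> ((k - 1) * v - d / t)\<^sup>2" by simp
      then show ?thesis unfolding power2_sum power2_diff by linarith
    qed
    ultimately have "(u / s * d)\<^sup>2 + ((k - 1) * v + d / t)\<^sup>2 \<le> d\<^sup>2 + (2 * (\<tau> * C)\<^sup>2 + 2 * (d\<^sup>2 / s0\<^sup>2))"
      using sq1 by linarith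
    then have 4: "Cs * ((u / s * d)\<^sup>2 + ((k - 1) * v + d / t)\<^sup>2) \<le> Cs * (d\<^sup>2 + (2 * (\<tau> * C)\<^sup>2 + 2 * (d\<^sup>2 / s0\<^sup>2)))"
      using Cs_pos by (intro mult_left_mono) auto
    have "C * (\<tau>\<^sup>2 + d\<^sup>2) + Cs * (d\<^sup>2 + (2 * (\<tau> * C)\<^sup>2 + 2 * (d\<^sup>2 / s0\<^sup>2))) \<le> Q * (\<tau>\<^sup>2 + d\<^sup>2)"
    proof -
      have "Q * (\<tau>\<^sup>2 + d\<^sup>2) - (C * (\<tau>\<^sup>2 + d\<^sup>2) + Cs * (d\<^sup>2 + (2 * (\<tau> * C)\<^sup>2 + 2 * (d\<^sup>2 / s0\<^sup>2))))
        = Cs * \<tau>\<^sup>2 + 2 * Cs * C\<^sup>2 * d\<^sup>2 + 2 * Cs / s0\<^sup>2 * \<tau>\<^sup>2"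
        by (simp add: Q_def power_mult_distrib algebra_simps add_divide_distrib)
      moreover have "\<dots> \<ge> 0" using Cs_pos by (intro add_nonneg_nonneg mult_nonneg_nonneg) auto
      ultimately show ?thesis by linarith
    qed
    also have "\<tau>\<^sup>2 + d\<^sup>2 \<le> (1 + 1 / s0\<^sup>2) * (d\<^sup>2 + (t - s)\<^sup>2)"
    proof -
      have "\<tau>\<^sup>2 = 1 / s0\<^sup>2 * (t - s)\<^sup>2" by (simp add: \<tau>_def power_divide)
      moreover have "0 \<le> 1 / s0\<^sup>2 * d\<^sup>2" "0 \<le> (t - s)\<^sup>2" by auto
      ultimately show ?thesis unfolding distrib_right distrib_left by linarith
    qed
    then have "Q * (\<tau>\<^sup>2 + d\<^sup>2) \<le> Err"
      unfolding Err_def mult.assoc using Q by (rule mult_left_mono)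
    finally show ?thesis using 1 2 3 4 by linarith
  qed
  have cg: "continuous_on {0..t} g"
  proof (rule lipschitz_on_continuous_on)
    show "(s / t * (2 * C * C * (s / t)))-lipschitz_on {0..t} g"
      using glip pos C_pos by (intro lipschitz_onI) (auto simp: dist_real_def)
  qed
  have c\<gamma>: "continuous_on {0..t} \<gamma>" using d\<gamma> by (rule DERIV_continuous_on)
  have "integral {0..t} (\<lambda>r. LB (\<gamma> r) (g r)) \<le> (\<lambda>r. \<Psi> r + Err * r) t - (\<lambda>r. \<Psi> r + Err * r) 0"
  proof (rule has_real_derivative_mono_integral)
    show "(\<lambda>r. LB (\<gamma> r) (g r)) integrable_on {0..t}"
      by (intro integrable_continuous_real LB_continuous c\<gamma> cg)
    show "((\<lambda>r. \<Psi> r + Err * r) has_real_derivative \<Psi>' r + Err) (at r within {0..t})" if "r \<in> {0..t}" for r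
      by (rule DERIV_add[OF d\<Psi>[OF that]]) (auto intro!: derivative_eq_intros)
  qed (use le pos in auto)
  also have "\<dots> = act s q p + E * (s - t) + d * p s + t * Err"
  proof -
    have "(k - 1) * t = s - t" using kt by (simp add: left_diff_distrib)
    then have "E * (k - 1) * t = E * (s - t)" by (simp add: mult.assoc)
    moreover have "d / s * (s * p s) = d * p s" using pos by simp
    ultimately show ?thesis by (simp add: \<Psi>_def kt hs_action_def mult.commute)
  qed
  finally have int: "integral {0..t} (\<lambda>r. LB (\<gamma> r) (g r)) \<le> act s q p + p s * d - E * (t - s) + t * Err"
    by (simp add: algebra_simps)
  show ?thesis
  proof (rule that)
    show "\<forall>r\<in>{0..t}. (\<gamma> has_real_derivative g r) (at r within {0..t})" using d\<gamma> by blast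
    show "\<forall>r\<in>{0..t}. \<forall>r'\<in>{0..t}. \<bar>g r - g r'\<bar> \<le> s / t * (2 * C * C * (s / t)) * \<bar>r - r'\<bar>"
      using glip by blast
    show "\<gamma> t = x" using pos by (simp add: \<gamma>_def kt d_def)
    show "\<gamma> 0 = q 0" by (simp add: \<gamma>_def)
  qed (use int in \<open>simp_all add: d_def E_def Err_def Q_def\<close>)
qed

end

section \<open>Definition and regularity of the value function\<close>

context ham_disc
begin

definition "calibrated t x q p \<longleftrightarrow> hs_sol H t q p \<and> q t = x \<and> (\<forall>s\<in>{0..t}. \<bar>p s\<bar> \<le> R) \<and>
  (\<forall>\<gamma> g. competitor t x \<gamma> g \<longrightarrow> Uo (q 0) + act t q p \<le> Uo (\<gamma> 0) + integral {0..t} (\<lambda>s. LB (\<gamma> s) (g s)))"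

text \<open>Defined through a chosen minimising orbit rather than as an infimum, so that attainment
  is built in.\<close>

definition "V t x = (if t \<le> 0 then Uo x
   else let z = (SOME z. calibrated t x (fst z) (snd z)) in Uo (fst z 0) + act t (fst z) (snd z))"

lemma V_0: "V 0 x = Uo x" by (simp add: V_def)

lemma V_calibrated:
  assumes "t > 0"
  obtains q p where "calibrated t x q p" "V t x = Uo (q 0) + act t q p"
proof -
  obtain q p where "hs_sol H t q p" "q t = x" "\<And>s. s \<in> {0..t} \<Longrightarrow> \<bar>p s\<bar> \<le> R"
    "\<And>\<gamma> g. competitor t x \<gamma> g \<Longrightarrow>
       Uo (q 0) + integral {0..t} (\<lambda>s. ell (q s) (p s)) \<le> Uo (\<gamma> 0) + integral {0..t} (\<lambda>s. LB (\<gamma> s) (g s))"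
    by (rule minimiser_exists[OF assms, of x]) blast
  then have "calibrated t x q p" by (simp add: calibrated_def hs_action_def)
  then have "\<exists>z. calibrated t x (fst z) (snd z)" by (intro exI[of _ "(q, p)"]) simp
  from someI_ex[OF this] assms that[of "fst (SOME z. calibrated t x (fst z) (snd z))" "snd (SOME z. calibrated t x (fst z) (snd z))"]
  show ?thesis by (simp add: V_def Let_def)
qed

lemma V_le_competitor:
  assumes "t > 0" "competitor t x \<gamma> g"
  shows "V t x \<le> Uo (\<gamma> 0) + integral {0..t} (\<lambda>s. LB (\<gamma> s) (g s))"
  using V_calibrated[OF assms(1), of x] assms(2) unfolding calibrated_def by metis

lemma V_le_hs_sol:
  assumes hs: "hs_sol H t q p" and b: "\<And>s. s \<in> {0..t} \<Longrightarrow> \<bar>p s\<bar> \<le> B" and t: "t \<ge> 0"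
  shows "V t (q t) \<le> Uo (q 0) + act t q p"
proof (cases "t = 0")
  case True
  then show ?thesis by (simp add: V_def hs_action_def)
next
  case False
  have "competitor t (q t) q (\<lambda>s. d2 H (q s) (p s))"
    unfolding competitor_def using hs
    by (intro conjI exI[of _ "2 * C * C"] ballI velocity_lipschitz[OF hs b]) (auto simp: hs_sol_def)
  then have "V t (q t) \<le> Uo (q 0) + integral {0..t} (\<lambda>s. LB (q s) (d2 H (q s) (p s)))"
    using False t by (intro V_le_competitor) auto
  also have "integral {0..t} (\<lambda>s. LB (q s) (d2 H (q s) (p s))) = act t q p"
    unfolding hs_action_def by (intro integral_cong) (use LB_velocity b in auto)
  finally show ?thesis .
qed

definition "Csc T s0 = T * ((C + Cs + 2 * Cs * C\<^sup>2 + 2 * Cs / s0\<^sup>2) * (1 + 1 / s0\<^sup>2))"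

text \<open>The deformed orbit is a competitor for the new endpoint. The linear part has slope
  \<open>p s\<close> in space and \<open>- H (q s) (p s)\<close> in time, the gradient that the
  equation predicts. Rescaling time degenerates near 0, hence the lower bound \<open>s0\<close> on
  both times.\<close>

lemma V_semiconcave:
  assumes hs: "hs_sol H s q p" and b: "\<And>r. r \<in> {0..s} \<Longrightarrow> \<bar>p r\<bar> \<le> B"
    and V: "V s (q s) = Uo (q 0) + act s q p"
    and s0: "0 < s0" "s0 \<le> s" "s0 \<le> t" "t \<le> T"
  shows "V t x \<le> V s (q s) + p s * (x - q s) - H (q s) (p s) * (t - s) + Csc T s0 * ((x - q s)\<^sup>2 + (t - s)\<^sup>2)"
proof -
  obtain \<gamma> g where
    dg: "\<forall>r\<in>{0..t}. (\<gamma> has_real_derivative g r) (at r within {0..t})"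
    and lip: "\<forall>r\<in>{0..t}. \<forall>r'\<in>{0..t}. \<bar>g r - g r'\<bar> \<le> s / t * (2 * C * C * (s / t)) * \<bar>r - r'\<bar>"
    and e: "\<gamma> t = x" "\<gamma> 0 = q 0"
    and int: "integral {0..t} (\<lambda>r. LB (\<gamma> r) (g r)) \<le> act s q p + p s * (x - q s) - H (q s) (p s) * (t - s)
      + t * ((C + Cs + 2 * Cs * C\<^sup>2 + 2 * Cs / s0\<^sup>2) * (1 + 1 / s0\<^sup>2) * ((x - q s)\<^sup>2 + (t - s)\<^sup>2))"
    by (rule deformed_orbit_action[OF hs b s0(1-3), of x])
  have "competitor t x \<gamma> g" unfolding competitor_def using dg lip e(1) by blast
  then have "V t x \<le> Uo (q 0) + integral {0..t} (\<lambda>r. LB (\<gamma> r) (g r))"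
    using V_le_competitor[of t x \<gamma> g] s0 e by simp
  moreover have "t * ((C + Cs + 2 * Cs * C\<^sup>2 + 2 * Cs / s0\<^sup>2) * (1 + 1 / s0\<^sup>2) * ((x - q s)\<^sup>2 + (t - s)\<^sup>2))
      \<le> Csc T s0 * ((x - q s)\<^sup>2 + (t - s)\<^sup>2)"
    unfolding Csc_def mult.assoc using s0 C_pos Cs_pos
    by (intro mult_right_mono mult_nonneg_nonneg add_nonneg_nonneg) auto
  ultimately show ?thesis using int V by linarith
qed

text \<open>Semiconcavity controls increments up to a quadratic error with a constant that explodes
  as \<open>s0\<close> tends to 0. Cutting the segment between the two points into \<open>N\<close>
  pieces leaves a total error \<open>K2 / N\<close>, so the constants in the limit depend only on
  the slopes.\<close>

lemma V_lipschitz_pos: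
  assumes s: "0 < s" "s \<le> T" and t: "0 < t" "t \<le> T"
  shows "V t x - V s y \<le> R * \<bar>x - y\<bar> + C * \<bar>t - s\<bar>"
proof -
  define s0 where "s0 = min s t"
  define K2 where "K2 = Csc T s0 * ((x - y)\<^sup>2 + (t - s)\<^sup>2)"
  have s0: "s0 > 0" using s t by (simp add: s0_def)
  have key: "V t x - V s y \<le> (R * \<bar>x - y\<bar> + C * \<bar>t - s\<bar>) + K2 / real (Suc n)" for n
  proof -
    define N where "N = Suc n"
    define \<sigma> where "\<sigma> = (\<lambda>i::nat. s + real i * ((t - s) / real N))"
    define \<eta> where "\<eta> = (\<lambda>i::nat. y + real i * ((x - y) / real N))"
    have N: "real N > 0" by (simp add: N_def)
    have \<sigma>: "s0 \<le> \<sigma> i" "\<sigma> i \<le> T" if "i \<le> N" for i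
    proof -
      have w: "0 \<le> real i / real N" "real i / real N \<le> 1" using that N by auto
      have eq: "\<sigma> i = (1 - real i / real N) * s + real i / real N * t"
        using N by (simp add: \<sigma>_def field_simps)
      have "(1 - real i / real N) * s0 + real i / real N * s0 \<le> \<sigma> i"
        unfolding eq using w by (intro add_mono mult_left_mono) (auto simp: s0_def)
      then show "s0 \<le> \<sigma> i" by (simp add: algebra_simps)
      have "\<sigma> i \<le> (1 - real i / real N) * T + real i / real N * T"
        unfolding eq using w s t by (intro add_mono mult_left_mono) auto
      then show "\<sigma> i \<le> T" by (simp add: algebra_simps)
    qed
    have step: "V (\<sigma> (Suc i)) (\<eta> (Suc i)) - V (\<sigma> i) (\<eta> i) \<le> (R * \<bar>x - y\<bar> + C * \<bar>t - s\<bar>) / real N + K2 / (real N)\<^sup>2"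
      if i: "i < N" for i
    proof -
      have pos: "\<sigma> i > 0" using \<sigma>(1)[of i] s0 i by simp
      obtain q p where cal: "calibrated (\<sigma> i) (\<eta> i) q p" and Vi: "V (\<sigma> i) (\<eta> i) = Uo (q 0) + act (\<sigma> i) q p"
        by (rule V_calibrated[OF pos, of "\<eta> i"]) blast
      have hs: "hs_sol H (\<sigma> i) q p" and qe: "q (\<sigma> i) = \<eta> i" and pR: "\<And>s. s \<in> {0..\<sigma> i} \<Longrightarrow> \<bar>p s\<bar> \<le> R"
        using cal by (auto simp: calibrated_def)
      have pB: "\<bar>p s\<bar> \<le> B" if "s \<in> {0..\<sigma> i}" for s using pR[OF that] R_less_B by simp
      have pe: "\<bar>p (\<sigma> i)\<bar> \<le> R" using pR pos by auto
      have dx: "\<eta> (Suc i) - \<eta> i = (x - y) / real N" and dt: "\<sigma> (Suc i) - \<sigma> i = (t - s) / real N"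
        unfolding \<eta>_def \<sigma>_def of_nat_Suc distrib_right by simp_all
      have "V (\<sigma> (Suc i)) (\<eta> (Suc i)) \<le> V (\<sigma> i) (\<eta> i) + p (\<sigma> i) * ((x - y) / real N)
          - H (\<eta> i) (p (\<sigma> i)) * ((t - s) / real N) + Csc T s0 * (((x - y) / real N)\<^sup>2 + ((t - s) / real N)\<^sup>2)"
        using V_semiconcave[OF hs pB, of s0 "\<sigma> (Suc i)" T "\<eta> (Suc i)"] s0 \<sigma>[of i] \<sigma>[of "Suc i"] i Vi
        by (simp add: qe dx dt)
      moreover have "p (\<sigma> i) * ((x - y) / real N) \<le> R * (\<bar>x - y\<bar> / real N)"
      proof -
        have "p (\<sigma> i) * ((x - y) / real N) \<le> \<bar>p (\<sigma> i) * ((x - y) / real N)\<bar>" by (rule abs_ge_self)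
        also have "\<dots> \<le> R * (\<bar>x - y\<bar> / real N)" 
          unfolding abs_mult abs_divide using pe by (intro mult_mono) auto
        finally show ?thesis .
      qed
      moreover have "- (H (\<eta> i) (p (\<sigma> i)) * ((t - s) / real N)) \<le> C * (\<bar>t - s\<bar> / real N)"
      proof -
        have "- (H (\<eta> i) (p (\<sigma> i)) * ((t - s) / real N)) \<le> \<bar>H (\<eta> i) (p (\<sigma> i)) * ((t - s) / real N)\<bar>" by (rule abs_ge_minus_self)
        also have "\<dots> \<le> C * (\<bar>t - s\<bar> / real N)" 
          unfolding abs_mult abs_divide using H_bound[of "p (\<sigma> i)"] pe R_less_B C_pos by (intro mult_mono) auto
        finally show ?thesis .
      qed
      moreover have "Csc T s0 * (((x - y) / real N)\<^sup>2 + ((t - s) / real N)\<^sup>2) = K2 / (real N)\<^sup>2"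
        unfolding K2_def power_divide times_divide_eq_right[symmetric] add_divide_distrib ..
      ultimately show ?thesis by (simp add: add_divide_distrib)
    qed
    have "V (\<sigma> N) (\<eta> N) - V (\<sigma> 0) (\<eta> 0) = (\<Sum>i<N. V (\<sigma> (Suc i)) (\<eta> (Suc i)) - V (\<sigma> i) (\<eta> i))"
      using sum_lessThan_telescope[of "\<lambda>i. V (\<sigma> i) (\<eta> i)" N] by simp
    also have "\<dots> \<le> (\<Sum>i<N. (R * \<bar>x - y\<bar> + C * \<bar>t - s\<bar>) / real N + K2 / (real N)\<^sup>2)"
      using step by (intro sum_mono) auto
    also have "\<dots> = (R * \<bar>x - y\<bar> + C * \<bar>t - s\<bar>) + K2 / real N"
      using N by (simp add: power2_eq_square field_simps)
    finally show ?thesis using N by (simp add: \<sigma>_def \<eta>_def flip: N_def)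
  qed
  have "(\<lambda>n. K2 / real (Suc n)) \<longlonglongrightarrow> 0"
    using LIMSEQ_ignore_initial_segment[OF lim_const_over_n[of K2], of 1] by simp
  then show ?thesis using key by (rule tendsto_0_le_imp)
qed

text \<open>The complement to the interior estimate at time 0: a minimiser travels at most
  \<open>C * t\<close> and its action is of order \<open>t\<close>.\<close>

lemma V_initial:
  assumes "t \<ge> 0"
  shows "\<bar>V t x - Uo x\<bar> \<le> (K * C + (1 + B) * C) * t"
proof (cases "t = 0")
  case False
  then have t: "t > 0" using assms by simp
  obtain q p where cal: "calibrated t x q p" and V: "V t x = Uo (q 0) + act t q p"
    by (rule V_calibrated[OF t, of x]) blast
  have hs: "hs_sol H t q p" and qe: "q t = x" and pR: "\<And>s. s \<in> {0..t} \<Longrightarrow> \<bar>p s\<bar> \<le> R"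
    using cal by (auto simp: calibrated_def)
  have pB: "\<bar>p s\<bar> \<le> B" if "s \<in> {0..t}" for s using pR[OF that] R_less_B by simp
  have "\<bar>q 0 - q t\<bar> \<le> C * \<bar>0 - t\<bar>" by (rule hs_sol_lipschitz[OF hs pB]) (use t in auto)
  then have "K * \<bar>q 0 - x\<bar> \<le> K * (C * t)" using K_nonneg t by (intro mult_left_mono) (auto simp: qe)
  then have "\<bar>Uo (q 0) - Uo x\<bar> \<le> K * (C * t)" using Uo_lip[of "q 0" x] by linarith
  then show ?thesis using act_abs_le[OF hs pB] t V by (simp add: algebra_simps)
qed (simp add: V_0)

lemma V_lipschitz: 
  assumes "T > 0"
  shows "\<exists>M. M-lipschitz_on ({0..T} \<times> UNIV) (\<lambda>z. V (fst z) (snd z))"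
proof -
  define M where "M = R + C + (K * C + (1 + B) * C)"
  have M: "M \<ge> 0" "R \<le> M" "C \<le> M" "K * C + (1 + B) * C \<le> M"
    using R_nonneg C_pos B_pos K_nonneg by (auto simp: M_def)
  have *: "V t x - V s y \<le> M * (\<bar>x - y\<bar> + \<bar>t - s\<bar>)" if "t \<in> {0..T}" "s \<in> {0..T}" for t s x y
  proof -
    have mm: "a * \<bar>x - y\<bar> + b * \<bar>t - s\<bar> \<le> M * (\<bar>x - y\<bar> + \<bar>t - s\<bar>)" if "a \<le> M" "b \<le> M" for a b
      unfolding distrib_left using that by (intro add_mono mult_right_mono) auto
    have "K \<le> M" using K_le_R M by simp
    consider "t > 0" "s > 0" | "t = 0" "s = 0" | "t > 0" "s = 0" | "t = 0" "s > 0"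
      using \<open>t \<in> _\<close> \<open>s \<in> _\<close> by force
    then show ?thesis
    proof cases
      case 1
      then show ?thesis using V_lipschitz_pos[of s T t x y] that mm[of R C] M by auto
    next
      case 2
      then show ?thesis using Uo_lip[of x y] mm[of K 0] \<open>K \<le> M\<close> M by (auto simp: V_0)
    next
      case 3
      then show ?thesis
        using V_initial[of t x] Uo_lip[of x y] mm[of K "K * C + (1 + B) * C"] \<open>K \<le> M\<close> M by (auto simp: V_0)
    next
      case 4
      then show ?thesis
        using V_initial[of s y] Uo_lip[of x y] mm[of K "K * C + (1 + B) * C"] \<open>K \<le> M\<close> M by (auto simp: V_0)
    qed
  qed
  have "(2 * M)-lipschitz_on ({0..T} \<times> UNIV) (\<lambda>z. V (fst z) (snd z))"
  proof (rule lipschitz_onI)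
    fix z w :: "real \<times> real" assume "z \<in> {0..T} \<times> UNIV" "w \<in> {0..T} \<times> UNIV"
    then have "\<bar>V (fst z) (snd z) - V (fst w) (snd w)\<bar> \<le> M * (\<bar>snd z - snd w\<bar> + \<bar>fst z - fst w\<bar>)"
      using *[of "fst z" "fst w" "snd z" "snd w"] *[of "fst w" "fst z" "snd w" "snd z"]
      by (auto simp: abs_minus_commute abs_le_iff)
    also have "\<dots> \<le> M * (2 * dist z w)"
      using dist_fst_le[of z w] dist_snd_le[of z w] M by (intro mult_left_mono) (auto simp: dist_real_def)
    finally show "dist (V (fst z) (snd z)) (V (fst w) (snd w)) \<le> 2 * M * dist z w"
      by (simp add: dist_real_def)
  qed (use M in auto)
  then show ?thesis by blast
qed

end

section \<open>The value function is a viscosity solution\<close>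

lemma dist_pair_le: "dist (s :: real, y :: real) (t, x) \<le> \<bar>s - t\<bar> + \<bar>y - x\<bar>"
proof -
  have "dist (s, y) (t, x) \<le> dist (s, y) (t, y) + dist (t, y) (t, x)" by (rule dist_triangle)
  then show ?thesis by (simp add: dist_Pair_Pair dist_real_def)
qed

lemma small_step:
  fixes d t e k :: real
  assumes "d > 0" "t > 0" "e > 0" "k > 0"
  obtains h where "h > 0" "h < d" "h \<le> t / 2" "h * k \<le> e / 2"
proof
  let ?h = "min (min (d / 2) (t / 2)) (e / (2 * k))"
  show "?h > 0" using assms by simp
  have "?h \<le> d / 2" "?h \<le> t / 2" "?h \<le> e / (2 * k)" by linarith+
  then show "?h < d" "?h \<le> t / 2" "?h * k \<le> e / 2"
    using assms mult_right_mono[of ?h "e / (2 * k)" k] by auto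
qed

context ham_disc
begin

text \<open>The point \<open>(t, x)\<close> is approached from earlier times with the velocity
  \<open>v\<close> dual to the test slope \<open>P\<close>. The final momentum of the minimiser at
  the earlier point is unknown, but for this velocity \<open>P\<close> maximises
  \<open>p * v - H x p\<close>, so any other momentum gives a smaller upper bound.\<close>

theorem V_visc_sub: "visc_sub H T V"
  unfolding visc_sub_def
proof (intro allI impI, elim conjE)
  fix \<phi> t x assume \<phi>: "Ck 1 \<phi>" and t: "t \<in> {0<..<T}" and "loc_max_on (\<lambda>s y. V s y - \<phi> s y) T t x"
  then obtain e where e: "e > 0"
    "\<And>s y. s \<in> {0<..<T} \<Longrightarrow> dist (s, y) (t, x) < e \<Longrightarrow> V s y - \<phi> s y \<le> V t x - \<phi> t x"
    unfolding loc_max_on_def by blast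
  define P where "P = d2 \<phi> t x"
  define v where "v = d2 H x P"
  \<comment> \<open>Collects the quadratic errors: moving \<open>H\<close> from \<open>y\<close>
    back to \<open>x\<close>, and the semiconcavity remainder.\<close>
  define c where "c = C * \<bar>v\<bar> + Csc T (t / 2) * (v\<^sup>2 + 1)"
  \<comment> \<open>The two occurrences of \<open>P * v\<close> cancel in the derivative at 0, which
    is minus the left-hand side of the equation; the maximum property will give
    \<open>w 0 \<le> w \<delta>\<close>.\<close>
  define w where "w = (\<lambda>\<delta>. \<phi> (t - \<delta>) (x - \<delta> * v) + \<delta> * (P * v - H x P) + c * \<delta>\<^sup>2)"
  show "d1 \<phi> t x + H x (d2 \<phi> t x) \<le> 0"
  proof (rule ccontr)
    assume "\<not> ?thesis"
    then have pos: "d1 \<phi> t x + H x P > 0" by (simp add: P_def)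
    have "((\<lambda>\<delta>. \<phi> (t - \<delta>) (x - \<delta> * v)) has_real_derivative d1 \<phi> (t - 0) (x - 0 * v) * (- 1) + d2 \<phi> (t - 0) (x - 0 * v) * (- v)) (at 0)"
      by (rule Ck_1_chain[OF \<phi>]) (auto intro!: derivative_eq_intros)
    then have "(w has_real_derivative - (d1 \<phi> t x + H x P)) (at 0)"
      unfolding w_def by (auto intro!: derivative_eq_intros simp: P_def algebra_simps)
    from has_real_derivative_neg_dec_right[OF this] pos
    obtain d where d: "d > 0" "\<And>\<delta>. \<delta> > 0 \<Longrightarrow> \<delta> < d \<Longrightarrow> w \<delta> < w 0" by auto
    have v1: "1 + \<bar>v\<bar> > 0" and t0: "t > 0" using t by auto
    obtain \<delta> where \<delta>: "\<delta> > 0" "\<delta> < d" "\<delta> \<le> t / 2" "\<delta> * (1 + \<bar>v\<bar>) \<le> e / 2"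
      by (rule small_step[OF d(1) t0 e(1) v1])
    define s where "s = t - \<delta>"
    define y where "y = x - \<delta> * v"
    have s: "s \<in> {0<..<T}" "t / 2 \<le> s" using \<delta> t by (auto simp: s_def)
    have "dist (s, y) (t, x) \<le> \<delta> * (1 + \<bar>v\<bar>)"
      using dist_pair_le[of s y t x] \<delta>(1) by (simp add: s_def y_def abs_mult algebra_simps)
    also have "\<dots> \<le> e / 2" by (rule \<delta>(4))
    finally have "dist (s, y) (t, x) < e" using e(1) by simp
    from e(2)[OF s(1) this] have 1: "V s y - \<phi> s y \<le> V t x - \<phi> t x" .
    have s0: "s > 0" using s by simp
    obtain q p where cal: "calibrated s y q p" and Vs: "V s y = Uo (q 0) + act s q p"
      by (rule V_calibrated[OF s0, of y]) blast
    have hs: "hs_sol H s q p" and qe: "q s = y" and pR: "\<And>r. r \<in> {0..s} \<Longrightarrow> \<bar>p r\<bar> \<le> R"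
      using cal by (auto simp: calibrated_def)
    have pB: "\<bar>p r\<bar> \<le> B" if "r \<in> {0..s}" for r using pR[OF that] R_less_B by simp
    have ps: "\<bar>p s\<bar> \<le> B" using pB s0 by simp
    have "V t x \<le> V s (q s) + p s * (x - q s) - H (q s) (p s) * (t - s) + Csc T (t / 2) * ((x - q s)\<^sup>2 + (t - s)\<^sup>2)"
      using s t \<delta> Vs qe by (intro V_semiconcave[OF hs pB]) (auto simp: s_def)
    then have 2: "V t x \<le> V s y + p s * (\<delta> * v) - H y (p s) * \<delta> + Csc T (t / 2) * ((\<delta> * v)\<^sup>2 + \<delta>\<^sup>2)"
      unfolding qe by (simp add: y_def s_def)
    have "H x (p s) - H y (p s) \<le> C * (\<delta> * \<bar>v\<bar>)"
      using H_lip[OF ps ps, of x y] \<delta>(1) by (simp add: y_def abs_mult abs_le_iff)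
    moreover have "H x (p s) \<ge> H x P + v * (p s - P)" unfolding v_def by (rule H_convex)
    ultimately have "p s * v - H y (p s) \<le> P * v - H x P + C * (\<delta> * \<bar>v\<bar>)"
      by (simp add: algebra_simps)
    then have "\<delta> * (p s * v - H y (p s)) \<le> \<delta> * (P * v - H x P + C * (\<delta> * \<bar>v\<bar>))"
      using \<delta>(1) by (intro mult_left_mono) auto
    moreover have "p s * (\<delta> * v) - H y (p s) * \<delta> = \<delta> * (p s * v - H y (p s))" by (simp add: algebra_simps)
    moreover have "\<delta> * (P * v - H x P + C * (\<delta> * \<bar>v\<bar>)) + Csc T (t / 2) * ((\<delta> * v)\<^sup>2 + \<delta>\<^sup>2)
        = \<delta> * (P * v - H x P) + c * \<delta>\<^sup>2"
      by (simp add: c_def power2_eq_square algebra_simps)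
    ultimately have "\<phi> t x \<le> \<phi> s y + (\<delta> * (P * v - H x P) + c * \<delta>\<^sup>2)" using 1 2 by linarith
    then have "w 0 \<le> w \<delta>" by (simp add: w_def s_def y_def)
    then show False using d(2)[OF \<delta>(1,2)] by simp
  qed
qed

text \<open>The test function is followed backwards along a minimiser. At an earlier time the
  restricted orbit bounds the value from above, with equality at \<open>t\<close>; hence
  \<open>w\<close> cannot be larger earlier. Convexity compares its derivative with the left-hand
  side of the equation at the test slope.\<close>

theorem V_visc_super: "visc_super H T V"
  unfolding visc_super_def
proof (intro allI impI, elim conjE)
  fix \<phi> t x assume \<phi>: "Ck 1 \<phi>" and t: "t \<in> {0<..<T}" and "loc_max_on (\<lambda>s y. \<phi> s y - V s y) T t x"
  then obtain e where e: "e > 0"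
    "\<And>s y. s \<in> {0<..<T} \<Longrightarrow> dist (s, y) (t, x) < e \<Longrightarrow> \<phi> s y - V s y \<le> \<phi> t x - V t x"
    unfolding loc_max_on_def by blast
  define P where "P = d2 \<phi> t x"
  have t0: "t > 0" using t by simp
  obtain q p where cal: "calibrated t x q p" and Vt: "V t x = Uo (q 0) + act t q p"
    by (rule V_calibrated[OF t0, of x]) blast
  have hs: "hs_sol H t q p" and qe: "q t = x" and pR: "\<And>r. r \<in> {0..t} \<Longrightarrow> \<bar>p r\<bar> \<le> R"
    using cal by (auto simp: calibrated_def)
  have pB: "\<bar>p r\<bar> \<le> B" if "r \<in> {0..t}" for r using pR[OF that] R_less_B by simp
  have tt: "t \<in> {0..t}" using t0 by simp
  define w where "w = (\<lambda>\<sigma>. \<phi> \<sigma> (q \<sigma>) - act \<sigma> q p)"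
  show "d1 \<phi> t x + H x (d2 \<phi> t x) \<ge> 0"
  proof (rule ccontr)
    assume "\<not> ?thesis"
    then have neg: "d1 \<phi> t x + H x P < 0" by (simp add: P_def)
    define D where "D = d1 \<phi> t x * 1 + P * d2 H x (p t) - ell x (p t)"
    have dq: "(q has_real_derivative d2 H x (p t)) (at t within {0..t})"
      using hs tt qe by (auto simp: hs_sol_def)
    have "(w has_real_derivative D) (at t within {0..t})"
      unfolding w_def D_def P_def
      using DERIV_diff[OF Ck_1_chain[OF \<phi> DERIV_ident dq] act_has_derivative[OF hs pB tt]] by (simp add: qe)
    moreover have "D < 0"
      using neg H_convex[of x "p t" P] by (simp add: D_def hs_lagrangian_def algebra_simps)
    ultimately obtain d where d: "d > 0" "\<And>h. h > 0 \<Longrightarrow> t - h \<in> {0..t} \<Longrightarrow> h < d \<Longrightarrow> w t < w (t - h)"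
      using has_real_derivative_neg_dec_left by blast
    have C1: "1 + C > 0" using C_pos by simp
    obtain h where h: "h > 0" "h < d" "h \<le> t / 2" "h * (1 + C) \<le> e / 2"
      by (rule small_step[OF d(1) t0 e(1) C1])
    define s where "s = t - h"
    have s: "s \<in> {0<..<T}" "s \<in> {0..t}" using h t by (auto simp: s_def)
    have "\<bar>q s - q t\<bar> \<le> C * \<bar>s - t\<bar>" by (rule hs_sol_lipschitz(1)[OF hs pB s(2) tt])
    then have "dist (s, q s) (t, x) \<le> h * (1 + C)"
      using dist_pair_le[of s "q s" t x] h(1) by (simp add: s_def qe algebra_simps)
    also have "\<dots> \<le> e / 2" by (rule h(4))
    finally have "dist (s, q s) (t, x) < e" using e(1) by simp
    from e(2)[OF s(1) this] have 1: "\<phi> s (q s) - V s (q s) \<le> \<phi> t x - V t x" .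
    have hss: "hs_sol H s q p" using hs_sol_restrict[OF hs] s by simp
    have pBs: "\<bar>p r\<bar> \<le> B" if "r \<in> {0..s}" for r using pB that s by simp
    have "V s (q s) \<le> Uo (q 0) + act s q p"
      by (rule V_le_hs_sol[OF hss pBs]) (use s in auto)
    then have "w s \<le> w t" using 1 Vt by (simp add: w_def qe)
    then show False using d(2)[OF h(1)] h s by (simp add: s_def)
  qed
qed

theorem V_visc_sol:
  assumes "T > 0"
  shows "visc_sol H T Uo V"
  unfolding visc_sol_def using V_lipschitz[OF assms] V_visc_sub V_visc_super by (simp add: V_0)

text \<open>Solutions starting with zero momentum are global: conservation of energy confines the momentum.\<close>
lemma hs_sol_from:
  assumes t: "t \<ge> 0"
  obtains q p where "hs_sol H t q p" "q 0 = x" "\<And>s. s \<in> {0..t} \<Longrightarrow> \<bar>p s\<bar> \<le> R"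
proof -
  obtain Z where Z0: "Z 0 = (x, 0)" and Z: "\<And>s. s \<in> {0..t} \<Longrightarrow> (Z has_vector_derivative F (Z s)) (at s within {0..t})"
    using ode_global_existence[OF F_lip, of "(x, 0)" t] C_pos by auto
  define p where "p = (\<lambda>s. snd (Z s))"
  have cZ: "continuous_on {0..t} Z"
    unfolding continuous_on_eq_continuous_within using Z has_vector_derivative_continuous by blast
  have cp: "continuous_on {0..t} (\<lambda>s. \<bar>p s\<bar>)"
    unfolding p_def by (intro continuous_intros cZ)
  have hsZ: "hs_sol H s (\<lambda>r. fst (Z r)) p" if "s \<le> t" "\<And>r. r \<in> {0..s} \<Longrightarrow> \<bar>p r\<bar> \<le> B" for s
    unfolding p_def
    by (rule F_imp_hs_sol) (use that Z in \<open>auto simp: p_def intro: has_vector_derivative_within_subset[where S="{0..t}"]\<close>)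
  have conf: "\<bar>p s\<bar> \<le> R" if "0 \<le> s" "s \<le> t" "\<And>r. r \<in> {0..s} \<Longrightarrow> \<bar>p r\<bar> \<le> B" for s
  proof -
    have "H (fst (Z s)) (p s) = H (fst (Z 0)) (p 0)"
      by (rule energy_conserved[OF hsZ[OF that(2,3)]]) (use that in auto)
    also have "\<dots> \<le> E" using H_le_E[of 0 x] K_nonneg by (simp add: Z0 p_def)
    finally show ?thesis using sublevel_R[of "fst (Z s)" "p s"] by simp
  qed
  have lt: "\<bar>p s\<bar> < B" if s: "s \<in> {0..t}" for s
  proof (rule ccontr)
    assume "\<not> \<bar>p s\<bar> < B"
    have p0: "\<bar>p 0\<bar> < B" using B_pos by (simp add: p_def Z0)
    \<comment> \<open>Up to the first time at which the modulus of the momentum reaches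
      \<open>B\<close> the clamped orbit is Hamiltonian, so \<open>conf\<close> applies there and
      gives the contradictory bound \<open>R < B\<close>.\<close>
    define S where "S = {r \<in> {0..t}. \<bar>p r\<bar> = B}"
    have ivt: "\<exists>r\<in>S. r \<le> s'" if "s' \<in> {0..t}" "\<bar>p s'\<bar> \<ge> B" for s'
      using IVT'[of "\<lambda>s. \<bar>p s\<bar>" 0 B s'] p0 that continuous_on_subset[OF cp, of "{0..s'}"]
      by (auto simp: S_def)
    have "closed S" unfolding S_def
      by (intro continuous_closed_preimage_constant cp closed_atLeastAtMost)
    moreover have "S \<noteq> {}" using ivt[OF s] \<open>\<not> \<bar>p s\<bar> < B\<close> by auto
    moreover have bb: "bdd_below S" unfolding S_def by (rule bdd_belowI[of _ 0]) auto
    ultimately have i: "Inf S \<in> S" by (intro closed_contains_Inf)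
    have "\<bar>p r\<bar> \<le> B" if "r \<in> {0..Inf S}" for r
    proof (rule ccontr)
      assume n: "\<not> \<bar>p r\<bar> \<le> B"
      have "r \<in> {0..t}" using that i by (auto simp: S_def)
      then obtain r' where r': "r' \<in> S" "r' \<le> r" using ivt[of r] n by auto
      then have "Inf S \<le> r'" using bb by (simp add: cInf_lower)
      then have "r = Inf S" using r' that by auto
      then show False using n i by (simp add: S_def)
    qed
    then have "\<bar>p (Inf S)\<bar> \<le> R" using i by (intro conf) (auto simp: S_def)
    then show False using i R_less_B by (simp add: S_def)
  qed
  show ?thesis
  proof (rule that)
    show "hs_sol H t (\<lambda>r. fst (Z r)) p" using lt by (intro hsZ) (auto intro: less_imp_le)
    show "fst (Z 0) = x" by (simp add: Z0)
    show "\<bar>p s\<bar> \<le> R" if "s \<in> {0..t}" for s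
      using that lt by (intro conf) (auto intro: less_imp_le)
  qed
qed

end

section \<open>Subsolutions are dominated by the action\<close>

lemma DERIV_from_quadratic:
  fixes f :: "real \<Rightarrow> real"
  assumes "\<And>r. \<bar>f r - f s - D * (r - s)\<bar> \<le> (r - s)\<^sup>2"
  shows "(f has_real_derivative D) (at s)"
  unfolding has_field_derivative_iff
proof (rule LIM_zero_cancel, rule Lim_null_comparison)
  have "\<bar>(f r - f s) / (r - s) - D\<bar> \<le> \<bar>r - s\<bar>" if "r \<noteq> s" for r
  proof -
    have "(f r - f s) / (r - s) - D = (f r - f s - D * (r - s)) / (r - s)"
      using that by (simp add: diff_divide_distrib)
    then have "\<bar>(f r - f s) / (r - s) - D\<bar> = \<bar>f r - f s - D * (r - s)\<bar> / \<bar>r - s\<bar>"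
      by (simp only: abs_divide)
    also have "\<dots> \<le> \<bar>r - s\<bar>\<^sup>2 / \<bar>r - s\<bar>"
      using assms[of r] by (intro divide_right_mono) auto
    also have "\<dots> = \<bar>r - s\<bar>" unfolding power2_eq_square
      by (rule nonzero_mult_div_cancel_left) (use that in simp)
    finally show ?thesis .
  qed
  then show "\<forall>\<^sub>F r in at s. norm ((f r - f s) / (r - s) - D) \<le> \<bar>r - s\<bar>"
    by (simp add: eventually_at_filter)
  have "((\<lambda>r. \<bar>r - s\<bar>) \<longlongrightarrow> \<bar>s - s\<bar>) (at s)" by (intro tendsto_intros)
  then show "((\<lambda>r. \<bar>r - s\<bar>) \<longlongrightarrow> 0) (at s)" by simp
qed

text \<open>The squared positive part is the simplest continuously differentiable penalty that
  vanishes up to time \<open>a\<close> and has nonnegative derivative, so it only helps in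
  subsolution inequalities.\<close>

lemma DERIV_pos_part_square: "((\<lambda>s. (max 0 (s - a))\<^sup>2) has_real_derivative 2 * max 0 (s - a)) (at s)"
proof (rule DERIV_from_quadratic)
  fix r :: real
  have *: "\<bar>(max 0 u)\<^sup>2 - (max 0 w)\<^sup>2 - 2 * max 0 w * (u - w)\<bar> \<le> (u - w)\<^sup>2" for u w :: real
  proof -
    consider "u \<ge> 0" "w \<ge> 0" | "u < 0" "w \<ge> 0" | "u \<ge> 0" "w < 0" | "u < 0" "w < 0" by linarith
    then show ?thesis
    proof cases
      case 1
      then have "(max 0 u)\<^sup>2 - (max 0 w)\<^sup>2 - 2 * max 0 w * (u - w) = (u - w)\<^sup>2"
        by (simp add: power2_eq_square algebra_simps)
      then show ?thesis by simp
    next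
      case 2
      then have "(max 0 u)\<^sup>2 - (max 0 w)\<^sup>2 - 2 * max 0 w * (u - w) = w\<^sup>2 - 2 * (w * u)"
        by (simp add: power2_eq_square algebra_simps max_def)
      moreover have "w * u \<le> 0" using 2 by (simp add: mult_nonneg_nonpos)
      moreover have "(u - w)\<^sup>2 = u\<^sup>2 + w\<^sup>2 - 2 * (w * u)" by (simp add: power2_diff)
      moreover have "u\<^sup>2 \<ge> 0" "w\<^sup>2 \<ge> 0" by auto
      ultimately show ?thesis by linarith
    next
      case 3
      then have "u * w \<le> 0" by (simp add: mult_nonneg_nonpos)
      moreover have "(u - w)\<^sup>2 = u\<^sup>2 + w\<^sup>2 - 2 * (u * w)" by (simp add: power2_diff)
      moreover have "(max 0 u)\<^sup>2 - (max 0 w)\<^sup>2 - 2 * max 0 w * (u - w) = u\<^sup>2" using 3 by simp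
      moreover have "u\<^sup>2 \<ge> 0" "w\<^sup>2 \<ge> 0" by auto
      ultimately show ?thesis by linarith
    next
      case 4
      then show ?thesis by (simp add: max_def)
    qed
  qed
  show "\<bar>(max 0 (r - a))\<^sup>2 - (max 0 (s - a))\<^sup>2 - 2 * max 0 (s - a) * (r - s)\<bar> \<le> (r - s)\<^sup>2"
    using *[of "r - a" "s - a"] by simp
qed

text \<open>Test functions must be differentiable on the whole plane, whereas orbits and actions are
  controlled on a compact interval with one-sided derivatives at its ends; extending the derivative
  continuously and integrating it repairs this.\<close>

lemma extend_antiderivative:
  fixes f u :: "real \<Rightarrow> real"
  assumes f: "continuous_on UNIV f" and t: "t \<ge> 0"
    and u: "\<And>s. s \<in> {0..t} \<Longrightarrow> (u has_real_derivative f s) (at s within {0..t})"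
  obtains Q where "\<forall>s. (Q has_real_derivative f s) (at s)" "\<forall>s\<in>{0..t}. Q s = u s"
proof -
  obtain G where G: "\<And>s. (G has_real_derivative f s) (at s)"
    using einterval_antiderivative[of "-\<infinity>" "\<infinity>" f] f
    by (auto simp: continuous_on_eq_continuous_at has_real_derivative_iff_has_vector_derivative)
  define Q where "Q = (\<lambda>s. G s - G 0 + u 0)"
  have Q: "(Q has_real_derivative f s) (at s)" for s
    unfolding Q_def by (auto intro!: derivative_eq_intros G)
  have "((\<lambda>s. Q s - u s) has_real_derivative 0) (at s within {0..t})" if "s \<in> {0..t}" for s
    using DERIV_diff[OF has_field_derivative_at_within[OF Q] u[OF that]] by simp
  then have "\<bar>(Q s - u s) - (Q 0 - u 0)\<bar> \<le> 0 * \<bar>s - 0\<bar>" if "s \<in> {0..t}" for s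
    using that t by (intro MVT_abs_le[of "{0..t}" 0 s "\<lambda>s. Q s - u s" "\<lambda>s. 0"]) auto
  then have "Q s = u s" if "s \<in> {0..t}" for s using that by (fastforce simp: Q_def)
  then show ?thesis using Q that by blast
qed

lemma lipschitz_pairD:
  assumes "M-lipschitz_on ({0..T} \<times> UNIV) (\<lambda>z. U (fst z) (snd z) :: real)"
    and "s \<in> {0..T}" "t \<in> {0..T}"
  shows "\<bar>U s y - U t x\<bar> \<le> M * (\<bar>s - t\<bar> + \<bar>y - x\<bar>)"
proof -
  have "\<bar>U s y - U t x\<bar> \<le> M * dist (s, y) (t, x)"
    using lipschitz_onD[OF assms(1), of "(s, y)" "(t, x)"] assms(2,3) by (simp add: dist_real_def)
  also have "\<dots> \<le> M * (\<bar>s - t\<bar> + \<bar>y - x\<bar>)"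
    using lipschitz_on_nonneg[OF assms(1)] dist_pair_le by (rule mult_left_mono[rotated])
  finally show ?thesis .
qed

lemma penalised_distance:
  fixes r M \<epsilon> :: real
  assumes "r\<^sup>2 / \<epsilon> \<le> M * \<bar>r\<bar>" "\<epsilon> > 0" "M \<ge> 0"
  shows "\<bar>r\<bar> \<le> M * \<epsilon>"
proof (cases "r = 0")
  case False
  have "\<bar>r\<bar> * \<bar>r\<bar> \<le> (M * \<epsilon>) * \<bar>r\<bar>"
    using assms by (simp add: pos_divide_le_eq power2_eq_square mult_ac flip: abs_mult)
  then show ?thesis by (rule mult_right_le_imp_le) (use False in simp)
qed (use assms in simp)

lemma small_epsilon:
  fixes k d :: real
  assumes "k \<ge> 0" "d > 0"
  obtains \<epsilon> where "\<epsilon> > 0" "k * \<epsilon> < d"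
proof
  show "d / (k + 1) > 0" using assms by simp
  show "k * (d / (k + 1)) < d" using assms by (simp add: field_simps)
qed

context ham_box
begin

text \<open>The test function \<open>(y - q s)\<^sup>2 / \<epsilon>\<close> plus the running action is \<open>C\<^sup>1\<close> because \<open>q\<close> is, so no doubling of
  variables is needed; the term with \<open>\<Lambda>\<close> keeps the maximum away from the final time.\<close>
lemma visc_sub_dominated_before:
  assumes lip: "M-lipschitz_on ({0..T} \<times> UNIV) (\<lambda>z. U (fst z) (snd z))" and MB: "2 * M \<le> B"
    and sub: "visc_sub H T U"
    and hs: "hs_sol H t0 q p" and b: "\<And>s. s \<in> {0..t0} \<Longrightarrow> \<bar>p s\<bar> \<le> B"
    and t: "0 < t1" "t1 < t0" "t0 \<le> T"
  shows "U t1 (q t1) \<le> U 0 (q 0) + act t1 q p"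
proof (rule ccontr)
  assume contr: "\<not> ?thesis"
  define \<sigma> where "\<sigma> = U t1 (q t1) - U 0 (q 0) - act t1 q p"
  have \<sigma>: "\<sigma> > 0" using contr by (simp add: \<sigma>_def)
  have M: "M \<ge> 0" using lip by (rule lipschitz_on_nonneg)
  define ct where "ct = (\<lambda>s. max 0 (min t0 s))"
  have ct: "ct s \<in> {0..t0}" "s \<in> {0..t0} \<Longrightarrow> ct s = s" for s using t by (auto simp: ct_def)
  have cct: "continuous_on UNIV ct" unfolding ct_def by (intro continuous_intros)
  define w where "w = (\<lambda>s. d2 H (q (ct s)) (p (ct s)))"
  define l where "l = (\<lambda>s. ell (q (ct s)) (p (ct s)))"
  have cqp: "continuous_on UNIV (\<lambda>s. q (ct s))" "continuous_on UNIV (\<lambda>s. p (ct s))"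
    using hs_sol_continuous[OF hs] ct(1) by (auto intro!: continuous_on_compose2[OF _ cct])
  have cw: "continuous_on UNIV w" unfolding w_def
    by (rule box_continuous[OF Hp_lip cqp]) (use b ct in auto)
  have cl: "continuous_on UNIV l" unfolding l_def
    by (rule box_continuous[OF ell_lip cqp]) (use b ct in auto)
  obtain Q where Q: "\<forall>s. (Q has_real_derivative w s) (at s)" "\<forall>s\<in>{0..t0}. Q s = q s"
    by (rule extend_antiderivative[OF cw, of t0 q]) (use t hs ct in \<open>auto simp: w_def hs_sol_def\<close>)
  obtain G where G: "\<forall>s. (G has_real_derivative l s) (at s)" "\<forall>s\<in>{0..t0}. G s = act s q p"
    by (rule extend_antiderivative[OF cl, of t0 "\<lambda>s. act s q p"])
      (use t ct act_has_derivative[OF hs b] in \<open>auto simp: l_def\<close>)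
  have cQ: "continuous_on S Q" and cG: "continuous_on S G" for S
    by (rule DERIV_continuous_on[OF has_field_derivative_at_within[OF Q(1)[rule_format]]],
        rule DERIV_continuous_on[OF has_field_derivative_at_within[OF G(1)[rule_format]]])
  have wC: "\<bar>w s\<bar> \<le> C" for s unfolding w_def using b ct by (intro Hp_bound) auto
  have Qlip: "\<bar>Q s - Q r\<bar> \<le> C * \<bar>s - r\<bar>" for s r
    by (rule MVT_abs_le[of UNIV r s Q w]) (use Q(1) wC in auto)
  define T' where "T' = (t1 + t0) / 2"
  have T': "t1 < T'" "T' < t0" "T' \<le> T" "T' > 0" using t by (auto simp: T'_def)
  \<comment> \<open>One more than the largest conceivable excess of \<open>U s y - act s q p\<close>
    over \<open>U 0 (q 0)\<close>, so that the penalty at \<open>T'\<close> rules out a maximum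
    there.\<close>
  define D where "D = M * (T + C * T + 1) + (1 + B) * C * T + 1"
  define \<Lambda> where "\<Lambda> = D / (T' - t1)\<^sup>2"
  \<comment> \<open>The slope in time that makes the final inequality strict; at \<open>t1\<close>
    it uses up only half of \<sigma>.\<close>
  define \<mu> where "\<mu> = \<sigma> / (2 * t1)"
  have D: "D > 0" using M C_pos B_pos t by (auto simp: D_def intro!: add_nonneg_pos)
  have \<Lambda>: "\<Lambda> > 0" "\<Lambda> * (T' - t1)\<^sup>2 = D" using T' D by (auto simp: \<Lambda>_def)
  have \<mu>: "\<mu> > 0" "\<mu> * t1 = \<sigma> / 2" using \<sigma> t by (auto simp: \<mu>_def)
  \<comment> \<open>The three summands keep the maximum off the lateral boundary, exclude time 0,
    and make the error of replacing \<open>y\<close> by \<open>q s\<close> in \<open>H\<close>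
    smaller than \<mu>.\<close>
  obtain \<epsilon> where \<epsilon>: "\<epsilon> > 0" "(M + M * M + C * M) * \<epsilon> < min 1 (min (\<sigma> / 2) \<mu>)"
    by (rule small_epsilon[of "M + M * M + C * M" "min 1 (min (\<sigma> / 2) \<mu>)"])
       (use M C_pos \<sigma> \<mu> in auto)
  have sm: "0 \<le> M * \<epsilon>" "0 \<le> M * M * \<epsilon>" "0 \<le> C * M * \<epsilon>" using M C_pos \<epsilon>(1) by auto
  then have \<epsilon>s: "M * \<epsilon> < 1" "M * M * \<epsilon> < \<sigma> / 2" "C * M * \<epsilon> < \<mu>"
    using \<epsilon>(2) unfolding distrib_right by linarith+
  define \<phi> where "\<phi> = (\<lambda>s y. G s + (y - Q s)\<^sup>2 / \<epsilon> + \<mu> * s + \<Lambda> * (max 0 (s - t1))\<^sup>2)"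
  define \<phi>1 where "\<phi>1 = (\<lambda>s y. l s - 2 * (y - Q s) / \<epsilon> * w s + \<mu> + \<Lambda> * (2 * max 0 (s - t1)))"
  define \<phi>2 where "\<phi>2 = (\<lambda>(s::real) y. 2 * (y - Q s) / \<epsilon>)"
  have c2: "continuous_on UNIV (\<lambda>z :: real \<times> real. f (fst z))" if "continuous_on UNIV f" for f :: "real \<Rightarrow> real"
    by (rule continuous_on_compose2[OF that continuous_on_fst[OF continuous_on_id]]) auto
    have f1: "((\<lambda>s. \<phi> s y) has_real_derivative \<phi>1 s y) (at s)" for s y
    proof -
      have "((\<lambda>s. (y - Q s)\<^sup>2 / \<epsilon>) has_real_derivative - (2 * (y - Q s) / \<epsilon> * w s)) (at s)"
        using \<epsilon>(1) by (auto intro!: derivative_eq_intros Q(1)[rule_format])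
      moreover have "((\<lambda>s. \<mu> * s) has_real_derivative \<mu>) (at s)"
        by (auto intro!: derivative_eq_intros)
      ultimately have "(\<phi>' has_real_derivative l s + - (2 * (y - Q s) / \<epsilon> * w s) + \<mu> + \<Lambda> * (2 * max 0 (s - t1))) (at s)"
        if "\<phi>' = (\<lambda>s. G s + (y - Q s)\<^sup>2 / \<epsilon> + \<mu> * s + \<Lambda> * (max 0 (s - t1))\<^sup>2)" for \<phi>'
        unfolding that by (intro DERIV_add DERIV_cmult DERIV_pos_part_square G(1)[rule_format])
      then show ?thesis unfolding \<phi>_def \<phi>1_def by simp
    qed
    have f2: "((\<lambda>y. \<phi> s y) has_real_derivative \<phi>2 s y) (at y)" for s y
      unfolding \<phi>_def \<phi>2_def using \<epsilon>(1) by (auto intro!: derivative_eq_intros)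
    have c0: "continuous_on UNIV (\<lambda>z. \<phi> (fst z) (snd z))"
      unfolding \<phi>_def using \<epsilon>(1) by (intro continuous_intros c2 cQ cG) auto
    have c1: "continuous_on UNIV (\<lambda>z. \<phi>1 (fst z) (snd z))"
      unfolding \<phi>1_def using \<epsilon>(1) by (intro continuous_intros c2 cQ cl cw) auto
    have c3: "continuous_on UNIV (\<lambda>z. \<phi>2 (fst z) (snd z))"
      unfolding \<phi>2_def using \<epsilon>(1) by (intro continuous_intros c2 cQ) auto
  have "Ck 1 \<phi>" and d\<phi>: "d1 \<phi> = \<phi>1" "d2 \<phi> = \<phi>2"
    by (rule Ck_1I[OF f1 f2 c0 c1 c3])+
  \<comment> \<open>The coordinate \<open>r = y - Q s\<close> straightens the tube around the orbit
    into a compact box.\<close>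
  define \<Psi> where "\<Psi> = (\<lambda>s r. U s (Q s + r) - \<phi> s (Q s + r))"
  have "\<exists>z\<in>{0..T'} \<times> {-1..1}. \<forall>z'\<in>{0..T'} \<times> {-1..1}. \<Psi> (fst z') (snd z') \<le> \<Psi> (fst z) (snd z)"
  proof (rule continuous_attains_sup)
    show "compact ({0..T'} \<times> {-1..1 :: real})" by (intro compact_Times compact_Icc)
    have cpair: "continuous_on ({0..T'} \<times> {-1..1}) (\<lambda>z :: real \<times> real. (fst z, Q (fst z) + snd z))"
      by (intro continuous_intros continuous_on_subset[OF c2[OF cQ]]) auto
    have "continuous_on ({0..T'} \<times> {-1..1}) (\<lambda>z. U (fst z) (Q (fst z) + snd z))"
    proof -
      have "(\<lambda>z. (fst z, Q (fst z) + snd z)) ` ({0..T'} \<times> {-1..1}) \<subseteq> {0..T} \<times> UNIV"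
        using T' by (intro image_subsetI) (simp add: mem_Times_iff)
      from continuous_on_compose2[OF lipschitz_on_continuous_on[OF lip] cpair this] show ?thesis by simp
    qed
    moreover have "continuous_on ({0..T'} \<times> {-1..1}) (\<lambda>z. \<phi> (fst z) (Q (fst z) + snd z))"
      using continuous_on_compose2[OF Ck_continuous[OF \<open>Ck 1 \<phi>\<close>] cpair] by auto
    ultimately show "continuous_on ({0..T'} \<times> {-1..1}) (\<lambda>z. \<Psi> (fst z) (snd z))"
      unfolding \<Psi>_def by (intro continuous_intros)
  qed (use T' in auto)
  then obtain s r where s: "s \<in> {0..T'}" and r: "r \<in> {-1..1}"
    and max: "\<And>s' r'. s' \<in> {0..T'} \<Longrightarrow> r' \<in> {-1..1} \<Longrightarrow> \<Psi> s' r' \<le> \<Psi> s r"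
    by (auto simp: Ball_def)
  have st: "s \<in> {0..t0}" "s \<in> {0..T}" using s T' by auto
  define y where "y = Q s + r"
  have low: "U 0 (q 0) + \<sigma> / 2 \<le> \<Psi> s r"
  proof -
    have "\<Psi> t1 0 = U t1 (q t1) - act t1 q p - \<mu> * t1"
      using t Q(2) G(2) by (simp add: \<Psi>_def \<phi>_def)
    moreover have "\<Psi> t1 0 \<le> \<Psi> s r" using T' t by (intro max) auto
    moreover have "U t1 (q t1) - act t1 q p = U 0 (q 0) + \<sigma>" by (simp add: \<sigma>_def)
    ultimately show ?thesis using \<mu>(2) by simp
  qed
  have "\<bar>r\<bar> \<le> M * \<epsilon>"
  proof (rule penalised_distance[OF _ \<epsilon>(1) M])
    have "\<Psi> s 0 \<le> \<Psi> s r" by (rule max[OF s]) simp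
    then have "r\<^sup>2 / \<epsilon> \<le> U s (Q s + r) - U s (Q s)" by (simp add: \<Psi>_def \<phi>_def)
    then show "r\<^sup>2 / \<epsilon> \<le> M * \<bar>r\<bar>"
      using lipschitz_pairD[OF lip st(2) st(2), of "Q s + r" "Q s"] by simp
  qed
  then have rM: "\<bar>r\<bar> \<le> M * \<epsilon>" "\<bar>r\<bar> < 1" using \<epsilon>s by auto
  have "s \<noteq> 0"
  proof
    assume "s = 0"
    have "r\<^sup>2 / \<epsilon> \<ge> 0" using \<epsilon>(1) by simp
    then have "\<Psi> s r \<le> U 0 (q 0 + r)"
      using Q(2) G(2) t unfolding \<Psi>_def \<phi>_def \<open>s = 0\<close> by (simp add: hs_action_def)
    also have "\<dots> \<le> U 0 (q 0) + M * \<bar>r\<bar>"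
      using lipschitz_pairD[OF lip, of 0 0 "q 0 + r" "q 0"] t by simp
    also have "M * \<bar>r\<bar> \<le> M * (M * \<epsilon>)" using rM M by (intro mult_left_mono) auto
    finally show False using low \<epsilon>s(2) by (simp add: mult.assoc)
  qed
  have "s \<noteq> T'"
  proof
    assume "s = T'"
    have "\<Psi> s r \<le> U s y - act s q p - \<Lambda> * (T' - t1)\<^sup>2"
    proof -
      have "r\<^sup>2 / \<epsilon> \<ge> 0" "\<mu> * s \<ge> 0" using \<epsilon>(1) \<mu>(1) s by auto
      moreover have "max 0 (s - t1) = T' - t1" using T' \<open>s = T'\<close> by simp
      ultimately show ?thesis using G(2) st(1) by (simp add: \<Psi>_def \<phi>_def y_def)
    qed
    moreover have "U s y \<le> U 0 (q 0) + M * (T + C * T + 1)"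
    proof -
      have "\<bar>q s - q 0\<bar> \<le> C * \<bar>s - 0\<bar>" by (rule hs_sol_lipschitz[OF hs b st(1)]) (use t in auto)
      also have "\<dots> \<le> C * T" using st C_pos by (intro mult_left_mono) auto
      finally have "\<bar>s - 0\<bar> + \<bar>y - q 0\<bar> \<le> T + C * T + 1" using Q(2) st r by (auto simp: y_def)
      then have "M * (\<bar>s - 0\<bar> + \<bar>y - q 0\<bar>) \<le> M * (T + C * T + 1)" using M by (rule mult_left_mono)
      then show ?thesis using lipschitz_pairD[OF lip st(2), of 0 y "q 0"] t by auto
    qed
    moreover have "\<bar>act s q p\<bar> \<le> (1 + B) * C * T"
    proof -
      have "\<bar>act s q p\<bar> \<le> (1 + B) * C * s"
        by (rule act_abs_le[OF hs_sol_restrict[OF hs]]) (use b st in auto)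
      also have "\<dots> \<le> (1 + B) * C * T" using st B_pos C_pos by (intro mult_left_mono) auto
      finally show ?thesis .
    qed
    ultimately show False using low \<sigma> unfolding \<Lambda>(2) D_def by linarith
  qed
  have s': "0 < s" "s < T'" using s \<open>s \<noteq> 0\<close> \<open>s \<noteq> T'\<close> by auto
  have "loc_max_on (\<lambda>s y. U s y - \<phi> s y) T s y"
  proof -
    define e where "e = min (T' - s) ((1 - \<bar>r\<bar>) / (1 + C))"
    have "e > 0" using s' rM C_pos by (auto simp: e_def)
    moreover have "U s'' y'' - \<phi> s'' y'' \<le> U s y - \<phi> s y" if "s'' \<in> {0<..<T}" "dist (s'', y'') (s, y) < e" for s'' y''
    proof -
      have d: "\<bar>s'' - s\<bar> < e" "\<bar>y'' - y\<bar> < e"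
        using that(2) dist_fst_le[of "(s'', y'')" "(s, y)"] dist_snd_le[of "(s'', y'')" "(s, y)"]
        by (auto simp: dist_real_def)
      have ee: "e \<le> T' - s" "(1 + C) * e \<le> 1 - \<bar>r\<bar>"
      proof -
        show "e \<le> T' - s" by (simp add: e_def)
        have "e \<le> (1 - \<bar>r\<bar>) / (1 + C)" by (simp add: e_def)
        then show "(1 + C) * e \<le> 1 - \<bar>r\<bar>" using C_pos by (simp add: pos_le_divide_eq mult.commute)
      qed
      have "C * \<bar>s'' - s\<bar> \<le> C * e" using d C_pos by (intro mult_left_mono) auto
      then have "\<bar>Q s'' - Q s\<bar> \<le> C * e" using Qlip[of s'' s] by linarith
      moreover have "y'' - Q s'' = r + (y'' - y) - (Q s'' - Q s)" by (simp add: y_def)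
      ultimately have "\<bar>y'' - Q s''\<bar> \<le> \<bar>r\<bar> + e + C * e" using d by linarith
      then have "y'' - Q s'' \<in> {-1..1}" using ee(2) by (auto simp: distrib_right)
      moreover have "s'' \<in> {0..T'}" using d ee(1) that by auto
      ultimately have "\<Psi> s'' (y'' - Q s'') \<le> \<Psi> s r" by (intro max)
      then show ?thesis by (simp add: \<Psi>_def y_def)
    qed
    ultimately show ?thesis unfolding loc_max_on_def by blast
  qed
  then have "d1 \<phi> s y + H y (d2 \<phi> s y) \<le> 0"
    using sub \<open>Ck 1 \<phi>\<close> s' T' unfolding visc_sub_def by auto
  moreover define P where "P = 2 * r / \<epsilon>"
  ultimately have 1: "ell (q s) (p s) - P * d2 H (q s) (p s) + \<mu> + \<Lambda> * (2 * max 0 (s - t1)) + H y P \<le> 0"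
    unfolding d\<phi> \<phi>1_def \<phi>2_def y_def l_def w_def using ct(2)[OF st(1)] by simp
  \<comment> \<open>The slope of the test function at the maximum is at most twice the Lipschitz
    constant; this explains the hypothesis \<open>2 * M \<le> B\<close>.\<close>
  have PB: "\<bar>P\<bar> \<le> B"
  proof -
    have "\<bar>P\<bar> = 2 * \<bar>r\<bar> / \<epsilon>" using \<epsilon>(1) by (simp add: P_def abs_mult)
    also have "\<dots> \<le> 2 * (M * \<epsilon>) / \<epsilon>" using rM \<epsilon>(1) by (intro divide_right_mono) auto
    also have "\<dots> = 2 * M" using \<epsilon>(1) by simp
    finally show ?thesis using MB by simp
  qed
  have "H (q s) P \<ge> H (q s) (p s) + d2 H (q s) (p s) * (P - p s)" by (rule H_convex)
  then have "ell (q s) (p s) - P * d2 H (q s) (p s) \<ge> - H (q s) P" by (simp add: hs_lagrangian_def algebra_simps)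
  moreover have "H (q s) P - H y P \<le> C * \<bar>r\<bar>"
    using H_lip[OF PB PB, of "q s" y] Q(2) st by (simp add: y_def abs_le_iff)
  moreover have "C * \<bar>r\<bar> \<le> C * M * \<epsilon>" using rM C_pos by (simp add: mult.assoc)
  moreover have "\<Lambda> * (2 * max 0 (s - t1)) \<ge> 0" using \<Lambda>(1) by simp
  ultimately show False using 1 \<epsilon>s(3) by linarith
qed

text \<open>The penalty needs room after \<open>t1\<close>, so the endpoint itself is reached by
  letting \<open>t1\<close> increase to \<open>t0\<close>, using Lipschitz continuity in
  time.\<close>

lemma visc_sub_dominated:
  assumes lip: "M-lipschitz_on ({0..T} \<times> UNIV) (\<lambda>z. U (fst z) (snd z))" and MB: "2 * M \<le> B"
    and sub: "visc_sub H T U"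
    and hs: "hs_sol H t0 q p" and b: "\<And>s. s \<in> {0..t0} \<Longrightarrow> \<bar>p s\<bar> \<le> B"
    and t: "0 \<le> t0" "t0 \<le> T"
  shows "U t0 (q t0) \<le> U 0 (q 0) + act t0 q p"
proof (cases "t0 = 0")
  case True
  then show ?thesis by (simp add: hs_action_def)
next
  case False
  then have t0: "t0 > 0" using t by simp
  have M: "M \<ge> 0" using lip by (rule lipschitz_on_nonneg)
  define c where "c = M * (1 + C) + (1 + B) * C"
  have c: "c \<ge> 0" using M C_pos B_pos by (auto simp: c_def)
  have key: "U t0 (q t0) - (U 0 (q 0) + act t0 q p) \<le> c * (t0 - t1)" if t1: "0 < t1" "t1 < t0" for t1
  proof -
    have m: "t1 \<in> {0..t0}" "t0 \<in> {0..t0}" using t1 by auto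
    have "\<bar>act t0 q p - act t1 q p\<bar> \<le> (1 + B) * C * \<bar>t0 - t1\<bar>"
      by (rule MVT_abs_le[OF _ m act_has_derivative[OF hs b]]) (use ell_bound b in auto)
    moreover have "\<bar>U t0 (q t0) - U t1 (q t1)\<bar> \<le> M * (\<bar>t0 - t1\<bar> + \<bar>q t0 - q t1\<bar>)"
      by (rule lipschitz_pairD[OF lip]) (use t t1 in auto)
    moreover have "M * (\<bar>t0 - t1\<bar> + \<bar>q t0 - q t1\<bar>) \<le> M * ((1 + C) * (t0 - t1))"
      using hs_sol_lipschitz(1)[OF hs b m(2,1)] t1 M by (intro mult_left_mono) (auto simp: algebra_simps)
    moreover have "U t1 (q t1) \<le> U 0 (q 0) + act t1 q p"
      by (rule visc_sub_dominated_before[OF lip MB sub hs b t1 t(2)])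
    moreover have "c * (t0 - t1) = M * ((1 + C) * (t0 - t1)) + (1 + B) * C * (t0 - t1)"
      by (simp add: c_def algebra_simps)
    ultimately show ?thesis using t1 by (simp add: abs_le_iff)
  qed
  have "U t0 (q t0) - (U 0 (q 0) + act t0 q p) \<le> 0"
  proof (rule ccontr)
    assume "\<not> ?thesis"
    then have d: "U t0 (q t0) - (U 0 (q 0) + act t0 q p) > 0" by simp
    obtain \<epsilon> where e: "\<epsilon> > 0" "c * \<epsilon> < U t0 (q t0) - (U 0 (q 0) + act t0 q p)"
      by (rule small_epsilon[OF c d])
    define \<delta> where "\<delta> = min \<epsilon> (t0 / 2)"
    have \<delta>: "0 < \<delta>" "\<delta> < t0" "\<delta> \<le> \<epsilon>" using e t0 by (auto simp: \<delta>_def)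
    have "c * \<delta> \<le> c * \<epsilon>" using \<delta> c by (intro mult_left_mono) auto
    then show False using key[of "t0 - \<delta>"] \<delta> e by simp
  qed
  then show ?thesis by simp
qed

end

section \<open>Comparison\<close>

lemma dist_pairD:
  assumes "dist (s :: real, y :: real) (t, x) < e"
  shows "\<bar>s - t\<bar> < e" "\<bar>y - x\<bar> < e"
  using assms dist_fst_le[of "(s, y)" "(t, x)"] dist_snd_le[of "(s, y)" "(t, x)"]
  by (auto simp: dist_real_def)

context ham_box
begin

text \<open>Doubling of variables with a quadratic penalty. The Lipschitz bound on \<open>v\<close>
  limits the penalty slopes to \<open>2 * M\<close>, so only the Lipschitz constant of
  \<open>H\<close> on the strip enters; the extra 1 in \<open>2 * M + 1\<close> leaves room for the
  slope of the term that localises in space.\<close>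

lemma comparison_interior:
  assumes lipu: "M-lipschitz_on ({0..T} \<times> UNIV) (\<lambda>z. u (fst z) (snd z))"
    and lipv: "M-lipschitz_on ({0..T} \<times> UNIV) (\<lambda>z. v (fst z) (snd z))"
    and M: "M > 0" and MB: "2 * M + 1 \<le> B"
    and sub: "visc_sub H T u" and super: "visc_super H T v"
    and init: "\<And>x. u 0 x \<le> v 0 x" and t1: "0 < t1" "t1 < T"
  shows "u t1 x1 \<le> v t1 x1"
proof (rule ccontr)
  assume contr: "\<not> ?thesis"
  define \<sigma> where "\<sigma> = u t1 x1 - v t1 x1"
  have \<sigma>: "\<sigma> > 0" using contr by (simp add: \<sigma>_def)
  \<comment> \<open>Since \<open>u 0 \<le> v 0\<close> and both functions are
    \<open>M\<close>-Lipschitz in time, \<open>u - v\<close> stays below \<open>D\<close>; at the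
    maximum the penalties are thus below \<open>D + 1\<close>, the 1 covering the doubling
    error.\<close>
  define D where "D = 2 * M * T"
  have D: "D > 0" using M t1 by (simp add: D_def)
  define T' where "T' = (t1 + T) / 2"
  have T': "t1 < T'" "T' < T" "T' > 0" using t1 by (auto simp: T'_def)
  define \<Lambda> where "\<Lambda> = (D + 2) / (T' - t1)\<^sup>2"
  have \<Lambda>: "\<Lambda> > 0" "\<Lambda> * (T' - t1)\<^sup>2 = D + 2" using T' D by (auto simp: \<Lambda>_def)
  define \<mu> where "\<mu> = \<sigma> / (4 * t1)"
  have \<mu>: "\<mu> > 0" "\<mu> * t1 = \<sigma> / 4" using \<sigma> t1 by (auto simp: \<mu>_def)
  \<comment> \<open>Will bound \<open>\<beta> * x\<close> at the maximum. The localisation then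
    shifts the test slope by at most \<open>2 * \<theta>\<close>, which stays in the strip and costs
    less than \<mu> in \<open>H\<close>.\<close>
  define \<theta> where "\<theta> = min (1 / 2) (\<mu> / (8 * C))"
  have \<theta>: "\<theta> > 0" "\<theta> \<le> 1 / 2" "2 * C * \<theta> \<le> \<mu> / 4"
  proof -
    show "\<theta> > 0" "\<theta> \<le> 1 / 2" using \<mu> C_pos by (auto simp: \<theta>_def)
    have "\<theta> \<le> \<mu> / (8 * C)" by (simp add: \<theta>_def)
    then show "2 * C * \<theta> \<le> \<mu> / 4" using C_pos by (simp add: field_simps)
  qed
  obtain \<beta> where \<beta>: "\<beta> > 0" "(x1\<^sup>2 + (D + 1)) * \<beta> < min (\<sigma> / 4) (\<theta>\<^sup>2)"
    by (rule small_epsilon[of "x1\<^sup>2 + (D + 1)" "min (\<sigma> / 4) (\<theta>\<^sup>2)"]) (use D \<sigma> \<theta> in auto)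
  have \<beta>s: "\<beta> * x1\<^sup>2 \<le> \<sigma> / 4" "\<beta> * (D + 1) \<le> \<theta>\<^sup>2"
  proof -
    have "0 \<le> \<beta> * x1\<^sup>2" "0 \<le> \<beta> * (D + 1)" using \<beta>(1) D by auto
    moreover have "(x1\<^sup>2 + (D + 1)) * \<beta> = \<beta> * x1\<^sup>2 + \<beta> * (D + 1)" by (simp add: algebra_simps)
    ultimately show "\<beta> * x1\<^sup>2 \<le> \<sigma> / 4" "\<beta> * (D + 1) \<le> \<theta>\<^sup>2" using \<beta>(2) by linarith+
  qed
  \<comment> \<open>Large enough that the penalty at \<open>A\<close> or \<open>-A\<close> exceeds
    its maximal admissible value, so that the maximum is interior in \<open>x\<close>.\<close>
  define A where "A = \<bar>x1\<bar> + 1 + (D + 2) / \<beta>"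
  have A1: "A \<ge> 1" "\<bar>x1\<bar> \<le> A" "A > 0" using D \<beta>(1) by (auto simp: A_def add_nonneg_nonneg add_nonneg_pos)
  have A2: "\<beta> * A\<^sup>2 \<ge> D + 2"
  proof -
    have "D + 2 = \<beta> * ((D + 2) / \<beta>)" using \<beta>(1) by simp
    also have "\<dots> \<le> \<beta> * A" using \<beta>(1) by (intro mult_left_mono) (auto simp: A_def)
    also have "\<dots> \<le> \<beta> * A\<^sup>2" using A1 \<beta>(1) by (intro mult_left_mono) (auto simp: power2_eq_square)
    finally show ?thesis .
  qed
  \<comment> \<open>Common tolerance for the doubling errors: 1 keeps \<open>r\<close> interior,
    \<open>\<sigma> / 8\<close> keeps both times positive, \<open>T - T'\<close> keeps
    \<open>s\<close> below \<open>T\<close>, and \<open>\<mu> / 4\<close> serves the final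
    contradiction.\<close>
  define dd where "dd = min (min 1 (\<sigma> / 8)) (min (T - T') (\<mu> / 4))"
  have dd: "dd > 0" "dd \<le> 1" "dd \<le> \<sigma> / 8" "dd \<le> T - T'" "dd \<le> \<mu> / 4"
  proof -
    show "dd > 0" using \<sigma> T' \<mu>(1) by (simp add: dd_def)
    show "dd \<le> 1" "dd \<le> \<sigma> / 8" "dd \<le> T - T'" "dd \<le> \<mu> / 4" unfolding dd_def by linarith+
  qed
  obtain \<epsilon> where \<epsilon>: "\<epsilon> > 0" "(M + 2 * M * M + C * M) * \<epsilon> < dd"
    by (rule small_epsilon[of "M + 2 * M * M + C * M" dd]) (use M C_pos dd in auto)
  have \<epsilon>s: "M * \<epsilon> < dd" "2 * M * (M * \<epsilon>) < dd" "C * (M * \<epsilon>) < dd"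
  proof -
    have "0 \<le> M * \<epsilon>" "0 \<le> 2 * M * (M * \<epsilon>)" "0 \<le> C * (M * \<epsilon>)" using M C_pos \<epsilon>(1) by auto
    moreover have "(M + 2 * M * M + C * M) * \<epsilon> = M * \<epsilon> + 2 * M * (M * \<epsilon>) + C * (M * \<epsilon>)"
      by (simp add: algebra_simps)
    ultimately show "M * \<epsilon> < dd" "2 * M * (M * \<epsilon>) < dd" "C * (M * \<epsilon>) < dd" using \<epsilon>(2) by linarith+
  qed
  define pen where "pen = (\<lambda>t x. \<beta> * x\<^sup>2 + \<mu> * t + \<Lambda> * (max 0 (t - t1))\<^sup>2)"
  \<comment> \<open>The second position is written \<open>x + r\<close> so that the maximum is taken
    over a box; the localising penalties act on the variables of \<open>u\<close> alone, and
    \<open>v\<close> sees only the coupling terms.\<close>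
  define \<Psi> where "\<Psi> = (\<lambda>t x s r. u t x - v s (x + r) - r\<^sup>2 / \<epsilon> - (t - s)\<^sup>2 / \<epsilon> - pen t x)"
  define KK where "KK = {0..T'} \<times> {-A..A} \<times> {0..T} \<times> {-1..1 :: real}"
  have "\<exists>z\<in>KK. \<forall>z'\<in>KK. \<Psi> (fst z') (fst (snd z')) (fst (snd (snd z'))) (snd (snd (snd z')))
      \<le> \<Psi> (fst z) (fst (snd z)) (fst (snd (snd z))) (snd (snd (snd z)))"
  proof (rule continuous_attains_sup)
    show "compact KK" unfolding KK_def by (intro compact_Times compact_Icc)
    show "KK \<noteq> {}" using T' A1 t1 by (auto simp: KK_def)
    have c1: "continuous_on KK (\<lambda>z. (fst z, fst (snd z)))"
      and c2: "continuous_on KK (\<lambda>z. (fst (snd (snd z)), fst (snd z) + snd (snd (snd z))))"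
      by (intro continuous_intros)+
    have i1: "(\<lambda>z. (fst z, fst (snd z))) ` KK \<subseteq> {0..T} \<times> UNIV"
      and i2: "(\<lambda>z. (fst (snd (snd z)), fst (snd z) + snd (snd (snd z)))) ` KK \<subseteq> {0..T} \<times> UNIV"
      using T' by (auto simp: KK_def)
    have cu: "continuous_on KK (\<lambda>z. u (fst z) (fst (snd z)))"
      using continuous_on_compose2[OF lipschitz_on_continuous_on[OF lipu] c1 i1] by simp
    have cv: "continuous_on KK (\<lambda>z. v (fst (snd (snd z))) (fst (snd z) + snd (snd (snd z))))"
      using continuous_on_compose2[OF lipschitz_on_continuous_on[OF lipv] c2 i2] by simp
    show "continuous_on KK (\<lambda>z. \<Psi> (fst z) (fst (snd z)) (fst (snd (snd z))) (snd (snd (snd z))))"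
      unfolding \<Psi>_def pen_def using \<epsilon>(1) by (intro continuous_intros cu cv) auto
  qed
  then obtain t x s r where mem: "t \<in> {0..T'}" "x \<in> {-A..A}" "s \<in> {0..T}" "r \<in> {-1..1}"
    and max: "\<And>t' x' s' r'. t' \<in> {0..T'} \<Longrightarrow> x' \<in> {-A..A} \<Longrightarrow> s' \<in> {0..T} \<Longrightarrow> r' \<in> {-1..1} \<Longrightarrow> \<Psi> t' x' s' r' \<le> \<Psi> t x s r"
    unfolding KK_def by fastforce
  have tT: "t \<in> {0..T}" using mem T' by auto
  define y where "y = x + r"
  have pen0: "0 \<le> \<beta> * x\<^sup>2" "0 \<le> \<mu> * t" "0 \<le> \<Lambda> * (max 0 (t - t1))\<^sup>2"
    using \<beta>(1) \<mu>(1) \<Lambda>(1) mem by auto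
  have low: "\<sigma> / 2 \<le> \<Psi> t x s r"
  proof -
    have "\<Psi> t1 x1 t1 0 = \<sigma> - \<beta> * x1\<^sup>2 - \<mu> * t1" by (simp add: \<Psi>_def pen_def \<sigma>_def)
    moreover have "\<Psi> t1 x1 t1 0 \<le> \<Psi> t x s r" by (rule max) (use t1 T' A1 in auto)
    ultimately show ?thesis using \<beta>s(1) \<mu>(2) by linarith
  qed
  have M0: "M \<ge> 0" using M by simp
  have r: "\<bar>r\<bar> \<le> M * \<epsilon>"
  proof (rule penalised_distance[OF _ \<epsilon>(1) M0])
    have "\<Psi> t x s 0 \<le> \<Psi> t x s r" by (rule max) (use mem in auto)
    then have "r\<^sup>2 / \<epsilon> \<le> v s (x + 0) - v s (x + r)" by (simp add: \<Psi>_def)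
    then show "r\<^sup>2 / \<epsilon> \<le> M * \<bar>r\<bar>"
      using lipschitz_pairD[OF lipv mem(3) mem(3), of "x + 0" "x + r"] by simp
  qed
  have ts: "\<bar>t - s\<bar> \<le> M * \<epsilon>"
  proof (rule penalised_distance[OF _ \<epsilon>(1) M0])
    have "\<Psi> t x t r \<le> \<Psi> t x s r" by (rule max) (use mem tT in auto)
    then have "(t - s)\<^sup>2 / \<epsilon> \<le> v t (x + r) - v s (x + r)" by (simp add: \<Psi>_def)
    then show "(t - s)\<^sup>2 / \<epsilon> \<le> M * \<bar>t - s\<bar>"
      using lipschitz_pairD[OF lipv tT mem(3), of "x + r" "x + r"] by simp
  qed
  have gap: "\<sigma> / 2 + pen t x \<le> 2 * M * t + 2 * M * (M * \<epsilon>)"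
  proof -
    have "u t x \<le> u 0 x + M * t" using lipschitz_pairD[OF lipu tT, of 0 x x] tT by auto
    moreover have "v 0 x \<le> v t x + M * t" using lipschitz_pairD[OF lipv tT, of 0 x x] tT by auto
    moreover have "v t x \<le> v s (x + r) + M * (\<bar>t - s\<bar> + \<bar>r\<bar>)"
      using lipschitz_pairD[OF lipv tT mem(3), of x "x + r"] by simp
    moreover have "M * (\<bar>t - s\<bar> + \<bar>r\<bar>) \<le> M * (M * \<epsilon> + M * \<epsilon>)" using r ts M by (intro mult_left_mono) auto
    moreover have "M * (M * \<epsilon> + M * \<epsilon>) = 2 * M * (M * \<epsilon>)" by simp
    moreover have "0 \<le> r\<^sup>2 / \<epsilon>" "0 \<le> (t - s)\<^sup>2 / \<epsilon>" using \<epsilon>(1) by auto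
    moreover have "u t x - v s (x + r) = \<Psi> t x s r + r\<^sup>2 / \<epsilon> + (t - s)\<^sup>2 / \<epsilon> + pen t x" by (simp add: \<Psi>_def)
    ultimately show ?thesis using low init[of x] by linarith
  qed
  \<comment> \<open>A positive gap needs time to build up from ordered initial values, which
    separates the maximum from the initial time.\<close>
  have t_pos: "2 * M * t \<ge> 3 * (\<sigma> / 8)"
    using gap \<epsilon>s(2) dd(3) pen0 unfolding pen_def by linarith
  have s_pos: "s > 0" and t_pos': "t > 0"
  proof -
    have "2 * M * (M * \<epsilon>) < 2 * M * t" using t_pos \<epsilon>s(2) dd(3) \<sigma> by linarith
    then have "M * \<epsilon> < t" using M by simp
    moreover have "M * \<epsilon> \<ge> 0" using M \<epsilon>(1) by simp
    ultimately show "s > 0" "t > 0" using ts by linarith+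
  qed
  have pen_le: "pen t x < D + 1"
  proof -
    have "2 * M * t \<le> D" unfolding D_def using tT M by (intro mult_left_mono) auto
    then show ?thesis using gap \<epsilon>s(2) dd(2) \<sigma> by linarith
  qed
  have bx: "\<beta> * x\<^sup>2 \<le> D + 1" and lt: "\<Lambda> * (max 0 (t - t1))\<^sup>2 < D + 2"
    using pen_le pen0 unfolding pen_def by linarith+
  have t_less: "t < T'"
  proof (rule ccontr)
    assume "\<not> t < T'"
    then have "t = T'" using mem by auto
    then show False using lt \<Lambda>(2) T' by simp
  qed
  have s_less: "s < T"
  proof -
    have "s \<le> t + M * \<epsilon>" using ts by linarith
    then show ?thesis using t_less \<epsilon>s(1) dd(4) by linarith
  qed
  have x_less: "\<bar>x\<bar> < A"
  proof (rule ccontr)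
    assume "\<not> \<bar>x\<bar> < A"
    then have "A\<^sup>2 \<le> x\<^sup>2" using A1 by (simp add: power2_le_iff_abs_le flip: abs_le_square_iff)
    then have "\<beta> * A\<^sup>2 \<le> \<beta> * x\<^sup>2" using \<beta>(1) by (intro mult_left_mono) auto
    then show False using A2 bx by linarith
  qed
  have r_less: "\<bar>r\<bar> < 1" using r \<epsilon>s(1) dd(2) by linarith
  have y_x: "y - x = r" by (simp add: y_def)
  define e where "e = min (min (T' - t) (A - \<bar>x\<bar>)) (1 - \<bar>r\<bar>)"
  have e: "e > 0" "e \<le> T' - t" "e \<le> A - \<bar>x\<bar>" "e \<le> 1 - \<bar>r\<bar>"
    using t_less x_less r_less unfolding e_def by auto

  define \<phi> where "\<phi> = (\<lambda>t x. (x - y)\<^sup>2 / \<epsilon> + (t - s)\<^sup>2 / \<epsilon> + pen t x)"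
  define \<phi>1 where "\<phi>1 = (\<lambda>t (x::real). 2 * (t - s) / \<epsilon> + \<mu> + \<Lambda> * (2 * max 0 (t - t1)))"
  define \<phi>2 where "\<phi>2 = (\<lambda>(t::real) x. 2 * (x - y) / \<epsilon> + 2 * \<beta> * x)"
  have f1: "((\<lambda>t. \<phi> t x) has_real_derivative \<phi>1 t x) (at t)" for t x
  proof -
    have 1: "((\<lambda>t. (x - y)\<^sup>2 / \<epsilon> + (t - s)\<^sup>2 / \<epsilon>) has_real_derivative 2 * (t - s) / \<epsilon>) (at t)"
      using \<epsilon>(1) by (auto intro!: derivative_eq_intros)
    have 2: "((\<lambda>t. \<beta> * x\<^sup>2 + \<mu> * t) has_real_derivative \<mu>) (at t)"
      by (auto intro!: derivative_eq_intros)
    have 3: "((\<lambda>t. \<Lambda> * (max 0 (t - t1))\<^sup>2) has_real_derivative \<Lambda> * (2 * max 0 (t - t1))) (at t)"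
      by (intro DERIV_cmult DERIV_pos_part_square)
    show ?thesis
      using DERIV_add[OF 1 DERIV_add[OF 2 3]] unfolding \<phi>_def \<phi>1_def pen_def by (simp add: add.assoc)
  qed
  have f2: "((\<lambda>x. \<phi> t x) has_real_derivative \<phi>2 t x) (at x)" for t x
    unfolding \<phi>_def \<phi>2_def pen_def using \<epsilon>(1) by (auto intro!: derivative_eq_intros)
  have "Ck 1 \<phi>" and d\<phi>: "d1 \<phi> = \<phi>1" "d2 \<phi> = \<phi>2"
    by (rule Ck_1I[OF f1 f2];
        (unfold \<phi>_def \<phi>1_def \<phi>2_def pen_def; use \<epsilon>(1) in \<open>intro continuous_intros; simp\<close>))+
  have "loc_max_on (\<lambda>t x. u t x - \<phi> t x) T t x"
    unfolding loc_max_on_def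
  proof (intro exI[of _ e] conjI allI impI)
    fix t' x' assume *: "t' \<in> {0<..<T} \<and> dist (t', x') (t, x) < e"
    then have d: "\<bar>t' - t\<bar> < e" "\<bar>x' - x\<bar> < e" using dist_pairD by blast+
    have "\<Psi> t' x' s (y - x') \<le> \<Psi> t x s r"
    proof (rule max)
      show "t' \<in> {0..T'}" using * d(1) e(2) by auto
      show "x' \<in> {-A..A}" using d(2) e(3) by auto
      show "y - x' \<in> {-1..1}" using d(2) e(4) y_x by auto
    qed (rule mem)
    moreover have "(x' - y)\<^sup>2 = (y - x')\<^sup>2" "(x - y)\<^sup>2 = r\<^sup>2" by (simp_all add: power2_commute y_def)
    ultimately show "u t' x' - \<phi> t' x' \<le> u t x - \<phi> t x" by (simp add: \<Psi>_def \<phi>_def y_def)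
  qed (rule e)
  then have "d1 \<phi> t x + H x (d2 \<phi> t x) \<le> 0"
    using sub \<open>Ck 1 \<phi>\<close> t_pos' t_less T' unfolding visc_sub_def by auto
  moreover define P where "P = 2 * (x - y) / \<epsilon>"
  ultimately have I1: "2 * (t - s) / \<epsilon> + \<mu> + \<Lambda> * (2 * max 0 (t - t1)) + H x (P + 2 * \<beta> * x) \<le> 0"
    unfolding d\<phi> \<phi>1_def \<phi>2_def by simp

  define \<psi> where "\<psi> = (\<lambda>s' y'. - ((x - y')\<^sup>2 / \<epsilon>) - (t - s')\<^sup>2 / \<epsilon>)"
  define \<psi>1 where "\<psi>1 = (\<lambda>s' (y'::real). 2 * (t - s') / \<epsilon>)"
  define \<psi>2 where "\<psi>2 = (\<lambda>(s'::real) y'. 2 * (x - y') / \<epsilon>)"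
  have g1: "((\<lambda>s'. \<psi> s' y') has_real_derivative \<psi>1 s' y') (at s')" for s' y'
    unfolding \<psi>_def \<psi>1_def using \<epsilon>(1) by (auto intro!: derivative_eq_intros simp: field_simps)
  have g2: "((\<lambda>y'. \<psi> s' y') has_real_derivative \<psi>2 s' y') (at y')" for s' y'
    unfolding \<psi>_def \<psi>2_def using \<epsilon>(1) by (auto intro!: derivative_eq_intros simp: field_simps)
  have "Ck 1 \<psi>" and d\<psi>: "d1 \<psi> = \<psi>1" "d2 \<psi> = \<psi>2"
    by (rule Ck_1I[OF g1 g2];
        (unfold \<psi>_def \<psi>1_def \<psi>2_def; use \<epsilon>(1) in \<open>intro continuous_intros; simp\<close>))+
  have "loc_max_on (\<lambda>s y. \<psi> s y - v s y) T s y"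
    unfolding loc_max_on_def
  proof (intro exI[of _ e] conjI allI impI)
    fix s' y' assume *: "s' \<in> {0<..<T} \<and> dist (s', y') (s, y) < e"
    then have d: "\<bar>y' - y\<bar> < e" using dist_pairD by blast
    have "\<Psi> t x s' (y' - x) \<le> \<Psi> t x s r"
    proof (rule max)
      show "s' \<in> {0..T}" using * by auto
      show "y' - x \<in> {-1..1}" using d e(4) y_x by auto
    qed (rule mem)+
    moreover have "(x - y')\<^sup>2 = (y' - x)\<^sup>2" "(x - y)\<^sup>2 = r\<^sup>2" by (simp_all add: power2_commute y_def)
    ultimately show "\<psi> s' y' - v s' y' \<le> \<psi> s y - v s y" by (simp add: \<Psi>_def \<psi>_def y_def)
  qed (rule e)
  then have "d1 \<psi> s y + H y (d2 \<psi> s y) \<ge> 0"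
    using super \<open>Ck 1 \<psi>\<close> s_pos s_less unfolding visc_super_def by auto
  then have I2: "2 * (t - s) / \<epsilon> + H y P \<ge> 0" unfolding d\<psi> \<psi>1_def \<psi>2_def P_def .
  have P: "\<bar>P\<bar> \<le> 2 * M"
  proof -
    have "\<bar>P\<bar> = 2 * \<bar>r\<bar> / \<epsilon>" using \<epsilon>(1) by (simp add: P_def y_def abs_mult)
    also have "\<dots> \<le> 2 * (M * \<epsilon>) / \<epsilon>" using r \<epsilon>(1) by (intro divide_right_mono) auto
    also have "\<dots> = 2 * M" using \<epsilon>(1) by simp
    finally show ?thesis .
  qed
  have bx2: "\<bar>\<beta> * x\<bar> \<le> \<theta>"
  proof -
    have "(\<beta> * x)\<^sup>2 = \<beta> * (\<beta> * x\<^sup>2)" by (simp add: power2_eq_square)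
    also have "\<dots> \<le> \<beta> * (D + 1)" using bx \<beta>(1) by (intro mult_left_mono) auto
    also have "\<dots> \<le> \<theta>\<^sup>2" by (rule \<beta>s)
    finally show ?thesis using \<theta>(1) by (simp add: abs_le_square_iff[symmetric])
  qed
  have PB: "\<bar>P\<bar> \<le> B" "\<bar>P + 2 * \<beta> * x\<bar> \<le> B" using P bx2 \<theta>(2) MB M by (auto simp: mult.assoc)
  have "H y P - H x (P + 2 * \<beta> * x) \<le> C * (\<bar>y - x\<bar> + \<bar>P - (P + 2 * \<beta> * x)\<bar>)"
    using H_lip[OF PB, of y x] by linarith
  also have "\<dots> \<le> C * (M * \<epsilon> + 2 * \<theta>)"
    using r bx2 C_pos by (intro mult_left_mono add_mono) (auto simp: y_x mult.assoc)
  also have "\<dots> = C * (M * \<epsilon>) + 2 * C * \<theta>" by (simp add: algebra_simps)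
  also have "\<dots> < \<mu>" using \<epsilon>s(3) dd(5) \<theta>(3) \<mu>(1) by linarith
  finally have "H y P - H x (P + 2 * \<beta> * x) < \<mu>" .
  moreover have "0 \<le> \<Lambda> * (2 * max 0 (t - t1))" using \<Lambda>(1) by simp
  ultimately show False using I1 I2 by linarith
qed

theorem comparison:
  assumes lipu: "M-lipschitz_on ({0..T} \<times> UNIV) (\<lambda>z. u (fst z) (snd z))"
    and lipv: "M-lipschitz_on ({0..T} \<times> UNIV) (\<lambda>z. v (fst z) (snd z))"
    and M: "M > 0" and MB: "2 * M + 1 \<le> B"
    and sub: "visc_sub H T u" and super: "visc_super H T v"
    and init: "\<And>x. u 0 x \<le> v 0 x" and t: "t \<in> {0..T}"
  shows "u t x \<le> v t x"
proof (rule ccontr)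
  assume contr: "\<not> ?thesis"
  define d where "d = u t x - v t x"
  have d: "d > 0" using contr by (simp add: d_def)
  have "t \<noteq> 0" using contr init by auto
  then have t0: "t > 0" using t by auto
  have "2 * M \<ge> 0" using M by simp
  then obtain \<epsilon> where \<epsilon>: "\<epsilon> > 0" "2 * M * \<epsilon> < d"
    by (rule small_epsilon[OF _ d])
  define \<delta> where "\<delta> = min \<epsilon> (t / 2)"
  have \<delta>: "\<delta> > 0" "\<delta> < t" "\<delta> \<le> \<epsilon>" using t0 \<epsilon> by (auto simp: \<delta>_def)
  have "u (t - \<delta>) x \<le> v (t - \<delta>) x"
    by (rule comparison_interior[OF assms(1-7)]) (use t \<delta> in auto)
  moreover have "\<bar>u t x - u (t - \<delta>) x\<bar> \<le> M * \<delta>"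
    using lipschitz_pairD[OF lipu t, of "t - \<delta>" x x] t \<delta> by simp
  moreover have "\<bar>v t x - v (t - \<delta>) x\<bar> \<le> M * \<delta>"
    using lipschitz_pairD[OF lipv t, of "t - \<delta>" x x] t \<delta> by simp
  moreover have "2 * M * \<delta> \<le> 2 * M * \<epsilon>" using \<delta> M by (intro mult_left_mono) auto
  ultimately show False using \<epsilon>(2) unfolding d_def by linarith
qed

end

section \<open>Statements freed from the truncation\<close>

context hamiltonian
begin

lemma ham_disc_exists:
  assumes "is_lipschitz Uo"
  obtains B C m K E R where "ham_disc H B C m Uo K E R"
proof -
  obtain K where K: "K-lipschitz_on UNIV Uo" using assms by (auto simp: is_lipschitz_def)
  have K0: "K \<ge> 0" using K by (rule lipschitz_on_nonneg)
  \<comment> \<open>A preliminary strip around the slopes of the datum: its bound on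
    \<open>H\<close> becomes the energy level \<open>E\<close>. The width \<open>K + 1\<close> is
    positive even for constant data.\<close>
  obtain E m0 where "ham_box H (K + 1) E m0" using ham_box_exists[of "K + 1"] K0 by auto
  then interpret b0: ham_box H "K + 1" E m0 .
  obtain R where R: "\<forall>x p. H x p \<le> E + 1 \<longrightarrow> \<bar>p\<bar> \<le> R" using H_sublevel_bounded by blast
  have HE: "H x p \<le> E" if "\<bar>p\<bar> \<le> K" for x p
    using b0.H_bound[of p x] that by (simp add: abs_le_iff)
  have "H 0 0 \<le> E" using HE[of 0 0] K0 by simp
  then have "\<bar>0::real\<bar> \<le> R" using R[rule_format, of 0 0] by simp
  then have R0: "R + 1 > 0" by simp
  obtain C m where "ham_box H (R + 1) C m" using ham_box_exists[OF R0] by blast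
  then interpret b1: ham_box H "R + 1" C m .
  have "ham_disc H (R + 1) C m Uo K E R"
  proof
    show "\<bar>Uo x - Uo y\<bar> \<le> K * \<bar>x - y\<bar>" for x y
      using lipschitz_onD[OF K, of x y] by (simp add: dist_real_def)
  qed (use K0 HE R in auto)
  then show ?thesis by (rule that)
qed

lemma visc_comparison:
  assumes u: "\<exists>M. M-lipschitz_on ({0..T} \<times> UNIV) (\<lambda>z. u (fst z) (snd z))"
    and v: "\<exists>M. M-lipschitz_on ({0..T} \<times> UNIV) (\<lambda>z. v (fst z) (snd z))"
    and "visc_sub H T u" "visc_super H T v" "\<And>x. u 0 x \<le> v 0 x" "t \<in> {0..T}"
  shows "u t x \<le> v t x"
proof -
  obtain M1 M2 where M12: "M1-lipschitz_on ({0..T} \<times> UNIV) (\<lambda>z. u (fst z) (snd z))"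
    "M2-lipschitz_on ({0..T} \<times> UNIV) (\<lambda>z. v (fst z) (snd z))"
    using u v by blast
  define M where "M = max 1 (max M1 M2)"
  have M: "M > 0" "M1 \<le> M" "M2 \<le> M" by (auto simp: M_def)
  obtain C m where "ham_box H (2 * M + 1) C m" using ham_box_exists[of "2 * M + 1"] M by auto
  then interpret ham_box H "2 * M + 1" C m .
  show ?thesis
    by (rule comparison[OF lipschitz_on_mono[OF M12(1) subset_refl M(2)] lipschitz_on_mono[OF M12(2) subset_refl M(3)]])
       (use assms M in auto)
qed

lemma hs_sol_momentum_bounded:
  assumes "hs_sol H t q p"
  obtains b where "b > 0" "\<And>s. s \<in> {0..t} \<Longrightarrow> \<bar>p s\<bar> \<le> b"
proof -
  have "continuous_on {0..t} p"
    by (rule DERIV_continuous_on, use assms in \<open>auto simp: hs_sol_def\<close>)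
  then have "bounded (p ` {0..t})" by (intro compact_imp_bounded compact_continuous_image) auto
  then obtain b where "b > 0" "\<forall>x\<in>p ` {0..t}. norm x \<le> b" by (auto simp: bounded_pos)
  then show ?thesis by (intro that[of b]) auto
qed

text \<open>The momenta of orbits in \<open>RT\<close> have no common bound, but each single orbit
  has one by compactness, so the strip is chosen after the orbit.\<close>

lemma visc_sub_le_action:
  assumes U: "\<exists>M. M-lipschitz_on ({0..T} \<times> UNIV) (\<lambda>z. U (fst z) (snd z))" "visc_sub H T U"
    and hs: "hs_sol H T q p" and T: "T \<ge> 0"
  shows "U T (q T) \<le> U 0 (q 0) + hs_action H T q p"
proof -
  obtain M where M: "M-lipschitz_on ({0..T} \<times> UNIV) (\<lambda>z. U (fst z) (snd z))" using U by blast
  obtain b where b: "b > 0" "\<And>s. s \<in> {0..T} \<Longrightarrow> \<bar>p s\<bar> \<le> b" by (rule hs_sol_momentum_bounded[OF hs]) blast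
  define B where "B = max b (2 * M)"
  have B: "B > 0" "b \<le> B" "2 * M \<le> B" using b by (auto simp: B_def)
  obtain C m where "ham_box H B C m" using ham_box_exists[OF B(1)] by blast
  then interpret ham_box H B C m .
  show ?thesis
    using b(2) B T by (intro visc_sub_dominated[OF M B(3) U(2) hs]) force+
qed

text \<open>Gronwall backwards in time, in a strip containing both momenta. This makes the
  description in \<open>piW\<close> determine a unique foot.\<close>

lemma hs_sol_unique:
  assumes hs: "hs_sol H T q p" "hs_sol H T q' p'" and T: "T \<ge> 0"
    and eq: "q T = q' T" "p T = p' T"
  shows "q 0 = q' 0"
proof -
  obtain b where b: "b > 0" "\<And>s. s \<in> {0..T} \<Longrightarrow> \<bar>p s\<bar> \<le> b" by (rule hs_sol_momentum_bounded[OF hs(1)]) blast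
  obtain b' where b': "b' > 0" "\<And>s. s \<in> {0..T} \<Longrightarrow> \<bar>p' s\<bar> \<le> b'" by (rule hs_sol_momentum_bounded[OF hs(2)]) blast
  define B where "B = max b b'"
  have B: "B > 0" "b \<le> B" "b' \<le> B" using b by (auto simp: B_def)
  obtain C m where "ham_box H B C m" using ham_box_exists[OF B(1)] by blast
  then interpret ham_box H B C m .
  have bB: "\<bar>p s\<bar> \<le> B" "\<bar>p' s\<bar> \<le> B" if "s \<in> {0..T}" for s
    using b(2)[OF that] b'(2)[OF that] B by auto
  have "norm ((\<lambda>s. (q s, p s)) 0 - (\<lambda>s. (q' s, p' s)) 0)
      \<le> exp (4 * C * \<bar>0 - T\<bar>) * norm ((\<lambda>s. (q s, p s)) T - (\<lambda>s. (q' s, p' s)) T)"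
    by (rule ode_continuous_dependence[where a=0 and b=T, OF F_lip hs_sol_imp_F[OF hs(1) bB(1)] hs_sol_imp_F[OF hs(2) bB(2)]])
       (use T in auto)
  then show ?thesis using eq by (simp add: zero_prod_def)
qed

lemma Lag_velocity: "Lag H x (d2 H x p) = hs_lagrangian H x p"
  unfolding Lag_def
proof (rule cSup_eq_maximum)
  show "hs_lagrangian H x p \<in> range (\<lambda>p'. p' * d2 H x p - H x p')"
    by (auto simp: hs_lagrangian_def)
  fix z assume "z \<in> range (\<lambda>p'. p' * d2 H x p - H x p')"
  then obtain p' where "z = p' * d2 H x p - H x p'" by blast
  then show "z \<le> hs_lagrangian H x p"
    using H_convex[of x p p'] by (simp add: hs_lagrangian_def algebra_simps)
qed

lemma action_hs_sol:
  assumes "hs_sol H T q p" "T > 0"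
  shows "action H T q = hs_action H T q p"
  unfolding action_def hs_action_def
proof (rule integral_cong)
  fix s assume s: "s \<in> {0..T}"
  have "(q has_vector_derivative d2 H (q s) (p s)) (at s within {0..T})"
    using assms s by (auto simp: hs_sol_def has_real_derivative_iff_has_vector_derivative)
  then have "vector_derivative q (at s within {0..T}) = d2 H (q s) (p s)"
    using assms(2) s by (intro vector_derivative_within_closed_interval) auto
  then show "Lag H (q s) (vector_derivative q (at s within {0..T})) = hs_lagrangian H (q s) (p s)"
    by (simp add: Lag_velocity)
qed

end

section \<open>Left traces of the terminal profile\<close>

context ham_disc
begin

lemma V_slope:
  assumes T: "T > 0"
  obtains q p where "hs_sol H T q p" "q T = x" "\<forall>s\<in>{0..T}. \<bar>p s\<bar> \<le> R"
    "V T x = Uo (q 0) + act T q p"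
    "\<forall>x'. V T x' \<le> V T x + p T * (x' - x) + Csc T T * (x' - x)\<^sup>2"
proof -
  obtain q p where cal: "calibrated T x q p" and V: "V T x = Uo (q 0) + act T q p"
    by (rule V_calibrated[OF T, of x]) blast
  have hs: "hs_sol H T q p" and qe: "q T = x" and pR: "\<forall>s\<in>{0..T}. \<bar>p s\<bar> \<le> R"
    using cal by (auto simp: calibrated_def)
  have pB: "\<bar>p r\<bar> \<le> B" if "r \<in> {0..T}" for r using pR that R_less_B by force
  have "V T x' \<le> V T x + p T * (x' - x) + Csc T T * (x' - x)\<^sup>2" for x'
    using V_semiconcave[OF hs pB, of T T T x'] V T by (simp add: qe)
  then show ?thesis using that hs qe pR V by blast
qed

text \<open>Semiconcavity makes \<open>x \<mapsto> p T - 2 * c * x\<close> antitone, where \<open>p T\<close> is the final momentum of a chosen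
  minimiser ending in \<open>x\<close>; the left trace is its left limit, and is attained by a limit of minimisers.\<close>
theorem left_trace_calibrated:
  assumes T: "T > 0"
  obtains q p where "hs_sol H T q p" "q T = x" "p T = left_trace (V T) x" "\<forall>s\<in>{0..T}. \<bar>p s\<bar> \<le> R"
    "V T x = Uo (q 0) + act T q p"
proof -
  define W where "W = V T"
  define c where "c = Csc T T"
  have "\<forall>y. \<exists>q p. hs_sol H T q p \<and> q T = y \<and> (\<forall>s\<in>{0..T}. \<bar>p s\<bar> \<le> R) \<and> W y = Uo (q 0) + act T q p \<and>
      (\<forall>x'. W x' \<le> W y + p T * (x' - y) + c * (x' - y)\<^sup>2)"
  proof
    fix y
    obtain q p where "hs_sol H T q p" "q T = y" "\<forall>s\<in>{0..T}. \<bar>p s\<bar> \<le> R" "V T y = Uo (q 0) + act T q p"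
      "\<forall>x'. V T x' \<le> V T y + p T * (x' - y) + Csc T T * (x' - y)\<^sup>2"
      by (rule V_slope[OF T])
    then show "\<exists>q p. hs_sol H T q p \<and> q T = y \<and> (\<forall>s\<in>{0..T}. \<bar>p s\<bar> \<le> R) \<and> W y = Uo (q 0) + act T q p \<and>
      (\<forall>x'. W x' \<le> W y + p T * (x' - y) + c * (x' - y)\<^sup>2)"
      unfolding W_def c_def by blast
  qed
  then obtain Q P where QP: "\<forall>y. hs_sol H T (Q y) (P y) \<and> Q y T = y \<and> (\<forall>s\<in>{0..T}. \<bar>P y s\<bar> \<le> R) \<and>
      W y = Uo (Q y 0) + act T (Q y) (P y) \<and> (\<forall>x'. W x' \<le> W y + P y T * (x' - y) + c * (x' - y)\<^sup>2)"
    by (metis (no_types, lifting))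
  have hs: "hs_sol H T (Q y) (P y)" and qe: "Q y T = y" and pR: "s \<in> {0..T} \<Longrightarrow> \<bar>P y s\<bar> \<le> R"
    and Wy: "W y = Uo (Q y 0) + act T (Q y) (P y)"
    and sc: "W x' \<le> W y + P y T * (x' - y) + c * (x' - y)\<^sup>2" for y s x'
    using QP by blast+
  have cW: "continuous_on UNIV W"
  proof (rule continuous_on_compose2[of "{0..T} \<times> UNIV" "\<lambda>z. V (fst z) (snd z)" UNIV "\<lambda>y. (T, y)", simplified fst_conv snd_conv, folded W_def])
    obtain M where "M-lipschitz_on ({0..T} \<times> UNIV) (\<lambda>z. V (fst z) (snd z))" using V_lipschitz[OF T] by blast
    then show "continuous_on ({0..T} \<times> UNIV) (\<lambda>z. V (fst z) (snd z))" by (rule lipschitz_on_continuous_on)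
    show "continuous_on UNIV (Pair T)" by (intro continuous_intros)
    show "range (Pair T) \<subseteq> {0..T} \<times> UNIV" using T by auto
  qed
  \<comment> \<open>Subtracting the parabola turns semiconcavity into concavity; \<open>kk y\<close>
    is a supergradient of \<open>g\<close> at \<open>y\<close>, and supergradients of a concave
    function are antitone.\<close>
  define g where "g = (\<lambda>y. W y - c * y\<^sup>2)"
  define kk where "kk = (\<lambda>y. P y T - 2 * c * y)"
  have gs: "g x' \<le> g y + kk y * (x' - y)" for x' y
    using sc[of x' y] by (simp add: g_def kk_def power2_eq_square algebra_simps)
  have anti: "kk x' \<le> kk y" if "y \<le> x'" for y x'
  proof (cases "y = x'")
    case False
    have "0 \<le> (kk y - kk x') * (x' - y)" using gs[of x' y] gs[of y x'] by (simp add: algebra_simps)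
    then show ?thesis using False that by (simp add: zero_le_mult_iff)
  qed simp
  \<comment> \<open>At \<open>y\<close> the profile touches from below a parabola of slope
    \<open>P y T\<close>; where it is differentiable, the two slopes must agree.\<close>
  have der: "deriv W y = P y T" if dy: "W differentiable (at y)" for y
  proof -
    obtain D where D: "(W has_real_derivative D) (at y)" using dy unfolding real_differentiable_def by blast
    define w where "w = (\<lambda>x'. W y + P y T * (x' - y) + c * (x' - y)\<^sup>2 - W x')"
    have "(w has_real_derivative P y T - D) (at y)"
      unfolding w_def by (auto intro!: derivative_eq_intros D)
    moreover have "\<forall>x'. \<bar>y - x'\<bar> < 1 \<longrightarrow> w y \<le> w x'" using sc[of _ y] by (simp add: w_def)
    ultimately have "P y T - D = 0" by (intro DERIV_local_min[of w _ y 1]) auto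
    then show ?thesis using DERIV_imp_deriv[OF D] by simp
  qed
  \<comment> \<open>Difference quotients of \<open>g\<close> lie between the supergradients at the
    two ends, so continuity of \<open>kk\<close> at \<open>y\<close> squeezes them.\<close>
  have diff: "W differentiable (at y)" if "isCont kk y" for y
  proof -
    have "(g has_real_derivative kk y) (at y)"
      unfolding has_field_derivative_iff
    proof (rule LIM_zero_cancel, rule Lim_null_comparison)
      have "\<bar>(g x' - g y) / (x' - y) - kk y\<bar> \<le> \<bar>kk x' - kk y\<bar>" if "x' \<noteq> y" for x'
      proof (cases "x' > y")
        case True
        have "kk x' \<le> (g x' - g y) / (x' - y)" "(g x' - g y) / (x' - y) \<le> kk y"
          using gs[of x' y] gs[of y x'] True by (auto simp: field_simps)
        then show ?thesis by linarith
      next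
        case False
        then have lt: "x' < y" using that by simp
        have "(g x' - g y) / (x' - y) \<le> kk x'" "kk y \<le> (g x' - g y) / (x' - y)"
          using gs[of x' y] gs[of y x'] lt by (auto simp: field_simps)
        then show ?thesis by linarith
      qed
      then show "\<forall>\<^sub>F x' in at y. norm ((g x' - g y) / (x' - y) - kk y) \<le> \<bar>kk x' - kk y\<bar>"
        by (simp add: eventually_at_filter)
      have "((\<lambda>x'. \<bar>kk x' - kk y\<bar>) \<longlongrightarrow> \<bar>kk y - kk y\<bar>) (at y)"
        using that by (intro tendsto_intros) (simp add: isCont_def)
      then show "((\<lambda>x'. \<bar>kk x' - kk y\<bar>) \<longlongrightarrow> 0) (at y)" by simp
    qed
    then have "((\<lambda>y. g y + c * y\<^sup>2) has_real_derivative kk y + c * (2 * y)) (at y)"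
      by (auto intro!: derivative_eq_intros)
    then show ?thesis unfolding real_differentiable_def by (auto simp: g_def)
  qed
  define S where "S = {..<x} \<inter> {y. W differentiable (at y)}"
  \<comment> \<open>A monotone function has countably many discontinuities. Hence differentiability
    points accumulate at \<open>x\<close> from the left, and the limit defining the left trace is
    unique.\<close>
  have dense: "\<exists>y\<in>S. a < y" if "a < x" for a
  proof -
    have "mono (\<lambda>y. - kk y)" using anti by (auto simp: mono_def)
    then have "countable {y. \<not> isCont (\<lambda>y. - kk y) y}" by (rule mono_ctble_discont)
    then have "\<not> {a<..<x} \<subseteq> {y. \<not> isCont (\<lambda>y. - kk y) y}"
      using uncountable_open_interval[of a x] that countable_subset by blast
    then obtain y where y: "y \<in> {a<..<x}" "isCont (\<lambda>y. - kk y) y" by blast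
    then have "isCont kk y" using continuous_minus[OF y(2)] by simp
    then show ?thesis using diff y(1) by (auto simp: S_def)
  qed
  define L where "L = Inf (kk ` {..<x})"
  have bdd: "bdd_below (kk ` {..<x})" using anti[of _ x] by (intro bdd_belowI2[of _ "kk x"]) auto
  have limkk: "(kk \<longlongrightarrow> L) (at_left x)"
  proof (rule decreasing_tendsto)
    show "\<forall>\<^sub>F y in at_left x. L \<le> kk y"
      unfolding eventually_at_filter L_def by (auto intro!: always_eventually cInf_lower bdd)
    fix l' assume "L < l'"
    then obtain y0 where y0: "y0 < x" "kk y0 < l'"
      using cInf_lessD[of "kk ` {..<x}" l'] by (auto simp: L_def)
    have "kk y < l'" if "y \<in> {y0<..<x}" for y
      using le_less_trans[OF anti y0(2), of y] that by simp
    then show "\<forall>\<^sub>F y in at_left x. kk y < l'"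
      using eventually_at_left_real[OF y0(1)] by (rule eventually_mono[rotated])
  qed
  define l where "l = L + 2 * c * x"
  have limk: "((\<lambda>y. P y T) \<longlongrightarrow> l) (at_left x)"
  proof -
    have "((\<lambda>y. kk y + 2 * c * y) \<longlongrightarrow> l) (at_left x)"
      unfolding l_def by (intro tendsto_intros limkk)
    then show ?thesis by (simp add: kk_def)
  qed
  have limS: "((\<lambda>y. deriv W y) \<longlongrightarrow> l) (at x within S)"
  proof (rule Lim_transform_within[OF _ zero_less_one])
    show "((\<lambda>y. P y T) \<longlongrightarrow> l) (at x within S)"
      using limk by (rule tendsto_within_subset) (auto simp: S_def)
  qed (auto simp: S_def der)
  have "x islimpt S"
    unfolding islimpt_approachable
  proof (intro allI impI)
    fix e :: real assume "e > 0"
    then obtain y where "y \<in> S" "x - e < y" using dense[of "x - e"] by auto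
    then show "\<exists>x'\<in>S. x' \<noteq> x \<and> dist x' x < e" by (intro bexI[of _ y]) (auto simp: S_def dist_real_def)
  qed
  then have nb: "at x within S \<noteq> bot" by (simp add: trivial_limit_within)
  have trace: "left_trace W x = l"
    unfolding left_trace_def S_def[symmetric]
    by (rule the_equality[where P="\<lambda>l. ((\<lambda>y. deriv W y) \<longlongrightarrow> l) (at x within S)"])
       (use limS nb tendsto_unique in blast)+
  define y where "y = (\<lambda>n. x - inverse (real (Suc n)))"
  have ylim: "y \<longlonglongrightarrow> x"
    unfolding y_def using tendsto_diff[OF tendsto_const LIMSEQ_inverse_real_of_nat, of x] by simp
  have klim: "(\<lambda>n. P (y n) T) \<longlonglongrightarrow> l"
  proof (rule filterlim_compose[OF limk])
    show "filterlim y (at_left x) sequentially"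
      unfolding filterlim_at using ylim by (auto simp: y_def)
  qed
  have RB: "R \<le> B" and T0: "T \<ge> 0" using R_less_B T by auto
  have pB: "\<bar>P y' s\<bar> \<le> B" if "s \<in> {0..T}" for y' s using pR[OF that, of y'] RB by simp
  have "norm (Q (y n) 0) \<le> \<bar>x\<bar> + C * T + 1" for n
  proof -
    have "\<bar>Q (y n) 0 - Q (y n) T\<bar> \<le> C * \<bar>0 - T\<bar>"
      by (rule hs_sol_lipschitz(1)[OF hs pB]) (use T in auto)
    moreover have "\<bar>y n - x\<bar> \<le> 1" by (simp add: y_def field_simps)
    moreover have "C * \<bar>0 - T\<bar> = C * T" using T by simp
    ultimately show ?thesis unfolding qe real_norm_def by linarith
  qed
  then have bd: "bounded (range (\<lambda>n. Q (y n) 0))"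
    by (intro boundedI[of _ "\<bar>x\<bar> + C * T + 1"]) blast
  obtain r q' p' where r: "strict_mono (r :: nat \<Rightarrow> nat)" and hs': "hs_sol H T q' p'"
    and pR': "\<forall>s\<in>{0..T}. \<bar>p' s\<bar> \<le> R"
    and ql: "\<forall>s\<in>{0..T}. (\<lambda>n. Q (y (r n)) s) \<longlonglongrightarrow> q' s"
    and pl: "\<forall>s\<in>{0..T}. (\<lambda>n. P (y (r n)) s) \<longlonglongrightarrow> p' s"
    and al: "(\<lambda>n. integral {0..T} (\<lambda>s. ell (Q (y (r n)) s) (P (y (r n)) s))) \<longlonglongrightarrow> integral {0..T} (\<lambda>s. ell (q' s) (p' s))"
    by (rule hs_sol_limit[of T "\<lambda>n. Q (y n)" "\<lambda>n. P (y n)" R, OF hs pR RB T0 bd])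
  have mem: "0 \<in> {0..T}" "T \<in> {0..T}" using T by auto
  have yr: "(\<lambda>n. y (r n)) \<longlonglongrightarrow> x" using LIMSEQ_subseq_LIMSEQ[OF ylim r] by (simp add: comp_def)
  have kr: "(\<lambda>n. P (y (r n)) T) \<longlonglongrightarrow> l" using LIMSEQ_subseq_LIMSEQ[OF klim r] by (simp add: comp_def)
  have "q' T = x" using LIMSEQ_unique[OF ql[rule_format, OF mem(2)]] yr by (simp add: qe)
  moreover have "p' T = left_trace W x" using LIMSEQ_unique[OF pl[rule_format, OF mem(2)] kr] by (simp add: trace)
  moreover have "W x = Uo (q' 0) + act T q' p'"
  proof (rule LIMSEQ_unique)
    have "isCont W x" using cW by (simp add: continuous_on_eq_continuous_at)
    then show "(\<lambda>n. W (y (r n))) \<longlonglongrightarrow> W x" by (rule isCont_tendsto_compose[OF _ yr])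
    have "isCont Uo (q' 0)" using Uo_continuous[of UNIV] by (simp add: continuous_on_eq_continuous_at)
    then have "(\<lambda>n. Uo (Q (y (r n)) 0)) \<longlonglongrightarrow> Uo (q' 0)" by (rule isCont_tendsto_compose[OF _ ql[rule_format, OF mem(1)]])
    from tendsto_add[OF this al] show "(\<lambda>n. W (y (r n))) \<longlonglongrightarrow> Uo (q' 0) + act T q' p'"
      by (simp add: Wy hs_action_def)
  qed
  ultimately show ?thesis using that hs' pR' unfolding W_def by blast
qed

end

section \<open>Initial data leading to a given terminal profile\<close>

context hamiltonian
begin

text \<open>Any two viscosity solutions agree by comparison, so every solution is the value function \<open>V\<close> of its
  initial datum and inherits its minimisers.\<close>
lemma terminal_calibrated:
  assumes "Uo \<in> IHJ H T W" and T: "T > 0"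
  obtains R where "\<forall>x. \<exists>q p. hs_sol H T q p \<and> q T = x \<and> p T = left_trace W x \<and>
    (\<forall>s\<in>{0..T}. \<bar>p s\<bar> \<le> R) \<and> W x = Uo (q 0) + hs_action H T q p"
proof -
  obtain U where Uo: "is_lipschitz Uo" and U: "visc_sol H T Uo U" "U T = W"
    using assms(1) by (auto simp: IHJ_def)
  obtain B C m K E R where "ham_disc H B C m Uo K E R" by (rule ham_disc_exists[OF Uo])
  then interpret ham_disc H B C m Uo K E R .
  have lip: "\<exists>M. M-lipschitz_on ({0..T} \<times> UNIV) (\<lambda>z. U (fst z) (snd z))"
    and sub: "visc_sub H T U" and super: "visc_super H T U" and U0: "U 0 x = Uo x" for x
    using U(1) unfolding visc_sol_def by blast+
  have TT: "T \<in> {0..T}" using T by simp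
  have "U T x = V T x" for x
  proof (rule antisym)
    show "U T x \<le> V T x"
      by (rule visc_comparison[OF lip V_lipschitz[OF T] sub V_visc_super _ TT]) (simp add: U0 V_0)
    show "V T x \<le> U T x"
      by (rule visc_comparison[OF V_lipschitz[OF T] lip V_visc_sub super _ TT]) (simp add: U0 V_0)
  qed
  then have W: "V T = W" using U(2) by auto
  have "\<forall>x. \<exists>q p. hs_sol H T q p \<and> q T = x \<and> p T = left_trace W x \<and>
    (\<forall>s\<in>{0..T}. \<bar>p s\<bar> \<le> R) \<and> W x = Uo (q 0) + hs_action H T q p"
  proof
    fix x
    obtain q p where "hs_sol H T q p" "q T = x" "p T = left_trace (V T) x" "\<forall>s\<in>{0..T}. \<bar>p s\<bar> \<le> R"
      "V T x = Uo (q 0) + act T q p"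
      by (rule left_trace_calibrated[OF T])
    then show "\<exists>q p. hs_sol H T q p \<and> q T = x \<and> p T = left_trace W x \<and>
      (\<forall>s\<in>{0..T}. \<bar>p s\<bar> \<le> R) \<and> W x = Uo (q 0) + hs_action H T q p"
      unfolding W by blast
  qed
  then show ?thesis by (rule that)
qed

lemma piW_eq:
  assumes "hs_sol H T q p" "p T = left_trace W (q T)" and T: "T > 0"
  shows "piW H T W (q T) = q 0"
  unfolding piW_def
proof (rule the_equality)
  show "\<exists>q' p'. hs_sol H T q' p' \<and> q' T = q T \<and> p' T = left_trace W (q T) \<and> q' 0 = q 0"
    using assms by blast
  fix y assume "\<exists>q' p'. hs_sol H T q' p' \<and> q' T = q T \<and> p' T = left_trace W (q T) \<and> q' 0 = y"
  then obtain q' p' where "hs_sol H T q' p'" "q' T = q T" "p' T = left_trace W (q T)" "q' 0 = y" by blast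
  then show "y = q 0" using hs_sol_unique[of T q' p' q p] assms by auto
qed

lemma IHJ_imp_le_action:
  assumes "Uo \<in> IHJ H T W" and T: "T > 0" and q: "q \<in> RT H T"
  shows "W (q T) - action H T q \<le> Uo (q 0)"
proof -
  obtain p where p: "hs_sol H T q p" using q by (auto simp: RT_def)
  obtain U where U: "visc_sol H T Uo U" "U T = W" using assms(1) by (auto simp: IHJ_def)
  have "U T (q T) \<le> U 0 (q 0) + hs_action H T q p"
    using U(1) p T unfolding visc_sol_def by (intro visc_sub_le_action) auto
  then show ?thesis using U action_hs_sol[OF p T] by (simp add: visc_sol_def)
qed

text \<open>The existence of one admissible datum bounds the family under the supremum, which makes
  \<open>SUP\<close> over the reals a genuine least upper bound.\<close>

lemma Ustar_upper:
  assumes "Uo \<in> IHJ H T W" and T: "T > 0" and hs: "hs_sol H T q p"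
  shows "W (q T) - hs_action H T q p \<le> Ustar H T W (q 0)"
  unfolding Ustar_def
proof (rule cSUP_upper2)
  show "q \<in> {q' \<in> RT H T. q' 0 = q 0}" using hs by (auto simp: RT_def)
  show "W (q T) - hs_action H T q p \<le> W (q T) - action H T q" by (simp add: action_hs_sol[OF hs T])
  show "bdd_above ((\<lambda>q. W (q T) - action H T q) ` {q' \<in> RT H T. q' 0 = q 0})"
    using IHJ_imp_le_action[OF assms(1) T] by (intro bdd_aboveI2[of _ _ "Uo (q 0)"]) force
qed

text \<open>The supremum must range over a nonempty family to be controlled; the global orbit with
  zero initial momentum issued from \<open>x\<close> provides a member.\<close>

lemma Ustar_le:
  assumes "Uo \<in> IHJ H T W" and T: "T > 0"
  shows "Ustar H T W x \<le> Uo x"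
  unfolding Ustar_def
proof (rule cSUP_least)
  have Uo: "is_lipschitz Uo" using assms(1) by (auto simp: IHJ_def)
  obtain B C m K E R where "ham_disc H B C m Uo K E R" by (rule ham_disc_exists[OF Uo])
  then interpret ham_disc H B C m Uo K E R .
  obtain q p where "hs_sol H T q p" "q 0 = x" by (rule hs_sol_from[of T x]) (use T in auto)
  then show "{q \<in> RT H T. q 0 = x} \<noteq> {}" by (auto simp: RT_def)
  show "W (q T) - action H T q \<le> Uo x" if "q \<in> {q \<in> RT H T. q 0 = x}" for q
    using IHJ_imp_le_action[OF assms, of q] that by auto
qed

text \<open>Equality passes to the closure because a bounded family of minimisers is relatively compact.\<close>
lemma Ustar_eq_closure:
  assumes Uo: "Uo \<in> IHJ H T W" and W: "is_lipschitz W" and T: "T > 0"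
    and x: "x \<in> closure (range (piW H T W))"
  shows "Uo x = Ustar H T W x"
proof (rule antisym)
  show "Ustar H T W x \<le> Uo x" by (rule Ustar_le[OF Uo T])
  obtain R where R: "\<forall>x. \<exists>q p. hs_sol H T q p \<and> q T = x \<and> p T = left_trace W x \<and>
    (\<forall>s\<in>{0..T}. \<bar>p s\<bar> \<le> R) \<and> W x = Uo (q 0) + hs_action H T q p"
    by (rule terminal_calibrated[OF Uo T])
  obtain Y where Y: "\<And>n. Y n \<in> range (piW H T W)" "Y \<longlonglongrightarrow> x"
    using x by (auto simp: closure_sequential)
  have "\<forall>n. \<exists>q p. hs_sol H T q p \<and> q 0 = Y n \<and> (\<forall>s\<in>{0..T}. \<bar>p s\<bar> \<le> R) \<and> W (q T) = Uo (Y n) + hs_action H T q p"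
  proof
    fix n
    obtain y where y: "Y n = piW H T W y" using Y(1) by blast
    obtain q p where qp: "hs_sol H T q p" "q T = y" "p T = left_trace W y" "\<forall>s\<in>{0..T}. \<bar>p s\<bar> \<le> R"
      "W y = Uo (q 0) + hs_action H T q p"
      using R by blast
    have "q 0 = Y n" using piW_eq[OF qp(1) _ T, of W] qp y by simp
    then show "\<exists>q p. hs_sol H T q p \<and> q 0 = Y n \<and> (\<forall>s\<in>{0..T}. \<bar>p s\<bar> \<le> R) \<and> W (q T) = Uo (Y n) + hs_action H T q p"
      using qp by auto
  qed
  then obtain q p where qp: "\<forall>n. hs_sol H T (q n) (p n) \<and> q n 0 = Y n \<and> (\<forall>s\<in>{0..T}. \<bar>p n s\<bar> \<le> R) \<and>
      W (q n T) = Uo (Y n) + hs_action H T (q n) (p n)"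
    by (metis (no_types, lifting))
  have hs: "hs_sol H T (q n) (p n)" and q0: "q n 0 = Y n" and pR: "s \<in> {0..T} \<Longrightarrow> \<bar>p n s\<bar> \<le> R"
    and Wq: "W (q n T) = Uo (Y n) + hs_action H T (q n) (p n)" for n s
    using qp by blast+
  \<comment> \<open>\<open>R\<close> comes without a sign, and a strip needs positive width.\<close>
  define B where "B = max 1 R"
  have B: "B > 0" "R \<le> B" by (auto simp: B_def)
  have T0: "T \<ge> 0" using T by simp
  obtain C m where "ham_box H B C m" using ham_box_exists[OF B(1)] by blast
  then interpret ham_box H B C m .
  have bd: "bounded (range (\<lambda>n. q n 0))"
    using convergent_imp_bounded[OF Y(2)] by (simp add: q0)
  obtain r q' p' where r: "strict_mono (r :: nat \<Rightarrow> nat)" and hs': "hs_sol H T q' p'"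
    and pR': "\<forall>s\<in>{0..T}. \<bar>p' s\<bar> \<le> R"
    and ql: "\<forall>s\<in>{0..T}. (\<lambda>n. q (r n) s) \<longlonglongrightarrow> q' s"
    and pl: "\<forall>s\<in>{0..T}. (\<lambda>n. p (r n) s) \<longlonglongrightarrow> p' s"
    and al: "(\<lambda>n. integral {0..T} (\<lambda>s. ell (q (r n) s) (p (r n) s))) \<longlonglongrightarrow> integral {0..T} (\<lambda>s. ell (q' s) (p' s))"
    by (rule hs_sol_limit[of T q p R, OF hs pR B(2) T0 bd])
  have cont: "isCont f y" if "is_lipschitz f" for f y
    using that lipschitz_on_continuous_on
    unfolding is_lipschitz_def by (metis UNIV_I continuous_on_eq_continuous_at open_UNIV)
  have Yr: "(\<lambda>n. Y (r n)) \<longlonglongrightarrow> x" using LIMSEQ_subseq_LIMSEQ[OF Y(2) r] by (simp add: comp_def)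
  have mem: "0 \<in> {0..T}" "T \<in> {0..T}" using T by auto
  have x0: "q' 0 = x" using LIMSEQ_unique[OF ql[rule_format, OF mem(1)]] Yr by (simp add: q0)
  have "W (q' T) = Uo x + hs_action H T q' p'"
  proof (rule LIMSEQ_unique)
    show "(\<lambda>n. W (q (r n) T)) \<longlonglongrightarrow> W (q' T)"
      by (rule isCont_tendsto_compose[OF cont[OF W] ql[rule_format, OF mem(2)]])
    have "is_lipschitz Uo" using Uo by (auto simp: IHJ_def)
    then have "(\<lambda>n. Uo (Y (r n))) \<longlonglongrightarrow> Uo x" by (rule isCont_tendsto_compose[OF cont Yr])
    from tendsto_add[OF this al] show "(\<lambda>n. W (q (r n) T)) \<longlonglongrightarrow> Uo x + hs_action H T q' p'"
      by (simp add: Wq hs_action_def)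
  qed
  then show "Uo x \<le> Ustar H T W x" using Ustar_upper[OF Uo T hs'] x0 by simp
qed

text \<open>In the converse direction a reference datum \<open>U1\<close> from the nonempty preimage
  supplies both the boundedness of the supremum and the orbits with momentum given by the left
  trace. Domination by \<open>Ustar\<close> is tested on minimisers for \<open>Uo\<close>, equality
  on the feet is tested on minimisers for \<open>U1\<close>.\<close>

lemma IHJ_characterisation:
  assumes T: "T > 0" and W: "is_lipschitz W" and ne: "IHJ H T W \<noteq> {}" and Uo: "is_lipschitz Uo"
  shows "Uo \<in> IHJ H T W \<longleftrightarrow>
    (\<forall>x. Uo x \<ge> Ustar H T W x) \<and> (\<forall>x \<in> closure (range (piW H T W)). Uo x = Ustar H T W x)"
proof (intro iffI conjI allI ballI)
  fix x assume "Uo \<in> IHJ H T W"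
  then show "Uo x \<ge> Ustar H T W x" using T by (rule Ustar_le)
next
  fix x assume "Uo \<in> IHJ H T W" "x \<in> closure (range (piW H T W))"
  then show "Uo x = Ustar H T W x" using Ustar_eq_closure W T by blast
next
  assume A: "(\<forall>x. Uo x \<ge> Ustar H T W x) \<and> (\<forall>x \<in> closure (range (piW H T W)). Uo x = Ustar H T W x)"
  obtain U1 where U1: "U1 \<in> IHJ H T W" using ne by blast
  obtain R1 where cal: "\<forall>x. \<exists>q p. hs_sol H T q p \<and> q T = x \<and> p T = left_trace W x \<and>
    (\<forall>s\<in>{0..T}. \<bar>p s\<bar> \<le> R1) \<and> W x = U1 (q 0) + hs_action H T q p"
    by (rule terminal_calibrated[OF U1 T])
  obtain B C m K E R where "ham_disc H B C m Uo K E R" by (rule ham_disc_exists[OF Uo])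
  then interpret ham_disc H B C m Uo K E R .
  note V = V_visc_sol[OF T]
  have "V T x = W x" for x
  proof (rule antisym)
    obtain q p where qp: "hs_sol H T q p" "q T = x" "p T = left_trace W x" "W x = U1 (q 0) + hs_action H T q p"
      using cal by blast
    have "q 0 = piW H T W x" using piW_eq[OF qp(1) _ T, of W] qp by simp
    then have cl: "q 0 \<in> closure (range (piW H T W))"
      using closure_subset[of "range (piW H T W)"] by auto
    \<comment> \<open>Both data equal \<open>Ustar\<close> at this foot, so the optimal orbit for
      \<open>U1\<close> has the same cost when started from \<open>Uo\<close>.\<close>
    then have "Uo (q 0) = U1 (q 0)" using A Ustar_eq_closure[OF U1 W T cl] by simp
    moreover have "V T (q T) \<le> V 0 (q 0) + hs_action H T q p"
      using V qp(1) T unfolding visc_sol_def by (intro visc_sub_le_action) auto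
    ultimately show "V T x \<le> W x" using qp by (simp add: V_0)
    obtain q p where q: "hs_sol H T q p" "q T = x" "V T x = Uo (q 0) + act T q p"
      by (rule V_slope[OF T, of x])
    have "W (q T) - act T q p \<le> Ustar H T W (q 0)" by (rule Ustar_upper[OF U1 T q(1)])
    also have "\<dots> \<le> Uo (q 0)" using A by blast
    finally show "W x \<le> V T x" using q by simp
  qed
  then have "V T = W" by auto
  then show "Uo \<in> IHJ H T W" using Uo V by (auto simp: IHJ_def)
qed

end

theorem theorem3p3:
  fixes H :: "real \<Rightarrow> real \<Rightarrow> real" and T :: real and W :: "real \<Rightarrow> real"
  assumes "hyp_C3 H" and "hyp_CNH H" and "hyp_CVX H"
    and "T > 0" and "is_lipschitz W" and "IHJ H T W \<noteq> {}"
    and "is_lipschitz Uo"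
  shows "Uo \<in> IHJ H T W \<longleftrightarrow>
           ((\<forall>x. Uo x \<ge> Ustar H T W x) \<and>
            (\<forall>x \<in> closure (range (piW H T W)). Uo x = Ustar H T W x))"
proof -
  interpret hamiltonian H by unfold_locales (fact assms)+
  show ?thesis by (rule IHJ_characterisation[OF assms(4-7)])
qed

end
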